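(* For every topological space $X$, the following are equivalent: 1. $\pi_1^{top}(\Sigma(X_+))$ is a topological group. 2. $\pi_1^{top}(\Sigma(X_+))$ is topologically isomorphic to the free topological group $F_M(\pi_0^{top}(X))$. 3. The identity homomorphisms $\Phi_X:F_R(\pi_0^{top}(X))\to F_M(\pi_0^{top}(X))$ and $\Psi_X:F_R^{P_X}(\pi_0^{top}(X))\to F_R(\pi_0^{top}(X))$ are topological isomorphisms.
   Context: For a space $Z$, $\pi_0^{top}(Z)$ is the set $\pi_0(Z)$ of path components of $Z$ with the quotient topology from the canonical map $P_Z:Z\to\pi_0(Z)$. For a based space $(Z,z)$, $\pi_1^{top}(Z,z)$ is $\pi_1(Z,z)$ with the quotient topology from the loop space $\Omega(Z,z)$ (compact-open topology). For a space $X$, $X_+=X\sqcup\{*\}$ is $X$ with a disjoint basepoint, and $\Sigma(X_+)=\dfrac{X_+\times I}{X\times\{0,1\}\cup\{*\}\times I}$ ($I=[0,1]$) is the reduced suspension, based at the image of the collapsed set. For a space $Y$, $F(Y)$ is the free group on the underlying set of $Y$. $F_M(Y)$ is the free (Markov) topological group on $Y$: the group $F(Y)$ with the group topology such that the canonical injection $\sigma:Y\to F_M(Y)$ is continuous and every continuous map $f:Y\to G$ to a topological group $G$ extends uniquely to a continuous homomorphism $\tilde f:F_M(Y)\to G$ with $\tilde f\circ\sigma=f$. Let $Y^{-1}$ be a homeomorphic copy of $Y$, $M_T^*(Y)=\coprod_{n\ge 0}(Y\sqcup Y^{-1})^n$ the free topological monoid on $Y\sqcup Y^{-1}$ (words under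 concatenation), and $R:M_T^*(Y)\to F(Y)$ reduction of words. $F_R(Y)$ is $F(Y)$ with the quotient topology with respect to $R$. There is a canonical continuous bijection $\psi_X:\pi_0^{top}(M_T^*(X))\to M_T^*(\pi_0^{top}(X))$ sending the path component of $x_1^{\epsilon_1}\cdots x_n^{\epsilon_n}$ to $P_X(x_1)^{\epsilon_1}\cdots P_X(x_n)^{\epsilon_n}$. $F_R^{P_X}(\pi_0^{top}(X))$ is the free group $F(\pi_0(X))$ with the quotient topology with respect to $R\circ\psi_X:\pi_0^{top}(M_T^*(X))\to F(\pi_0(X))$. The maps $\Phi_X$ and $\Psi_X$ are the identity on the group $F(\pi_0(X))$; they are always continuous. A topological isomorphism is a group isomorphism that is a homeomorphism. *)

theory Defs
  imports "HOL-Analysis.Analysis" "HOL-Algebra.Group"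
begin

section \<open>Quotient spaces\<close>

definition quotient_topology :: "'a topology \<Rightarrow> ('a \<Rightarrow> 'b) \<Rightarrow> 'b topology" where
  "quotient_topology X q =
     topology (\<lambda>U. U \<subseteq> q ` topspace X \<and> openin X {x \<in> topspace X. q x \<in> U})"

lemma openin_quotient_topology:
  "openin (quotient_topology X q) U \<longleftrightarrow>
     U \<subseteq> q ` topspace X \<and> openin X {x \<in> topspace X. q x \<in> U}"
proof -
  have 1: "{x \<in> topspace X. q x \<in> S \<inter> T} =
      {x \<in> topspace X. q x \<in> S} \<inter> {x \<in> topspace X. q x \<in> T}" for S T
    by auto
  have 2: "{x \<in> topspace X. q x \<in> \<Union>\<K>} = (\<Union>K\<in>\<K>. {x \<in> topspace X. q x \<in> K})" for \<K>
    by auto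
  have "istopology (\<lambda>U. U \<subseteq> q ` topspace X \<and> openin X {x \<in> topspace X. q x \<in> U})"
    unfolding istopology_def 1 2 by blast
  then show ?thesis
    by (simp add: quotient_topology_def)
qed

lemma topspace_quotient_topology [simp]:
  "topspace (quotient_topology X q) = q ` topspace X"
proof -
  have "{x \<in> topspace X. q x \<in> q ` topspace X} = topspace X"
    by auto
  then have "openin (quotient_topology X q) (q ` topspace X)"
    by (simp add: openin_quotient_topology)
  then show ?thesis
    by (meson openin_quotient_topology openin_subset openin_topspace subset_antisym)
qed

lemma quotient_map_quotient_topology: "quotient_map X (quotient_topology X q) q"
  by (auto simp: quotient_map_def openin_quotient_topology)

definition collapse_topology :: "'a topology \<Rightarrow> 'a set \<Rightarrow> 'a set topology" where
  "collapse_topology X A = quotient_topology X (\<lambda>x. if x \<in> A then A else {x})"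

definition pi0_top :: "'a topology \<Rightarrow> 'a set topology" where
  "pi0_top Z = quotient_topology Z (path_component_of_set Z)"

section \<open>Loop spaces and fundamental groups\<close>

abbreviation unit_interval :: "real topology" where
  "unit_interval \<equiv> top_of_set {0..1}"

text \<open>Continuous maps are represented by functions that are extensional on the domain,
  so that equality of points of the mapping space is equality of maps.\<close>

definition continuous_maps :: "'a topology \<Rightarrow> 'b topology \<Rightarrow> ('a \<Rightarrow> 'b) set" where
  "continuous_maps X Y = {f \<in> extensional (topspace X). continuous_map X Y f}"

definition compact_open_topology :: "'a topology \<Rightarrow> 'b topology \<Rightarrow> ('a \<Rightarrow> 'b) topology" where
  "compact_open_topology X Y =
     topology_generated_by
       {{f \<in> continuous_maps X Y. f ` K \<subseteq> U} | K U. compactin X K \<and> openin Y U}"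

lemma topspace_compact_open_topology [simp]:
  "topspace (compact_open_topology X Y) = continuous_maps X Y"
  unfolding compact_open_topology_def topology_generated_by_topspace
  using compactin_empty[of X] openin_empty[of Y] by fast

definition loop_space :: "'a topology \<Rightarrow> 'a \<Rightarrow> (real \<Rightarrow> 'a) topology" where
  "loop_space Z z =
     subtopology (compact_open_topology unit_interval Z) {f. f 0 = z \<and> f 1 = z}"

definition loop_class :: "'a topology \<Rightarrow> 'a \<Rightarrow> (real \<Rightarrow> 'a) \<Rightarrow> (real \<Rightarrow> 'a) set" where
  "loop_class Z z f =
     {g \<in> topspace (loop_space Z z).
        homotopic_with (\<lambda>h. h 0 = z \<and> h 1 = z) unit_interval Z f g}"

definition loop_concat :: "(real \<Rightarrow> 'a) \<Rightarrow> (real \<Rightarrow> 'a) \<Rightarrow> real \<Rightarrow> 'a" where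
  "loop_concat f g = (\<lambda>t\<in>{0..1}. if t \<le> 1/2 then f (2 * t) else g (2 * t - 1))"

text \<open>In the product below, all members of the union are the same homotopy class.\<close>

definition fundamental_group :: "'a topology \<Rightarrow> 'a \<Rightarrow> (real \<Rightarrow> 'a) set monoid" where
  "fundamental_group Z z =
     \<lparr>carrier = loop_class Z z ` topspace (loop_space Z z),
      monoid.mult = (\<lambda>A B. \<Union>f\<in>A. \<Union>g\<in>B. loop_class Z z (loop_concat f g)),
      one = loop_class Z z (\<lambda>t\<in>{0..1}. z)\<rparr>"

definition pi1_top :: "'a topology \<Rightarrow> 'a \<Rightarrow> (real \<Rightarrow> 'a) set topology" where
  "pi1_top Z z = quotient_topology (loop_space Z z) (loop_class Z z)"

section \<open>The reduced suspension of a space with a disjoint basepoint\<close>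

text \<open>The added point is \<open>None\<close>.\<close>

definition plus_topology :: "'a topology \<Rightarrow> 'a option topology" where
  "plus_topology X =
     topology (\<lambda>U. U \<subseteq> insert None (Some ` topspace X) \<and> openin X {x. Some x \<in> U})"

lemma openin_plus_topology:
  "openin (plus_topology X) U \<longleftrightarrow>
     U \<subseteq> insert None (Some ` topspace X) \<and> openin X {x. Some x \<in> U}"
proof -
  have 1: "{x. Some x \<in> S \<inter> T} = {x. Some x \<in> S} \<inter> {x. Some x \<in> T}" for S T :: "'a option set"
    by auto
  have 2: "{x. Some x \<in> \<Union>\<K>} = (\<Union>K\<in>\<K>. {x. Some x \<in> K})" for \<K> :: "'a option set set"
    by auto
  have "istopology (\<lambda>U. U \<subseteq> insert None (Some ` topspace X) \<and> openin X {x. Some x \<in> U})"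
    unfolding istopology_def 1 2 by blast
  then show ?thesis
    by (simp add: plus_topology_def)
qed

lemma topspace_plus_topology [simp]:
  "topspace (plus_topology X) = insert None (Some ` topspace X)"
proof -
  have "{x. Some x \<in> insert None (Some ` topspace X)} = topspace X"
    by auto
  then have "openin (plus_topology X) (insert None (Some ` topspace X))"
    by (simp add: openin_plus_topology)
  then show ?thesis
    by (meson openin_plus_topology openin_subset openin_topspace subset_antisym)
qed

definition suspension_base :: "'a topology \<Rightarrow> ('a option \<times> real) set" where
  "suspension_base X = Some ` topspace X \<times> {0, 1} \<union> {None} \<times> {0..1}"

text \<open>The collapsed set is itself a point of the quotient; it is the basepoint.\<close>

definition suspension_plus :: "'a topology \<Rightarrow> ('a option \<times> real) set topology" where
  "suspension_plus X =
     collapse_topology (prod_topology (plus_topology X) unit_interval) (suspension_base X)"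

section \<open>Topological groups\<close>

text \<open>No separation axiom is imposed.\<close>

definition topological_group :: "('g, 'm) monoid_scheme \<Rightarrow> 'g topology \<Rightarrow> bool" where
  "topological_group G T \<longleftrightarrow>
     group G \<and> topspace T = carrier G \<and>
     continuous_map (prod_topology T T) T (\<lambda>(x, y). x \<otimes>\<^bsub>G\<^esub> y) \<and>
     continuous_map T T (\<lambda>x. inv\<^bsub>G\<^esub> x)"

definition topological_isomorphism ::
  "('g, 'm) monoid_scheme \<Rightarrow> 'g topology \<Rightarrow> ('h, 'n) monoid_scheme \<Rightarrow> 'h topology \<Rightarrow> ('g \<Rightarrow> 'h) \<Rightarrow> bool"
  where
  "topological_isomorphism G T H S h \<longleftrightarrow> h \<in> iso G H \<and> homeomorphic_map T S h"

definition topologically_isomorphic ::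
  "('g, 'm) monoid_scheme \<Rightarrow> 'g topology \<Rightarrow> ('h, 'n) monoid_scheme \<Rightarrow> 'h topology \<Rightarrow> bool" where
  "topologically_isomorphic G T H S \<longleftrightarrow> (\<exists>h. topological_isomorphism G T H S h)"

section \<open>Free groups\<close>

text \<open>The letter \<open>(True, y)\<close> is the generator \<open>y\<close> and \<open>(False, y)\<close> is its inverse.
  The free group consists of the reduced words.\<close>

type_synonym 'y letter = "bool \<times> 'y"
type_synonym 'y word = "'y letter list"

definition inv_letter :: "'y letter \<Rightarrow> 'y letter" where
  "inv_letter a = (\<not> fst a, snd a)"

definition reduced_word :: "'y word \<Rightarrow> bool" where
  "reduced_word w \<longleftrightarrow> successively (\<lambda>a b. b \<noteq> inv_letter a) w"

fun push_letter :: "'y letter \<Rightarrow> 'y word \<Rightarrow> 'y word" where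
  "push_letter a [] = [a]"
| "push_letter a (b # w) = (if b = inv_letter a then w else a # b # w)"

definition reduce_word :: "'y word \<Rightarrow> 'y word" where
  "reduce_word w = foldr push_letter w []"

definition free_group :: "'y set \<Rightarrow> 'y word monoid" where
  "free_group A =
     \<lparr>carrier = {w. reduced_word w \<and> snd ` set w \<subseteq> A},
      monoid.mult = (\<lambda>u v. reduce_word (u @ v)),
      one = []\<rparr>"

definition generator :: "'y \<Rightarrow> 'y word" where
  "generator y = [(True, y)]"

lemma inv_letter_inv_letter [simp]: "inv_letter (inv_letter a) = a"
  by (simp add: inv_letter_def)

lemma reduced_word_Nil [simp]: "reduced_word []"
  by (simp add: reduced_word_def)

lemma reduced_word_push: "reduced_word w \<Longrightarrow> reduced_word (push_letter a w)"
  by (cases w) (auto simp: reduced_word_def successively_Cons)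

lemma reduced_word_foldr_push: "reduced_word w \<Longrightarrow> reduced_word (foldr push_letter u w)"
  by (induction u) (auto intro: reduced_word_push)

lemma reduced_word_reduce_word [simp]: "reduced_word (reduce_word w)"
  by (simp add: reduce_word_def reduced_word_foldr_push)

lemma reduce_word_reduced: "reduced_word w \<Longrightarrow> reduce_word w = w"
proof (induction w)
  case (Cons a w)
  then show ?case
    by (cases w) (auto simp: reduced_word_def reduce_word_def)
qed (simp add: reduce_word_def)

lemma push_inv_push:
  assumes "reduced_word w"
  shows "push_letter a (push_letter (inv_letter a) w) = w"
proof (cases w)
  case (Cons b v)
  then show ?thesis
    using assms by (cases v) (auto simp: reduced_word_def)
qed simp

lemma push_push_inv:
  "reduced_word w \<Longrightarrow> push_letter (inv_letter a) (push_letter a w) = w"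
  using push_inv_push[of w "inv_letter a"] by simp

lemma foldr_push_push:
  assumes "reduced_word s" "reduced_word w"
  shows "foldr push_letter (push_letter a s) w = push_letter a (foldr push_letter s w)"
  using assms
  by (cases s) (auto simp: push_inv_push reduced_word_foldr_push)

lemma foldr_push_reduce_word:
  "reduced_word w \<Longrightarrow> foldr push_letter (reduce_word u) w = foldr push_letter u w"
proof (induction u)
  case (Cons a u)
  have "reduce_word (a # u) = push_letter a (reduce_word u)"
    by (simp add: reduce_word_def)
  then show ?case
    using Cons by (simp add: foldr_push_push)
qed (simp add: reduce_word_def)

lemma reduce_word_append: "reduce_word (u @ v) = foldr push_letter u (reduce_word v)"
  by (simp add: reduce_word_def)

lemma reduce_word_append_left [simp]: "reduce_word (reduce_word u @ v) = reduce_word (u @ v)"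
  by (simp add: reduce_word_append foldr_push_reduce_word)

lemma reduce_word_append_right [simp]: "reduce_word (u @ reduce_word v) = reduce_word (u @ v)"
  by (simp add: reduce_word_append reduce_word_reduced)

lemma set_push_letter: "set (push_letter a w) \<subseteq> insert a (set w)"
  by (cases w) auto

lemma set_reduce_word: "set (reduce_word w) \<subseteq> set w"
proof (induction w)
  case (Cons a w)
  then show ?case
    using set_push_letter[of a "reduce_word w"] by (auto simp: reduce_word_def)
qed (simp add: reduce_word_def)

lemma foldr_push_inverse:
  "reduced_word s \<Longrightarrow>
     foldr push_letter (rev (map inv_letter w)) (foldr push_letter w s) = s"
  by (induction w) (simp_all add: push_push_inv reduced_word_foldr_push)

lemma snd_inv_letter [simp]: "snd (inv_letter a) = snd a"
  by (simp add: inv_letter_def)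

lemma reduce_word_in_free_group:
  "snd ` set w \<subseteq> A \<Longrightarrow> reduce_word w \<in> carrier (free_group A)"
  using set_reduce_word[of w] by (auto simp: free_group_def)

lemma group_free_group: "group (free_group A)"
proof (rule groupI)
  fix u v w
  assume u: "u \<in> carrier (free_group A)"
  have eq: "reduce_word u = u"
    using u by (simp add: free_group_def reduce_word_reduced)
  show "\<one>\<^bsub>free_group A\<^esub> \<otimes>\<^bsub>free_group A\<^esub> u = u"
    using eq by (simp add: free_group_def)
  show "\<exists>x\<in>carrier (free_group A). x \<otimes>\<^bsub>free_group A\<^esub> u = \<one>\<^bsub>free_group A\<^esub>"
  proof
    let ?x = "rev (map inv_letter u)"
    show "reduce_word ?x \<in> carrier (free_group A)"
      using u by (intro reduce_word_in_free_group) (auto simp: free_group_def image_image)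
    have "reduce_word (?x @ u) = []"
      using foldr_push_inverse[of "[]" u] by (simp add: reduce_word_def)
    then show "reduce_word ?x \<otimes>\<^bsub>free_group A\<^esub> u = \<one>\<^bsub>free_group A\<^esub>"
      by (simp add: free_group_def)
  qed
  assume v: "v \<in> carrier (free_group A)"
  then have "reduce_word (u @ v) \<in> carrier (free_group A)"
    using u by (intro reduce_word_in_free_group) (auto simp: free_group_def)
  then show "u \<otimes>\<^bsub>free_group A\<^esub> v \<in> carrier (free_group A)"
    by (simp add: free_group_def)
  show "u \<otimes>\<^bsub>free_group A\<^esub> v \<otimes>\<^bsub>free_group A\<^esub> w =
        u \<otimes>\<^bsub>free_group A\<^esub> (v \<otimes>\<^bsub>free_group A\<^esub> w)"
    by (simp add: free_group_def)
qed (simp add: free_group_def)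

definition letter_eval :: "('g, 'm) monoid_scheme \<Rightarrow> ('y \<Rightarrow> 'g) \<Rightarrow> 'y letter \<Rightarrow> 'g" where
  "letter_eval G f a = (if fst a then f (snd a) else inv\<^bsub>G\<^esub> f (snd a))"

definition word_eval :: "('g, 'm) monoid_scheme \<Rightarrow> ('y \<Rightarrow> 'g) \<Rightarrow> 'y word \<Rightarrow> 'g" where
  "word_eval G f w = foldr (\<lambda>a x. letter_eval G f a \<otimes>\<^bsub>G\<^esub> x) w \<one>\<^bsub>G\<^esub>"

context
  fixes G :: "('g, 'm) monoid_scheme" and f :: "'y \<Rightarrow> 'g" and A :: "'y set"
  assumes G: "group G" and f: "f \<in> A \<rightarrow> carrier G"
begin

interpretation group G by (rule G)

lemma letter_eval_closed: "snd a \<in> A \<Longrightarrow> letter_eval G f a \<in> carrier G"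
  using f by (auto simp: letter_eval_def)

lemma word_eval_closed: "snd ` set w \<subseteq> A \<Longrightarrow> word_eval G f w \<in> carrier G"
  by (induction w) (auto simp: word_eval_def letter_eval_closed)

lemma word_eval_append:
  "snd ` set u \<subseteq> A \<Longrightarrow> snd ` set v \<subseteq> A \<Longrightarrow>
     word_eval G f (u @ v) = word_eval G f u \<otimes>\<^bsub>G\<^esub> word_eval G f v"
proof (induction u)
  case Nil
  then show ?case
    using word_eval_closed[of v] by (simp add: word_eval_def)
next
  case (Cons a u)
  then have "word_eval G f (u @ v) = word_eval G f u \<otimes>\<^bsub>G\<^esub> word_eval G f v"
    and "word_eval G f u \<in> carrier G" and "word_eval G f v \<in> carrier G"
    and "letter_eval G f a \<in> carrier G"
    by (auto simp: word_eval_closed letter_eval_closed)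
  then show ?case
    by (simp add: word_eval_def m_assoc)
qed

lemma word_eval_push:
  assumes "snd a \<in> A" "snd ` set w \<subseteq> A"
  shows "word_eval G f (push_letter a w) = letter_eval G f a \<otimes>\<^bsub>G\<^esub> word_eval G f w"
proof (cases w)
  case (Cons b v)
  have a: "letter_eval G f a \<in> carrier G" and v: "word_eval G f v \<in> carrier G"
    using assms Cons by (auto simp: letter_eval_closed word_eval_closed)
  have "f (snd a) \<in> carrier G"
    using assms f by auto
  then have "letter_eval G f a \<otimes>\<^bsub>G\<^esub> letter_eval G f (inv_letter a) = \<one>\<^bsub>G\<^esub>"
    and b: "letter_eval G f (inv_letter a) \<in> carrier G"
    by (auto simp: letter_eval_def inv_letter_def)
  then have "letter_eval G f a \<otimes>\<^bsub>G\<^esub> (letter_eval G f (inv_letter a) \<otimes>\<^bsub>G\<^esub> word_eval G f v) = word_eval G f v"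
    using a v by (simp flip: m_assoc)
  then show ?thesis
    using Cons by (auto simp: word_eval_def)
qed (simp add: word_eval_def)

lemma word_eval_reduce_word:
  "snd ` set w \<subseteq> A \<Longrightarrow> word_eval G f (reduce_word w) = word_eval G f w"
proof (induction w)
  case (Cons a w)
  have "snd ` set (reduce_word w) \<subseteq> A"
    using Cons.prems set_reduce_word[of w] by auto
  then have "word_eval G f (push_letter a (reduce_word w)) =
      letter_eval G f a \<otimes>\<^bsub>G\<^esub> word_eval G f (reduce_word w)"
    using Cons.prems by (simp add: word_eval_push)
  then show ?case
    using Cons by (simp add: word_eval_def reduce_word_def)
qed (simp add: reduce_word_def)

lemma word_eval_hom: "word_eval G f \<in> hom (free_group A) G"
proof (rule homI)
  fix u v
  assume "u \<in> carrier (free_group A)" "v \<in> carrier (free_group A)"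
  then have u: "snd ` set u \<subseteq> A" and v: "snd ` set v \<subseteq> A"
    by (auto simp: free_group_def)
  then have "snd ` set (u @ v) \<subseteq> A"
    by auto
  then show "word_eval G f (u \<otimes>\<^bsub>free_group A\<^esub> v) =
      word_eval G f u \<otimes>\<^bsub>G\<^esub> word_eval G f v"
    using word_eval_reduce_word[of "u @ v"] word_eval_append[OF u v] by (simp add: free_group_def)
  show "word_eval G f u \<in> carrier G"
    by (rule word_eval_closed[OF u])
qed

lemma word_eval_generator: "y \<in> A \<Longrightarrow> word_eval G f (generator y) = f y"
  using f by (auto simp: word_eval_def generator_def letter_eval_def intro!: r_one)

lemma hom_eq_word_eval:
  assumes h: "h \<in> hom (free_group A) G" and gen: "\<And>y. y \<in> A \<Longrightarrow> h (generator y) = f y"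
    and w: "w \<in> carrier (free_group A)"
  shows "h w = word_eval G f w"
  using w
proof (induction w)
  case Nil
  have "h \<one>\<^bsub>free_group A\<^esub> = \<one>\<^bsub>G\<^esub>"
    by (rule hom_one[OF h group_free_group G])
  then show ?case
    by (simp add: free_group_def word_eval_def)
next
  case (Cons a w)
  have w: "w \<in> carrier (free_group A)" and aA: "snd a \<in> A"
    using Cons.prems by (cases w; auto simp: free_group_def reduced_word_def)+
  have a: "[(x, snd a)] \<in> carrier (free_group A)" for x
    using aA by (simp add: free_group_def reduced_word_def)
  have "a # w = [a] \<otimes>\<^bsub>free_group A\<^esub> w"
    using Cons.prems reduce_word_reduced[of "a # w"] by (simp add: free_group_def)
  then have "h (a # w) = h [a] \<otimes>\<^bsub>G\<^esub> h w"
    using h w a[of "fst a"] by (simp add: hom_mult)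
  moreover have "h [a] = letter_eval G f a"
  proof (cases "fst a")
    case True
    then have "[a] = generator (snd a)"
      by (metis generator_def prod.collapse)
    with True gen aA show ?thesis
      by (simp add: letter_eval_def)
  next
    case False
    have "[a] \<otimes>\<^bsub>free_group A\<^esub> generator (snd a) = \<one>\<^bsub>free_group A\<^esub>"
      using False
      by (cases a) (simp add: free_group_def generator_def reduce_word_def inv_letter_def)
    then have "h [a] \<otimes>\<^bsub>G\<^esub> f (snd a) = \<one>\<^bsub>G\<^esub>"
      using hom_mult[OF h a[of "fst a"] a[of True]] hom_one[OF h group_free_group G] gen[OF aA]
      by (simp add: generator_def)
    moreover have "h [a] \<in> carrier G"
      using h a[of "fst a"] by (auto simp: hom_def)
    moreover have "f (snd a) \<in> carrier G"
      using f aA by auto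
    ultimately have "h [a] = inv\<^bsub>G\<^esub> f (snd a)"
      by (metis inv_equality)
    with False show ?thesis
      by (simp add: letter_eval_def)
  qed
  ultimately show ?case
    using Cons.IH[OF w] by (simp add: word_eval_def)
qed

end

section \<open>The free topological group\<close>

text \<open>The extension property, for topological groups with elements in the type \<open>'g\<close>.
  Extensionality makes uniqueness on the carrier expressible as unique existence.\<close>

definition is_free_topological_group :: "'g itself \<Rightarrow> 'y topology \<Rightarrow> 'y word topology \<Rightarrow> bool" where
  "is_free_topological_group _ Y T \<longleftrightarrow>
     topological_group (free_group (topspace Y)) T \<and>
     continuous_map Y T generator \<and>
     (\<forall>(G :: 'g monoid) S f. topological_group G S \<and> continuous_map Y S f \<longrightarrow>
        (\<exists>!h. h \<in> extensional (carrier (free_group (topspace Y))) \<and>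
              h \<in> hom (free_group (topspace Y)) G \<and> continuous_map T S h \<and>
              (\<forall>y\<in>topspace Y. h (generator y) = f y)))"

text \<open>A definition cannot quantify over all types \<open>'g\<close>. Taking for \<open>'g\<close> the type of words
  already determines the topology, and the extension property then holds for every type; see
  \<open>is_free_topological_group_unique\<close> and \<open>is_free_topological_group_FM_topology\<close> below.\<close>

definition FM_topology :: "'y topology \<Rightarrow> 'y word topology" where
  "FM_topology Y = (THE T. is_free_topological_group TYPE('y word) Y T)"

definition group_topologies :: "'y topology \<Rightarrow> 'y word topology set" where
  "group_topologies Y =
     {T. topological_group (free_group (topspace Y)) T \<and> continuous_map Y T generator}"

definition join_topology :: "'y topology \<Rightarrow> 'y word topology" where
  "join_topology Y = topology_generated_by {U. \<exists>T\<in>group_topologies Y. openin T U}"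

lemma generator_closed: "y \<in> A \<Longrightarrow> generator y \<in> carrier (free_group A)"
  by (simp add: generator_def free_group_def reduced_word_def)

lemma topspace_group_topologies:
  "T \<in> group_topologies Y \<Longrightarrow> topspace T = carrier (free_group (topspace Y))"
  by (simp add: group_topologies_def topological_group_def)

lemma pullback_in_group_topologies:
  fixes G :: "('g, 'm) monoid_scheme"
  assumes G: "topological_group G S" and f: "continuous_map Y S f"
    and h: "h \<in> hom (free_group (topspace Y)) G"
    and gen: "\<And>y. y \<in> topspace Y \<Longrightarrow> h (generator y) = f y"
  shows "pullback_topology (carrier (free_group (topspace Y))) h S \<in> group_topologies Y"
proof -
  let ?F = "free_group (topspace Y)"
  let ?T = "pullback_topology (carrier ?F) h S"
  have grp: "group G" and S: "topspace S = carrier G"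
    and mult: "continuous_map (prod_topology S S) S (\<lambda>(x, y). x \<otimes>\<^bsub>G\<^esub> y)"
    and inv: "continuous_map S S (\<lambda>x. inv\<^bsub>G\<^esub> x)"
    using G by (auto simp: topological_group_def)
  interpret F: group ?F by (rule group_free_group)
  interpret h: group_hom ?F G h
    using grp h by (simp add: group_hom_def group_hom_axioms_def group_free_group)
  have top: "topspace ?T = carrier ?F"
    using h S by (auto simp: topspace_pullback_topology hom_def)
  have hcont: "continuous_map ?T S h"
    using continuous_map_pullback[OF continuous_map_id, of "carrier ?F" h S] by simp
  have fst: "continuous_map (prod_topology ?T ?T) S (\<lambda>p. h (fst p))"
    and snd: "continuous_map (prod_topology ?T ?T) S (\<lambda>p. h (snd p))"
    using continuous_map_compose[OF continuous_map_fst hcont]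
      continuous_map_compose[OF continuous_map_snd hcont] by (auto simp: o_def)
  have "continuous_map (prod_topology ?T ?T) S (\<lambda>p. h (fst p) \<otimes>\<^bsub>G\<^esub> h (snd p))"
    using continuous_map_compose[OF continuous_map_pairedI[OF fst snd] mult] by (simp add: o_def)
  then have "continuous_map (prod_topology ?T ?T) S (h \<circ> (\<lambda>(x, y). x \<otimes>\<^bsub>?F\<^esub> y))"
    by (rule continuous_map_eq) (auto simp: top)
  then have 1: "continuous_map (prod_topology ?T ?T) ?T (\<lambda>(x, y). x \<otimes>\<^bsub>?F\<^esub> y)"
    by (rule continuous_map_pullback') (auto simp: top)
  have "continuous_map ?T S (\<lambda>x. inv\<^bsub>G\<^esub> h x)"
    using continuous_map_compose[OF hcont inv] by (simp add: o_def)
  then have "continuous_map ?T S (h \<circ> (\<lambda>x. inv\<^bsub>?F\<^esub> x))"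
    by (rule continuous_map_eq) (auto simp: top)
  then have 2: "continuous_map ?T ?T (\<lambda>x. inv\<^bsub>?F\<^esub> x)"
    by (rule continuous_map_pullback') (auto simp: top)
  have "continuous_map Y S (h \<circ> generator)"
    using f by (rule continuous_map_eq) (simp add: gen)
  then have 3: "continuous_map Y ?T generator"
    by (rule continuous_map_pullback') (auto simp: generator_closed)
  show ?thesis
    using 1 2 3 top by (simp add: group_topologies_def topological_group_def group_free_group)
qed

definition trivial_group :: "unit monoid" where
  "trivial_group = \<lparr>carrier = UNIV, monoid.mult = (\<lambda>_ _. ()), one = ()\<rparr>"

lemma continuous_map_to_unit:
  fixes g :: "'z \<Rightarrow> unit"
  shows "continuous_map Z (discrete_topology UNIV) g"
  by (rule continuous_map_eq[of _ _ "\<lambda>_. ()"]) auto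

lemma group_topologies_nonempty: "group_topologies Y \<noteq> {}"
proof -
  have "group trivial_group"
    by (rule groupI) (auto simp: trivial_group_def)
  then have 1: "topological_group trivial_group (discrete_topology UNIV)"
    unfolding topological_group_def
    by (intro conjI continuous_map_to_unit) (simp_all add: trivial_group_def)
  have 2: "(\<lambda>_. ()) \<in> hom (free_group (topspace Y)) trivial_group"
    by (simp add: hom_def trivial_group_def)
  show ?thesis
    using pullback_in_group_topologies[OF 1 continuous_map_to_unit 2, of "\<lambda>_. ()"] by blast
qed

lemma topspace_join_topology: "topspace (join_topology Y) = carrier (free_group (topspace Y))"
proof -
  have "\<Union>{U. \<exists>T\<in>group_topologies Y. openin T U} = carrier (free_group (topspace Y))"
    using group_topologies_nonempty[of Y] topspace_group_topologies[of _ Y]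
    by (auto dest: openin_subset)
  then show ?thesis
    by (simp add: join_topology_def topology_generated_by_topspace)
qed

lemma openin_join_topology:
  "T \<in> group_topologies Y \<Longrightarrow> openin T U \<Longrightarrow> openin (join_topology Y) U"
  unfolding join_topology_def by (rule topology_generated_by_Basis) auto

lemma continuous_map_from_join:
  assumes T: "T \<in> group_topologies Y" and g: "continuous_map T S g"
  shows "continuous_map (join_topology Y) S g"
  using g openin_join_topology[OF T] topspace_group_topologies[OF T]
  by (simp add: continuous_map_def topspace_join_topology)

lemma continuous_map_into_join:
  assumes "\<And>T. T \<in> group_topologies Y \<Longrightarrow> continuous_map S T g"
  shows "continuous_map S (join_topology Y) g"
  unfolding join_topology_def
proof (rule continuous_on_generated_topo)
  fix U assume "U \<in> {U. \<exists>T\<in>group_topologies Y. openin T U}"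
  then obtain T where "T \<in> group_topologies Y" "openin T U" by auto
  then show "openin S (g -` U \<inter> topspace S)"
    using assms[of T] by (simp add: continuous_map vimage_def Int_def conj_commute)
next
  obtain T where "T \<in> group_topologies Y"
    using group_topologies_nonempty by auto
  then show "g ` topspace S \<subseteq> \<Union>{U. \<exists>T\<in>group_topologies Y. openin T U}"
    using assms[of T] by (fastforce simp: continuous_map_def)
qed

lemma join_in_group_topologies: "join_topology Y \<in> group_topologies Y"
proof -
  let ?F = "free_group (topspace Y)"
  let ?J = "join_topology Y"
  have id: "continuous_map ?J T (\<lambda>x. x)" if "T \<in> group_topologies Y" for T
    using continuous_map_from_join[OF that continuous_map_id] by (simp add: id_def)
  have 1: "continuous_map (prod_topology ?J ?J) ?J (\<lambda>(x, y). x \<otimes>\<^bsub>?F\<^esub> y)"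
  proof (rule continuous_map_into_join)
    fix T assume T: "T \<in> group_topologies Y"
    have "continuous_map (prod_topology ?J ?J) (prod_topology T T) (\<lambda>p. (fst p, snd p))"
      using continuous_map_compose[OF continuous_map_fst id[OF T]]
        continuous_map_compose[OF continuous_map_snd id[OF T]]
      by (intro continuous_map_pairedI) (auto simp: o_def)
    moreover have "continuous_map (prod_topology T T) T (\<lambda>(x, y). x \<otimes>\<^bsub>?F\<^esub> y)"
      using T by (simp add: group_topologies_def topological_group_def)
    ultimately show "continuous_map (prod_topology ?J ?J) T (\<lambda>(x, y). x \<otimes>\<^bsub>?F\<^esub> y)"
      using continuous_map_compose by (fastforce simp: o_def)
  qed
  have 2: "continuous_map ?J ?J (\<lambda>x. inv\<^bsub>?F\<^esub> x)"
    by (intro continuous_map_into_join continuous_map_from_join)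
      (auto simp: group_topologies_def topological_group_def)
  have 3: "continuous_map Y ?J generator"
    by (rule continuous_map_into_join) (simp add: group_topologies_def)
  show ?thesis
    using 1 2 3 topspace_join_topology
    by (simp add: group_topologies_def topological_group_def group_free_group)
qed

lemma is_free_topological_group_join:
  "is_free_topological_group TYPE('g) Y (join_topology Y)"
  unfolding is_free_topological_group_def
proof (intro conjI allI impI)
  let ?F = "free_group (topspace Y)"
  show "topological_group ?F (join_topology Y)" "continuous_map Y (join_topology Y) generator"
    using join_in_group_topologies[of Y] by (auto simp: group_topologies_def)
  fix G :: "'g monoid" and S f
  assume "topological_group G S \<and> continuous_map Y S f"
  then have G: "topological_group G S" and f: "continuous_map Y S f" by auto
  then have grp: "group G" and fG: "f \<in> topspace Y \<rightarrow> carrier G"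
    by (auto simp: topological_group_def continuous_map_def)
  define h where "h = restrict (word_eval G f) (carrier ?F)"
  have hom: "h \<in> hom ?F G"
    using word_eval_hom[OF grp fG] group.is_monoid[OF group_free_group, of "topspace Y"]
    by (auto simp: h_def hom_def monoid.m_closed)
  have gen: "h (generator y) = f y" if "y \<in> topspace Y" for y
    using that word_eval_generator[OF grp fG] by (simp add: h_def generator_closed)
  have "continuous_map (pullback_topology (carrier ?F) h S) S h"
    using continuous_map_pullback[OF continuous_map_id, of "carrier ?F" h S] by simp
  then have cont: "continuous_map (join_topology Y) S h"
    using continuous_map_from_join[OF pullback_in_group_topologies[OF G f hom gen]] by simp
  show "\<exists>!h. h \<in> extensional (carrier ?F) \<and> h \<in> hom ?F G \<and>
          continuous_map (join_topology Y) S h \<and> (\<forall>y\<in>topspace Y. h (generator y) = f y)"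
  proof (rule ex1I[of _ h])
    show "h \<in> extensional (carrier ?F) \<and> h \<in> hom ?F G \<and>
          continuous_map (join_topology Y) S h \<and> (\<forall>y\<in>topspace Y. h (generator y) = f y)"
      using hom gen cont by (simp add: h_def)
    fix k
    assume k: "k \<in> extensional (carrier ?F) \<and> k \<in> hom ?F G \<and>
          continuous_map (join_topology Y) S k \<and> (\<forall>y\<in>topspace Y. k (generator y) = f y)"
    then have "k w = h w" if "w \<in> carrier ?F" for w
      using hom_eq_word_eval[OF grp fG, of k w] that by (simp add: h_def)
    then show "k = h"
      using k by (intro extensionalityI[of k "carrier ?F"]) (auto simp: h_def)
  qed
qed

lemma is_free_topological_group_finest:
  assumes T: "is_free_topological_group TYPE('y word) (Y :: 'y topology) T"
    and S: "topological_group (free_group (topspace Y)) S" "continuous_map Y S generator"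
  shows "continuous_map T S (\<lambda>x. x)"
proof -
  let ?F = "free_group (topspace Y)"
  obtain h where h: "h \<in> hom ?F ?F" "continuous_map T S h"
      "\<And>y. y \<in> topspace Y \<Longrightarrow> h (generator y) = generator y"
    using T S unfolding is_free_topological_group_def by metis
  have gen: "generator \<in> topspace Y \<rightarrow> carrier ?F"
    by (simp add: generator_closed)
  have "h w = w" if "w \<in> carrier ?F" for w
    using hom_eq_word_eval[OF group_free_group gen h(1,3) that]
      hom_eq_word_eval[OF group_free_group gen, of "\<lambda>x. x" w] that
    by (simp add: hom_def)
  moreover have "topspace T = carrier ?F"
    using T by (simp add: is_free_topological_group_def topological_group_def)
  ultimately show ?thesis
    using h(2) by (auto intro: continuous_map_eq)
qed

lemma is_free_topological_group_unique:
  assumes "is_free_topological_group TYPE('y word) (Y :: 'y topology) S"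
    and "is_free_topological_group TYPE('y word) Y T"
  shows "S = T"
proof -
  have "homeomorphic_maps S T (\<lambda>x. x) (\<lambda>x. x)"
    using is_free_topological_group_finest[OF assms(1), of T]
      is_free_topological_group_finest[OF assms(2), of S] assms
    by (simp add: homeomorphic_maps_def is_free_topological_group_def)
  then show ?thesis
    using homeomorphic_map_id[of S T] homeomorphic_maps_imp_map by (fastforce simp: id_def)
qed

theorem is_free_topological_group_FM_topology:
  "is_free_topological_group TYPE('g) (Y :: 'y topology) (FM_topology Y)"
proof -
  have "FM_topology Y = join_topology Y"
    unfolding FM_topology_def
    using is_free_topological_group_join is_free_topological_group_unique
    by (intro the_equality) blast+
  then show ?thesis
    by (simp add: is_free_topological_group_join)
qed

section \<open>The free topological monoid and the quotient topologies on the free group\<close>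

definition letter_topology :: "'y topology \<Rightarrow> 'y letter topology" where
  "letter_topology Y = sum_topology (\<lambda>_. Y) UNIV"

text \<open>A list of length \<open>n\<close> represents the point of the \<open>n\<close>-th power given by its entries, so
  the quotient below is by a bijection.\<close>

definition monoid_topology :: "'y topology \<Rightarrow> 'y word topology" where
  "monoid_topology Y =
     quotient_topology
       (sum_topology (\<lambda>n. product_topology (\<lambda>_. letter_topology Y) {..<n}) UNIV)
       (\<lambda>(n, p). map p [0..<n])"

definition FR_topology :: "'y topology \<Rightarrow> 'y word topology" where
  "FR_topology Y = quotient_topology (monoid_topology Y) reduce_word"

lemma topspace_monoid_topology:
  "topspace (monoid_topology Y) = {w. snd ` set w \<subseteq> topspace Y}"
proof (intro equalityI subsetI)
  fix w assume "w \<in> topspace (monoid_topology Y)"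
  then obtain n p where w: "w = map p [0..<n]"
      and p: "p \<in> {..<n} \<rightarrow>\<^sub>E topspace (letter_topology Y)"
    by (auto simp: monoid_topology_def)
  have "snd (p i) \<in> topspace Y" if "i < n" for i
    using PiE_mem[OF p, of i] that by (simp add: letter_topology_def mem_Times_iff)
  then show "w \<in> {w. snd ` set w \<subseteq> topspace Y}"
    unfolding w by auto
next
  fix w :: "'a word" assume w: "w \<in> {w. snd ` set w \<subseteq> topspace Y}"
  let ?p = "restrict (nth w) {..<length w}"
  have "w = map ?p [0..<length w]"
    by (rule nth_equalityI) auto
  moreover have "w ! i \<in> UNIV \<times> topspace Y" if "i < length w" for i
    using w nth_mem[OF that] by (auto simp: mem_Times_iff)
  then have "?p \<in> {..<length w} \<rightarrow>\<^sub>E topspace (letter_topology Y)"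
    by (simp add: letter_topology_def PiE_iff)
  ultimately show "w \<in> topspace (monoid_topology Y)"
    unfolding monoid_topology_def topspace_quotient_topology
    by (intro image_eqI[of _ _ "(length w, ?p)"]) simp_all
qed

lemma continuous_map_from_sum:
  assumes "\<And>i. i \<in> I \<Longrightarrow> continuous_map (X i) Y (\<lambda>x. f (i, x))"
  shows "continuous_map (sum_topology X I) Y f"
  unfolding continuous_map_def
proof (intro conjI allI impI)
  show "f \<in> topspace (sum_topology X I) \<rightarrow> topspace Y"
    using continuous_map_image_subset_topspace[OF assms] by fastforce
  fix U assume "openin Y U"
  then have "openin (X i) {x \<in> topspace (X i). f (i, x) \<in> U}" if "i \<in> I" for i
    using assms[OF that] by (simp add: continuous_map_def)
  then show "openin (sum_topology X I) {x \<in> topspace (sum_topology X I). f x \<in> U}"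
    by (auto simp: openin_sum_topology)
qed

lemma continuous_map_from_quotient:
  "continuous_map X Y (f \<circ> q) \<Longrightarrow> continuous_map (quotient_topology X q) Y f"
  using quotient_map_quotient_topology continuous_compose_quotient_map by blast

lemma path_component_of_words:
  assumes vw: "path_component_of (monoid_topology X) v w"
  shows "map (apsnd (path_component_of_set X)) v = map (apsnd (path_component_of_set X)) w"
proof (rule nth_equalityI)
  have "continuous_map (monoid_topology X) (discrete_topology UNIV) length"
    unfolding monoid_topology_def
    by (intro continuous_map_from_quotient continuous_map_from_sum) simp
  then have len: "length v = length w"
    using vw path_component_of_continuous_image path_component_of_discrete_topology_iff by metis
  then show "length (map (apsnd (path_component_of_set X)) v) =
      length (map (apsnd (path_component_of_set X)) w)"
    by simp
  fix i assume "i < length (map (apsnd (path_component_of_set X)) v)"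
  then have i: "i < length v" by simp
  let ?g = "\<lambda>u. if i < length u then u ! i else v ! i"
  have "v \<in> topspace (monoid_topology X)"
    using vw by (meson path_component_in_topspace)
  then have "snd (v ! i) \<in> topspace X"
    using nth_mem[OF i] by (auto simp: topspace_monoid_topology)
  then have vi: "v ! i \<in> topspace (letter_topology X)"
    by (cases "v ! i") (simp add: letter_topology_def)
  have "continuous_map (monoid_topology X) (letter_topology X) ?g"
    unfolding monoid_topology_def
  proof (intro continuous_map_from_quotient continuous_map_from_sum)
    fix n :: nat
    let ?P = "product_topology (\<lambda>_. letter_topology X) {..<n}"
    show "continuous_map ?P (letter_topology X) (\<lambda>p. (?g \<circ> (\<lambda>(n, p). map p [0..<n])) (n :: nat, p))"
    proof (cases "i < n")
      case True
      then have "continuous_map ?P (letter_topology X) (\<lambda>p. p i)"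
        by (intro continuous_map_product_projection) simp
      then show ?thesis
        using True by simp
    qed (use vi in simp)
  qed
  then have "path_component_of (letter_topology X) (?g v) (?g w)"
    using vw by (rule path_component_of_continuous_image)
  then have vwi: "path_component_of (letter_topology X) (v ! i) (w ! i)"
    using i len by simp
  have "continuous_map (letter_topology X) (discrete_topology UNIV) fst"
    unfolding letter_topology_def by (rule continuous_map_from_sum) simp
  then have 1: "fst (v ! i) = fst (w ! i)"
    using vwi path_component_of_continuous_image path_component_of_discrete_topology_iff by metis
  have "continuous_map (letter_topology X) X snd"
    unfolding letter_topology_def by (rule continuous_map_from_sum) simp
  then have "path_component_of X (snd (v ! i)) (snd (w ! i))"
    using vwi by (rule path_component_of_continuous_image)
  then have "path_component_of_set X (snd (v ! i)) = path_component_of_set X (snd (w ! i))"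
    by (simp add: path_component_of_equiv)
  with 1 show "map (apsnd (path_component_of_set X)) v ! i =
      map (apsnd (path_component_of_set X)) w ! i"
    using i len by (simp add: apsnd_def map_prod_def split_beta)
qed

text \<open>By the preceding lemma, the choice made by \<open>SOME\<close> does not matter.\<close>

definition psi :: "'x topology \<Rightarrow> 'x word set \<Rightarrow> 'x set word" where
  "psi X C = map (apsnd (path_component_of_set X)) (SOME w. w \<in> C)"

lemma psi_path_component:
  assumes "w \<in> topspace (monoid_topology X)"
  shows "psi X (path_component_of_set (monoid_topology X) w) =
           map (apsnd (path_component_of_set X)) w"
proof -
  have "path_component_of (monoid_topology X) w w"
    using assms by (simp add: path_component_of_refl)
  then have "path_component_of (monoid_topology X) w
      (SOME v. v \<in> path_component_of_set (monoid_topology X) w)"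
    by (metis mem_Collect_eq someI)
  then show ?thesis
    unfolding psi_def by (rule path_component_of_words[symmetric])
qed
definition FRP_topology :: "'x topology \<Rightarrow> 'x set word topology" where
  "FRP_topology X = quotient_topology (pi0_top (monoid_topology X)) (reduce_word \<circ> psi X)"

end

theory Submission
  imports Defs
begin

text \<open>The key fact is that the meridians \<open>t \<mapsto> (x, t)\<close> induce a group isomorphism from the free group
  on the path components of \<open>X\<close> onto \<open>\<pi>\<^sub>1(\<Sigma>(X\<^sub>+))\<close> that is a homeomorphism from \<open>F\<^sub>R\<^sup>P\<close>. Surjectivity follows
  from a deformation that collapses a neighbourhood of the basepoint. For the inverse, a loop is lifted
  to a path in the free group that changes only while the loop crosses \<open>X \<times> (0, 1)\<close>; the endpoint of
  the lift is locally the reduction of a word in \<open>X\<close> depending continuously on the loop.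
  If \<open>\<pi>\<^sub>1\<close> is a topological group, the universal property of \<open>F\<^sub>M\<close> makes the identity \<open>F\<^sub>M \<rightarrow> F\<^sub>R\<^sup>P\<close> continuous,
  and as \<open>F\<^sub>R\<^sup>P \<rightarrow> F\<^sub>R \<rightarrow> F\<^sub>M\<close> are always continuous, all three topologies agree.\<close>

section \<open>Loops and the fundamental group\<close>

text \<open>\<open>X\<close> carries no local hypothesis that a covering space argument could use:
  its path components need not be open. What helps instead is the shape of the suspension. As the
  added point is isolated, the suspension is covered by two open sets, the cylinder
  \<open>inner_part\<close> over \<open>X\<close> and the collar \<open>outer_part\<close> around
  the basepoint. Their overlap splits by height into a lower and an upper piece, and a passage
  through the cylinder from one to the other at \<open>x\<close> is what contributes a letter.

  Multiplication on \<open>pi1_top\<close> may fail to be jointly continuous because a product of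
  quotient maps need not be a quotient map. The same defect separates \<open>FRP_topology\<close>
  from \<open>FR_topology\<close>, which are quotients of words over \<open>X\<close> and of words
  over the components. A loop close to a given one crosses the cylinder at points of
  \<open>X\<close> that vary continuously while their components may change. So the crossings have
  to be recorded as points of \<open>X\<close>; recording components only would give continuity into
  the coarser \<open>FR_topology\<close>.\<close>

lemma loop_iff:
  "f \<in> topspace (loop_space Z z) \<longleftrightarrow>
     f \<in> extensional {0..1} \<and> continuous_map unit_interval Z f \<and> f 0 = z \<and> f 1 = z"
  by (auto simp: loop_space_def continuous_maps_def)

lemma restrict_loop:
  assumes "continuous_map unit_interval Z f" "f 0 = z" "f 1 = z"
  shows "restrict f {0..1} \<in> topspace (loop_space Z z)"
  using assms continuous_map_eq[of unit_interval Z f "restrict f {0..1}"]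
  by (auto simp: loop_iff)

lemma const_loop: "z \<in> topspace Z \<Longrightarrow> (\<lambda>t\<in>{0..1}. z) \<in> topspace (loop_space Z z)"
  by (rule restrict_loop) auto

abbreviation loop_homotopic ::
  "'a topology \<Rightarrow> 'a \<Rightarrow> (real \<Rightarrow> 'a) \<Rightarrow> (real \<Rightarrow> 'a) \<Rightarrow> bool" where
  "loop_homotopic Z z \<equiv> homotopic_with (\<lambda>h. h 0 = z \<and> h 1 = z) unit_interval Z"

lemma loop_homotopic_iff:
  "loop_homotopic Z z f g \<longleftrightarrow>
     (\<exists>h. continuous_map (prod_topology unit_interval unit_interval) Z h \<and>
          (\<forall>t\<in>{0..1}. h (0, t) = f t) \<and> (\<forall>t\<in>{0..1}. h (1, t) = g t) \<and>
          (\<forall>r\<in>{0..1}. h (r, 0) = z \<and> h (r, 1) = z))"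
  by (subst homotopic_with) auto

lemma loop_homotopicI:
  assumes "continuous_map (prod_topology unit_interval unit_interval) Z (\<lambda>(r, t). h r t)"
    and "\<And>t. t \<in> {0..1} \<Longrightarrow> h 0 t = f t" "\<And>t. t \<in> {0..1} \<Longrightarrow> h 1 t = g t"
    and "\<And>r. r \<in> {0..1} \<Longrightarrow> h r 0 = z" "\<And>r. r \<in> {0..1} \<Longrightarrow> h r 1 = z"
  shows "loop_homotopic Z z f g"
  unfolding loop_homotopic_iff using assms by (intro exI[of _ "\<lambda>(r, t). h r t"]) auto

lemma loop_class_eq_iff:
  assumes "f \<in> topspace (loop_space Z z)" "g \<in> topspace (loop_space Z z)"
  shows "loop_class Z z f = loop_class Z z g \<longleftrightarrow> loop_homotopic Z z f g"
proof
  assume "loop_class Z z f = loop_class Z z g"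
  moreover have "g \<in> loop_class Z z g"
    using assms by (simp add: loop_class_def loop_iff)
  ultimately have "g \<in> loop_class Z z f"
    by simp
  then show "loop_homotopic Z z f g"
    by (simp add: loop_class_def)
next
  assume fg: "loop_homotopic Z z f g"
  have "loop_homotopic Z z f h \<longleftrightarrow> loop_homotopic Z z g h" for h
    by (rule iffI, erule homotopic_with_trans[OF homotopic_with_symD[OF fg]],
        erule homotopic_with_trans[OF fg])
  then show "loop_class Z z f = loop_class Z z g"
    by (simp add: loop_class_def)
qed

text \<open>The parameter space \<open>Y\<close> is arbitrary so that one gluing argument at time
  1/2 serves single loops, homotopies of loops, and loops that depend on a word.\<close>

lemma continuous_map_loop_concat:
  assumes F: "continuous_map (prod_topology Y unit_interval) Z (\<lambda>(y, t). f y t)"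
    and G: "continuous_map (prod_topology Y unit_interval) Z (\<lambda>(y, t). g y t)"
    and eq: "\<And>y. y \<in> topspace Y \<Longrightarrow> f y 1 = g y 0"
  shows "continuous_map (prod_topology Y unit_interval) Z (\<lambda>(y, t). loop_concat (f y) (g y) t)"
proof -
  let ?YI = "prod_topology Y unit_interval"
  have s: "continuous_map ?YI euclideanreal snd"
    using continuous_map_snd continuous_map_in_subtopology by blast
  let ?L = "subtopology ?YI {p \<in> topspace ?YI. snd p \<le> 1/2}"
  let ?R = "subtopology ?YI {p \<in> topspace ?YI. 1/2 \<le> snd p}"
  have sL: "continuous_map ?L euclideanreal snd" and sR: "continuous_map ?R euclideanreal snd"
    using s continuous_map_from_subtopology by blast+
  have fL: "continuous_map ?L Y fst" and fR: "continuous_map ?R Y fst"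
    using continuous_map_fst continuous_map_from_subtopology by blast+
  have L: "continuous_map ?L ?YI (\<lambda>p. (fst p, 2 * snd p))"
    using sL fL
    by (intro continuous_map_pairedI continuous_map_into_subtopology continuous_map_real_mult_left) auto
  have R: "continuous_map ?R ?YI (\<lambda>p. (fst p, 2 * snd p - 1))"
    using sR fR
    by (intro continuous_map_pairedI continuous_map_into_subtopology continuous_map_real_mult_left
        continuous_map_diff) auto
  have "continuous_map ?YI Z
      (\<lambda>p. if snd p \<le> 1/2 then f (fst p) (2 * snd p) else g (fst p) (2 * snd p - 1))"
  proof (rule continuous_map_cases_le[OF s])
    show "continuous_map ?L Z (\<lambda>p. f (fst p) (2 * snd p))"
      using continuous_map_compose[OF L F] by (simp add: o_def)
    show "continuous_map ?R Z (\<lambda>p. g (fst p) (2 * snd p - 1))"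
      using continuous_map_compose[OF R G] by (simp add: o_def)
    show "f (fst p) (2 * snd p) = g (fst p) (2 * snd p - 1)"
      if "p \<in> topspace ?YI" "snd p = 1/2" for p
      using that eq[of "fst p"] by (auto simp: that(2))
  qed auto
  then show ?thesis
    by (rule continuous_map_eq) (auto simp: loop_concat_def)
qed

lemma continuous_map_constant_family:
  "continuous_map A Z f \<Longrightarrow> continuous_map (prod_topology Y A) Z (\<lambda>(y, t). f t)"
  using continuous_map_compose[OF continuous_map_snd, of A Z f Y] by (simp add: o_def case_prod_unfold)

lemma loop_concat_ends: "loop_concat f g 0 = f 0" "loop_concat f g 1 = g 1"
  by (auto simp: loop_concat_def)

lemma loop_concat_loop:
  assumes f: "f \<in> topspace (loop_space Z z)" and g: "g \<in> topspace (loop_space Z z)"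
  shows "loop_concat f g \<in> topspace (loop_space Z z)"
proof -
  \<comment> \<open>The parameter \<open>y\<close> is a dummy; a single concatenation is a slice of
    the constant family.\<close>
  have "continuous_map (prod_topology unit_interval unit_interval) Z (\<lambda>(y, t). loop_concat f g t)"
    using f g by (intro continuous_map_loop_concat continuous_map_constant_family) (auto simp: loop_iff)
  from continuous_map_o_Pair[OF this, of 0] have "continuous_map unit_interval Z (loop_concat f g)"
    by (simp add: o_def)
  then show ?thesis
    using f g by (simp add: loop_iff loop_concat_ends) (simp add: loop_concat_def)
qed

lemma loop_homotopic_concat:
  assumes "loop_homotopic Z z f f'" "loop_homotopic Z z g g'"
  shows "loop_homotopic Z z (loop_concat f g) (loop_concat f' g')"
proof -
  obtain h where h: "continuous_map (prod_topology unit_interval unit_interval) Z h"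
      "\<And>t. t\<in>{0..1} \<Longrightarrow> h (0, t) = f t" "\<And>t. t\<in>{0..1} \<Longrightarrow> h (1, t) = f' t"
      "\<And>r. r\<in>{0..1} \<Longrightarrow> h (r, 0) = z" "\<And>r. r\<in>{0..1} \<Longrightarrow> h (r, 1) = z"
    using assms(1) unfolding loop_homotopic_iff by blast
  obtain k where k: "continuous_map (prod_topology unit_interval unit_interval) Z k"
      "\<And>t. t\<in>{0..1} \<Longrightarrow> k (0, t) = g t" "\<And>t. t\<in>{0..1} \<Longrightarrow> k (1, t) = g' t"
      "\<And>r. r\<in>{0..1} \<Longrightarrow> k (r, 0) = z" "\<And>r. r\<in>{0..1} \<Longrightarrow> k (r, 1) = z"
    using assms(2) unfolding loop_homotopic_iff by blast
  have "continuous_map (prod_topology unit_interval unit_interval) Z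
     (\<lambda>(r, t). loop_concat (\<lambda>s. h (r, s)) (\<lambda>s. k (r, s)) t)"
    using h k by (intro continuous_map_loop_concat) (auto simp: case_prod_unfold)
  then show ?thesis
    by (rule loop_homotopicI) (use h k in \<open>auto simp: loop_concat_def\<close>)
qed

text \<open>The straight-line homotopy between \<phi> and \<psi> stays in the interval by convexity,
  and composing it with \<open>c\<close> gives the homotopy. Each group law below compares two
  parametrizations of one path.\<close>

lemma reparametrization_homotopic:
  fixes \<phi> \<psi> :: "real \<Rightarrow> real"
  assumes c: "continuous_map unit_interval Z c"
    and \<phi>: "continuous_on {0..1} \<phi>" "\<And>t. t \<in> {0..1} \<Longrightarrow> \<phi> t \<in> {0..1}"
    and \<psi>: "continuous_on {0..1} \<psi>" "\<And>t. t \<in> {0..1} \<Longrightarrow> \<psi> t \<in> {0..1}"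
    and ends: "\<phi> 0 = \<psi> 0" "\<phi> 1 = \<psi> 1" "c (\<phi> 0) = z" "c (\<phi> 1) = z"
    and f: "\<And>t. t \<in> {0..1} \<Longrightarrow> f t = c (\<phi> t)" and g: "\<And>t. t \<in> {0..1} \<Longrightarrow> g t = c (\<psi> t)"
  shows "loop_homotopic Z z f g"
proof (rule loop_homotopicI)
  let ?k = "\<lambda>p. (1 - fst p) * \<phi> (snd p) + fst p * \<psi> (snd p)"
  have "continuous_on ({0..1} \<times> {0..1}) ?k"
    by (intro continuous_intros continuous_on_compose2[OF \<phi>(1)] continuous_on_compose2[OF \<psi>(1)]) auto
  moreover have "?k p \<in> {0..1}" if "p \<in> {0..1} \<times> {0..1}" for p
    using that \<phi>(2) \<psi>(2) convexD[of "{0..1::real}" "\<phi> (snd p)" "\<psi> (snd p)" "1 - fst p" "fst p"] by auto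
  ultimately have "continuous_map (prod_topology unit_interval unit_interval) unit_interval ?k"
    by (auto simp: prod_topology_subtopology_eu)
  from continuous_map_compose[OF this c]
  show "continuous_map (prod_topology unit_interval unit_interval) Z
          (\<lambda>(r, t). c ((1 - r) * \<phi> t + r * \<psi> t))"
    by (simp add: o_def case_prod_unfold)
  have "(1 - r) * a + r * a = a" for r a :: real
    by (simp add: algebra_simps)
  then show "c ((1 - r) * \<phi> 0 + r * \<psi> 0) = z" "c ((1 - r) * \<phi> 1 + r * \<psi> 1) = z" for r
    using ends by simp_all
qed (use f g in simp_all)

lemma fundamental_group_mult:
  assumes f: "f \<in> topspace (loop_space Z z)" and g: "g \<in> topspace (loop_space Z z)"
  shows "loop_class Z z f \<otimes>\<^bsub>fundamental_group Z z\<^esub> loop_class Z z g = loop_class Z z (loop_concat f g)"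
proof -
  have eq: "loop_class Z z (loop_concat f' g') = loop_class Z z (loop_concat f g)"
    if "f' \<in> loop_class Z z f" "g' \<in> loop_class Z z g" for f' g'
    using that f g
    by (subst loop_class_eq_iff)
      (auto simp: loop_class_def loop_concat_loop homotopic_with_sym intro: loop_homotopic_concat)
  have "f \<in> loop_class Z z f" "g \<in> loop_class Z z g"
    using f g by (auto simp: loop_class_def loop_iff)
  then have "(\<Union>f'\<in>loop_class Z z f. \<Union>g'\<in>loop_class Z z g. loop_class Z z (loop_concat f' g')) =
      (\<Union>f'\<in>loop_class Z z f. \<Union>g'\<in>loop_class Z z g. loop_class Z z (loop_concat f g))"
    by (intro SUP_cong refl eq)
  also have "\<dots> = loop_class Z z (loop_concat f g)"
    using \<open>f \<in> loop_class Z z f\<close> \<open>g \<in> loop_class Z z g\<close> by (metis UN_constant empty_iff)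
  finally show ?thesis
    by (simp add: fundamental_group_def)
qed

lemma carrier_fundamental_group:
  "carrier (fundamental_group Z z) = loop_class Z z ` topspace (loop_space Z z)"
  by (simp add: fundamental_group_def)

lemma loop_class_in_fundamental_group:
  "f \<in> topspace (loop_space Z z) \<Longrightarrow> loop_class Z z f \<in> carrier (fundamental_group Z z)"
  by (simp add: carrier_fundamental_group)

lemma one_fundamental_group: "\<one>\<^bsub>fundamental_group Z z\<^esub> = loop_class Z z (\<lambda>t\<in>{0..1}. z)"
  by (simp add: fundamental_group_def)

definition reverse_loop :: "(real \<Rightarrow> 'a) \<Rightarrow> real \<Rightarrow> 'a" where
  "reverse_loop f = (\<lambda>t\<in>{0..1}. f (1 - t))"

lemma reverse_loop_loop:
  assumes "f \<in> topspace (loop_space Z z)"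
  shows "reverse_loop f \<in> topspace (loop_space Z z)"
proof -
  have "continuous_map unit_interval unit_interval (\<lambda>t::real. 1 - t)"
    by (auto intro!: continuous_intros)
  with assms show ?thesis
    unfolding reverse_loop_def
    using continuous_map_compose[of unit_interval unit_interval "\<lambda>t. 1 - t" Z f]
    by (intro restrict_loop) (auto simp: loop_iff o_def)
qed

lemma loop_homotopic_concat_assoc:
  assumes f: "f \<in> topspace (loop_space Z z)" and g: "g \<in> topspace (loop_space Z z)"
    and h: "h \<in> topspace (loop_space Z z)"
  shows "loop_homotopic Z z (loop_concat (loop_concat f g) h) (loop_concat f (loop_concat g h))"
\<comment> \<open>The change of parameter has slopes 1/2, 1 and 2 with breaks at 1/2 and 3/4. It is
  convex, hence the maximum of its three affine pieces, which makes its continuity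
  immediate.\<close>
proof (rule reparametrization_homotopic[where \<phi> = "\<lambda>t. t"
    and \<psi> = "\<lambda>t. max (t / 2) (max (t - 1/4) (2 * t - 1))"])
  let ?c = "loop_concat (loop_concat f g) h"
  have "?c \<in> topspace (loop_space Z z)"
    using assms by (simp add: loop_concat_loop)
  then show "continuous_map unit_interval Z ?c" "?c 0 = z" "?c 1 = z"
    by (simp_all add: loop_iff)
  fix t :: real assume t: "t \<in> {0..1}"
  consider "t \<le> 1/2" | "1/2 < t" "t \<le> 3/4" | "3/4 < t" by linarith
  then show "loop_concat f (loop_concat g h) t = ?c (max (t / 2) (max (t - 1/4) (2 * t - 1)))"
  proof cases
    case 1
    then have "max (t / 2) (max (t - 1/4) (2 * t - 1)) = t / 2" by auto
    with 1 t show ?thesis by (simp add: loop_concat_def)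
  next
    case 2
    then have "max (t / 2) (max (t - 1/4) (2 * t - 1)) = t - 1/4" by auto
    with 2 t show ?thesis by (simp add: loop_concat_def algebra_simps)
  next
    case 3
    then have "max (t / 2) (max (t - 1/4) (2 * t - 1)) = 2 * t - 1" by auto
    with 3 t show ?thesis by (simp add: loop_concat_def algebra_simps)
  qed
qed (auto intro!: continuous_intros simp: le_max_iff_disj)

lemma loop_homotopic_const_concat:
  assumes f: "f \<in> topspace (loop_space Z z)"
  shows "loop_homotopic Z z (loop_concat (\<lambda>t\<in>{0..1}. z) f) f"
proof (rule reparametrization_homotopic[where \<phi> = "\<lambda>t. max 0 (2 * t - 1)" and \<psi> = "\<lambda>t. t"])
  show "continuous_map unit_interval Z f" "f (max 0 (2 * 0 - 1)) = z" "f (max 0 (2 * 1 - 1)) = z"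
    using f by (auto simp: loop_iff)
  show "loop_concat (\<lambda>t\<in>{0..1}. z) f t = f (max 0 (2 * t - 1))" if "t \<in> {0..1}" for t
  proof (cases "t \<le> 1/2")
    case True
    then have "max 0 (2 * t - 1) = 0" by auto
    with True that f show ?thesis by (simp add: loop_concat_def loop_iff)
  next
    case False
    then have "max 0 (2 * t - 1) = 2 * t - 1" by auto
    with False that show ?thesis by (simp add: loop_concat_def)
  qed
qed (auto intro!: continuous_intros)

text \<open>The concatenation follows \<open>f\<close> along the parameter \<bar>1 - 2 * t\<bar>,
  which runs from 1 to 0 and back, and this parameter contracts to the constant 1 with both ends
  fixed.\<close>

lemma loop_homotopic_reverse_concat:
  assumes f: "f \<in> topspace (loop_space Z z)"
  shows "loop_homotopic Z z (loop_concat (reverse_loop f) f) (\<lambda>t\<in>{0..1}. z)"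
proof (rule reparametrization_homotopic[where \<phi> = "\<lambda>t. \<bar>1 - 2 * t\<bar>" and \<psi> = "\<lambda>t. 1"])
  show "continuous_map unit_interval Z f" "f \<bar>1 - 2 * 0\<bar> = z" "f \<bar>1 - 2 * 1\<bar> = z"
    using f by (auto simp: loop_iff)
  show "loop_concat (reverse_loop f) f t = f \<bar>1 - 2 * t\<bar>" if "t \<in> {0..1}" for t
    using that by (auto simp: loop_concat_def reverse_loop_def)
  show "(\<lambda>t\<in>{0..1}. z) t = f 1" if "t \<in> {0..1}" for t
    using that f by (simp add: loop_iff)
qed (auto intro!: continuous_intros simp: abs_le_iff)

lemma group_fundamental_group:
  assumes z: "z \<in> topspace Z"
  shows "group (fundamental_group Z z)"
proof (rule groupI)
  let ?G = "fundamental_group Z z"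
  fix A B C
  assume "A \<in> carrier ?G"
  then obtain f where f: "f \<in> topspace (loop_space Z z)" "A = loop_class Z z f"
    by (auto simp: carrier_fundamental_group)
  show "\<one>\<^bsub>?G\<^esub> \<otimes>\<^bsub>?G\<^esub> A = A"
    using f const_loop[OF z] loop_homotopic_const_concat[OF f(1)]
    by (simp add: one_fundamental_group fundamental_group_mult loop_class_eq_iff loop_concat_loop)
  have "loop_class Z z (reverse_loop f) \<otimes>\<^bsub>?G\<^esub> A = \<one>\<^bsub>?G\<^esub>"
    using f const_loop[OF z] loop_homotopic_reverse_concat[OF f(1)]
    by (simp add: one_fundamental_group fundamental_group_mult loop_class_eq_iff loop_concat_loop
        reverse_loop_loop)
  then show "\<exists>B\<in>carrier ?G. B \<otimes>\<^bsub>?G\<^esub> A = \<one>\<^bsub>?G\<^esub>"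
    using f reverse_loop_loop[OF f(1)] by (auto simp: carrier_fundamental_group)
  assume "B \<in> carrier ?G"
  then obtain g where g: "g \<in> topspace (loop_space Z z)" "B = loop_class Z z g"
    by (auto simp: carrier_fundamental_group)
  show "A \<otimes>\<^bsub>?G\<^esub> B \<in> carrier ?G"
    using f g by (auto simp: carrier_fundamental_group fundamental_group_mult loop_concat_loop)
  assume "C \<in> carrier ?G"
  then obtain h where h: "h \<in> topspace (loop_space Z z)" "C = loop_class Z z h"
    by (auto simp: carrier_fundamental_group)
  show "A \<otimes>\<^bsub>?G\<^esub> B \<otimes>\<^bsub>?G\<^esub> C = A \<otimes>\<^bsub>?G\<^esub> (B \<otimes>\<^bsub>?G\<^esub> C)"
    using f g h loop_homotopic_concat_assoc[OF f(1) g(1) h(1)]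
    by (simp add: fundamental_group_mult loop_concat_loop loop_class_eq_iff)
next
  show "\<one>\<^bsub>fundamental_group Z z\<^esub> \<in> carrier (fundamental_group Z z)"
    using const_loop[OF z] unfolding carrier_fundamental_group one_fundamental_group by (rule imageI)
qed

lemma inv_fundamental_group:
  assumes z: "z \<in> topspace Z" and f: "f \<in> topspace (loop_space Z z)"
  shows "inv\<^bsub>fundamental_group Z z\<^esub> loop_class Z z f = loop_class Z z (reverse_loop f)"
proof -
  interpret group "fundamental_group Z z" by (rule group_fundamental_group[OF z])
  have "loop_class Z z (reverse_loop f) \<otimes>\<^bsub>fundamental_group Z z\<^esub> loop_class Z z f =
      \<one>\<^bsub>fundamental_group Z z\<^esub>"
    using f const_loop[OF z] loop_homotopic_reverse_concat[OF f]
    by (simp add: one_fundamental_group fundamental_group_mult loop_class_eq_iff loop_concat_loop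
        reverse_loop_loop)
  then show ?thesis
    using loop_class_in_fundamental_group[OF f] loop_class_in_fundamental_group[OF reverse_loop_loop[OF f]]
    by (rule inv_equality)
qed

section \<open>Cutting a loop at its visits to the basepoint\<close>

definition loop_piece :: "(real \<Rightarrow> 'a) \<Rightarrow> real \<Rightarrow> real \<Rightarrow> real \<Rightarrow> 'a" where
  "loop_piece f a c = (\<lambda>t\<in>{0..1}. f (a + (c - a) * t))"

lemma affine_in_interval:
  fixes a c t :: real
  assumes "a \<le> c" "t \<in> {0..1}"
  shows "a + (c - a) * t \<in> {a..c}"
  using assms mult_left_le[of t "c - a"] by auto

lemma continuous_map_affine:
  fixes a c :: real
  assumes "a \<le> c"
  shows "continuous_map unit_interval (top_of_set {a..c}) (\<lambda>t. a + (c - a) * t)"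
proof -
  have "continuous_on {0..1} (\<lambda>t. a + (c - a) * t)"
    by (intro continuous_intros)
  then show ?thesis
    using affine_in_interval[OF assms] by auto
qed

lemma loop_piece_loop:
  assumes "continuous_map unit_interval Z f" "0 \<le> a" "a \<le> c" "c \<le> 1" "f a = z" "f c = z"
  shows "loop_piece f a c \<in> topspace (loop_space Z z)"
proof -
  have "continuous_map (top_of_set {a..c}) Z f"
    using assms by (intro continuous_map_from_subtopology_mono[OF assms(1)]) auto
  from continuous_map_compose[OF continuous_map_affine[OF \<open>a \<le> c\<close>] this] show ?thesis
    unfolding loop_piece_def using assms by (intro restrict_loop) (auto simp: o_def)
qed

lemma loop_class_piece_mult:
  assumes f: "continuous_map unit_interval Z f"
    and ac: "0 \<le> a" "a \<le> c" "c \<le> 1" "f 0 = z" "f a = z" "f c = z"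
  shows "loop_class Z z (loop_piece f 0 a) \<otimes>\<^bsub>fundamental_group Z z\<^esub> loop_class Z z (loop_piece f a c)
           = loop_class Z z (loop_piece f 0 c)"
proof -
  have l: "loop_piece f 0 a \<in> topspace (loop_space Z z)" "loop_piece f a c \<in> topspace (loop_space Z z)"
    "loop_piece f 0 c \<in> topspace (loop_space Z z)"
    using assms by (auto intro: loop_piece_loop)
  have "loop_homotopic Z z (loop_concat (loop_piece f 0 a) (loop_piece f a c)) (loop_piece f 0 c)"
  \<comment> \<open>The concatenation traverses \<open>{0..a}\<close> in the first half and
    \<open>{a..c}\<close> in the second. The \<open>min\<close> and \<open>max\<close> merge these
    two affine maps into one continuous expression.\<close>
  proof (rule reparametrization_homotopic[OF f, where \<psi> = "\<lambda>t. c * t"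
        and \<phi> = "\<lambda>t. a * min (2 * t) 1 + (c - a) * max (2 * t - 1) 0"])
    fix t :: real assume t: "t \<in> {0..1}"
    have "c * t \<le> 1" "0 \<le> c * t"
      using ac t mult_le_one[of c t] by auto
    then show "c * t \<in> {0..1}" by simp
    have 1: "0 \<le> (c - a) * max (2 * t - 1) 0" "(c - a) * max (2 * t - 1) 0 \<le> c - a"
      using ac t mult_left_le[of "max (2 * t - 1) 0" "c - a"] by auto
    have 2: "0 \<le> a * min (2 * t) 1" "a * min (2 * t) 1 \<le> a"
      using ac t mult_left_le[of "min (2 * t) 1" a] by auto
    show "a * min (2 * t) 1 + (c - a) * max (2 * t - 1) 0 \<in> {0..1}"
      using 1 2 ac by simp
    show "loop_concat (loop_piece f 0 a) (loop_piece f a c) t =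
        f (a * min (2 * t) 1 + (c - a) * max (2 * t - 1) 0)"
      using t by (auto simp: loop_concat_def loop_piece_def min_def max_def)
    show "loop_piece f 0 c t = f (c * t)"
      using t by (simp add: loop_piece_def)
  qed (use ac in \<open>auto intro!: continuous_intros\<close>)
  then show ?thesis
    using l by (simp add: fundamental_group_mult loop_class_eq_iff loop_concat_loop)
qed

section \<open>Maps into and out of loop spaces\<close>

lemma continuous_map_curry:
  assumes F: "continuous_map (prod_topology Y A) Z (\<lambda>(y, t). f y t)"
  shows "continuous_map Y (compact_open_topology A Z) (\<lambda>y. \<lambda>t\<in>topspace A. f y t)"
  unfolding compact_open_topology_def
proof (rule continuous_on_generated_topo)
  have cont: "(\<lambda>t\<in>topspace A. f y t) \<in> continuous_maps A Z" if "y \<in> topspace Y" for y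
    using continuous_map_o_Pair[OF F that]
      continuous_map_eq[of A Z "f y" "restrict (f y) (topspace A)"]
    by (auto simp: continuous_maps_def o_def)
  show "(\<lambda>y. \<lambda>t\<in>topspace A. f y t) ` topspace Y \<subseteq>
      \<Union>{{f \<in> continuous_maps A Z. f ` K \<subseteq> U} | K U. compactin A K \<and> openin Z U}"
    using cont compactin_empty[of A] openin_empty[of Z] by fast
  fix W assume "W \<in> {{f \<in> continuous_maps A Z. f ` K \<subseteq> U} | K U. compactin A K \<and> openin Z U}"
  then obtain K U where W: "W = {f \<in> continuous_maps A Z. f ` K \<subseteq> U}"
      and K: "compactin A K" and U: "openin Z U" by auto
  have KA: "K \<subseteq> topspace A"
    by (rule compactin_subset_topspace[OF K])
  let ?O = "{p \<in> topspace (prod_topology Y A). (\<lambda>(y, t). f y t) p \<in> U}"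
  have op: "openin (prod_topology Y A) ?O"
    by (rule openin_continuous_map_preimage[OF F U])
  have eq: "(\<lambda>y. \<lambda>t\<in>topspace A. f y t) -` W \<inter> topspace Y = {y \<in> topspace Y. {y} \<times> K \<subseteq> ?O}"
    using KA cont unfolding W by auto (blast+)?
  show "openin Y ((\<lambda>y. \<lambda>t\<in>topspace A. f y t) -` W \<inter> topspace Y)"
    unfolding eq
  proof (rule openin_subopen[THEN iffD2], rule ballI)
    fix y assume "y \<in> {y \<in> topspace Y. {y} \<times> K \<subseteq> ?O}"
    then have y: "y \<in> topspace Y" "{y} \<times> K \<subseteq> ?O"
      by blast+
    \<comment> \<open>Compactness of \<open>K\<close> enters here: an open set containing the slice
      \<open>{y} \<times> K\<close> contains a box around it, so the subbasic condition persists for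
      nearby \<open>y\<close>.\<close>
    obtain O1 O2 where O: "openin Y O1" "y \<in> O1" "K \<subseteq> O2" "O1 \<times> O2 \<subseteq> ?O"
      using tube_lemma_right[OF op K y] by blast
    then have "O1 \<subseteq> {y \<in> topspace Y. {y} \<times> K \<subseteq> ?O}"
      using openin_subset[OF O(1)] by blast
    with O show "\<exists>T. openin Y T \<and> y \<in> T \<and> T \<subseteq> {y \<in> topspace Y. {y} \<times> K \<subseteq> ?O}"
      by blast
  qed
qed

lemma continuous_map_loop_family:
  assumes "continuous_map (prod_topology Y unit_interval) Z (\<lambda>(y, t). f y t)"
    and "\<And>y. y \<in> topspace Y \<Longrightarrow> f y 0 = z" "\<And>y. y \<in> topspace Y \<Longrightarrow> f y 1 = z"
  shows "continuous_map Y (loop_space Z z) (\<lambda>y. \<lambda>t\<in>{0..1}. f y t)"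
  using continuous_map_curry[OF assms(1)] assms(2,3)
  by (auto simp: loop_space_def intro!: continuous_map_into_subtopology)

lemma openin_loop_space_image_subset:
  assumes "openin Z U" "compactin unit_interval K"
  shows "openin (loop_space Z z) {f \<in> topspace (loop_space Z z). f ` K \<subseteq> U}"
proof -
  have "openin (compact_open_topology unit_interval Z) {f \<in> continuous_maps unit_interval Z. f ` K \<subseteq> U}"
    unfolding compact_open_topology_def using assms by (intro topology_generated_by_Basis) auto
  then have "openin (loop_space Z z)
      ({f \<in> continuous_maps unit_interval Z. f ` K \<subseteq> U} \<inter> {f. f 0 = z \<and> f 1 = z})"
    unfolding loop_space_def by (rule openin_subtopology_Int)
  moreover have "{f \<in> topspace (loop_space Z z). f ` K \<subseteq> U} =
      {f \<in> continuous_maps unit_interval Z. f ` K \<subseteq> U} \<inter> {f. f 0 = z \<and> f 1 = z}"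
    by (auto simp: loop_space_def)
  ultimately show ?thesis
    by (simp only:)
qed

lemma continuous_map_loop_eval:
  assumes "t \<in> {0..1}"
  shows "continuous_map (loop_space Z z) Z (\<lambda>f. f t)"
  unfolding continuous_map_def
proof (intro conjI allI impI)
  show "(\<lambda>f. f t) \<in> topspace (loop_space Z z) \<rightarrow> topspace Z"
    using assms by (auto simp: loop_iff continuous_map_def Pi_iff)
  fix U assume "openin Z U"
  then show "openin (loop_space Z z) {f \<in> topspace (loop_space Z z). f t \<in> U}"
    using openin_loop_space_image_subset[of Z U "{t}" z] assms by simp
qed

lemma continuous_map_loop_class: "continuous_map (loop_space Z z) (pi1_top Z z) (loop_class Z z)"
  unfolding pi1_top_def by (rule quotient_imp_continuous_map[OF quotient_map_quotient_topology])

section \<open>Topologies on words and on the free group\<close>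

lemma quotient_topology_compose:
  "quotient_topology (quotient_topology X p) q = quotient_topology X (q \<circ> p)"
proof -
  have "{x \<in> topspace X. p x \<in> {y \<in> p ` topspace X. q y \<in> U}} = {x \<in> topspace X. (q \<circ> p) x \<in> U}" for U
    by auto
  then show ?thesis
    by (simp add: topology_eq openin_quotient_topology image_comp)
qed

lemma quotient_topology_cong:
  assumes "\<And>x. x \<in> topspace X \<Longrightarrow> p x = q x"
  shows "quotient_topology X p = quotient_topology X q"
proof -
  have "p ` topspace X = q ` topspace X"
    using assms by simp
  moreover have "{x \<in> topspace X. p x \<in> U} = {x \<in> topspace X. q x \<in> U}" for U
    using assms by auto
  ultimately show ?thesis
    by (simp add: topology_eq openin_quotient_topology)
qed

section \<open>Continuity criteria for the word monoid\<close>

lemma continuous_map_to_quotient: "continuous_map X (quotient_topology X q) q"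
  by (rule quotient_imp_continuous_map[OF quotient_map_quotient_topology])

lemma continuous_map_letter:
  assumes "continuous_map Z Y f"
  shows "continuous_map Z (letter_topology Y) (\<lambda>z. (e, f z))"
  using continuous_map_compose[OF assms continuous_map_component_injection[of e UNIV "\<lambda>_. Y"]]
  by (simp add: letter_topology_def o_def)

lemma continuous_map_from_letter:
  assumes "\<And>e. continuous_map Y Z (\<lambda>y. f (e, y))"
  shows "continuous_map (letter_topology Y) Z f"
  unfolding letter_topology_def by (intro continuous_map_from_sum assms)

lemma continuous_map_into_monoid:
  assumes "\<forall>l\<in>set ls. continuous_map Z (letter_topology Y) l"
  shows "continuous_map Z (monoid_topology Y) (\<lambda>z. map (\<lambda>l. l z) ls)"
proof -
  let ?n = "length ls"
  let ?P = "\<lambda>n. product_topology (\<lambda>_. letter_topology Y) {..<n::nat}"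
  have "continuous_map Z (?P ?n) (\<lambda>z. \<lambda>i\<in>{..<?n}. (ls ! i) z)"
    using assms by (auto simp: continuous_map_componentwise)
  from continuous_map_compose[OF this continuous_map_component_injection[of ?n UNIV ?P]]
  have "continuous_map Z (sum_topology ?P UNIV) (\<lambda>z. (?n, \<lambda>i\<in>{..<?n}. (ls ! i) z))"
    by (simp add: o_def)
  from continuous_map_compose[OF this continuous_map_to_quotient[where q = "\<lambda>(n, p). map p [0..<n]"]]
  have "continuous_map Z (monoid_topology Y) (\<lambda>z. map (\<lambda>i\<in>{..<?n}. (ls ! i) z) [0..<?n])"
    by (simp add: monoid_topology_def o_def)
  moreover have "map (\<lambda>i\<in>{..<?n}. (ls ! i) z) [0..<?n] = map (\<lambda>l. l z) ls" for z
    by (rule nth_equalityI) auto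
  ultimately show ?thesis
    by simp
qed

text \<open>Each summand of the monoid is a finite power, and the identity word on it is the list of
  its projections. Testing against all lists of continuous letters over any \<open>Q\<close>, and
  not against the projections only, permits induction on the list with \<open>Q\<close>
  fixed.\<close>

lemma continuous_map_from_monoid:
  fixes Y :: "'y topology"
  assumes "\<And>(Q :: (nat \<Rightarrow> 'y letter) topology) ls. \<forall>l\<in>set ls. continuous_map Q (letter_topology Y) l \<Longrightarrow>
             continuous_map Q Z (\<lambda>p. f (map (\<lambda>l. l p) ls))"
  shows "continuous_map (monoid_topology Y) Z f"
  unfolding monoid_topology_def
proof (intro continuous_map_from_quotient continuous_map_from_sum)
  fix n :: nat
  let ?P = "product_topology (\<lambda>_. letter_topology Y) {..<n}"
  have "continuous_map ?P Z (\<lambda>p. f (map (\<lambda>l. l p) (map (\<lambda>i p. p i) [0..<n])))"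
    by (rule assms) (auto intro: continuous_map_product_projection)
  then show "continuous_map ?P Z (\<lambda>x. (f \<circ> (\<lambda>(n, p). map p [0..<n])) (n, x))"
    by (simp add: o_def)
qed

lemma continuous_map_monoid_map:
  assumes "continuous_map X Y f"
  shows "continuous_map (monoid_topology X) (monoid_topology Y) (map (apsnd f))"
proof (rule continuous_map_from_monoid)
  fix Q :: "(nat \<Rightarrow> 'a letter) topology" and ls
  assume ls: "\<forall>l\<in>set ls. continuous_map Q (letter_topology X) l"
  have f: "continuous_map (letter_topology X) (letter_topology Y) (apsnd f)"
    using continuous_map_letter[OF assms] by (intro continuous_map_from_letter) simp
  then have "\<forall>l\<in>set (map (\<lambda>l. apsnd f \<circ> l) ls). continuous_map Q (letter_topology Y) l"
    using ls by (auto intro: continuous_map_compose[OF _ f])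
  from continuous_map_into_monoid[OF this]
  show "continuous_map Q (monoid_topology Y) (\<lambda>p. map (apsnd f) (map (\<lambda>l. l p) ls))"
    by (simp add: o_def)
qed

lemma reduce_word_Cons_reduce [simp]: "reduce_word (a # reduce_word w) = reduce_word (a # w)"
  using reduce_word_append_right[of "[a]" w] by simp

lemma singleton_in_free_group: "snd a \<in> A \<Longrightarrow> [a] \<in> carrier (free_group A)"
  by (simp add: free_group_def reduced_word_def)

lemma inv_generator:
  assumes "y \<in> A"
  shows "inv\<^bsub>free_group A\<^esub> generator y = [(False, y)]"
proof -
  interpret group "free_group A" by (rule group_free_group)
  have "[(False, y)] \<otimes>\<^bsub>free_group A\<^esub> generator y = \<one>\<^bsub>free_group A\<^esub>"
    by (simp add: free_group_def generator_def reduce_word_def inv_letter_def)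
  then show ?thesis
    using assms by (intro inv_equality) (auto simp: generator_closed singleton_in_free_group)
qed

text \<open>The reduction of a word is the product of its letters in the free group, so continuity
  of multiplication and inversion in \<open>T\<close> gives the claim by induction on the
  length.\<close>

lemma continuous_map_reduce_word:
  assumes T: "topological_group (free_group (topspace Y)) T" and gen: "continuous_map Y T generator"
  shows "continuous_map (monoid_topology Y) T reduce_word"
proof (rule continuous_map_from_monoid)
  let ?F = "free_group (topspace Y)"
  have top: "topspace T = carrier ?F"
    and mult: "continuous_map (prod_topology T T) T (\<lambda>(x, y). x \<otimes>\<^bsub>?F\<^esub> y)"
    and inv: "continuous_map T T (\<lambda>x. inv\<^bsub>?F\<^esub> x)"
    using T by (auto simp: topological_group_def)
  have letter: "continuous_map (letter_topology Y) T (\<lambda>a. [a])"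
  proof (rule continuous_map_from_letter)
    fix e :: bool
    show "continuous_map Y T (\<lambda>y. [(e, y)])"
    proof (cases e)
      case True
      then show ?thesis using gen by (simp add: generator_def[abs_def])
    next
      case False
      then show ?thesis
        using continuous_map_compose[OF gen inv]
        by (auto elim!: continuous_map_eq simp: inv_generator)
    qed
  qed
  fix Q :: "(nat \<Rightarrow> 'a letter) topology" and ls
  assume "\<forall>l\<in>set ls. continuous_map Q (letter_topology Y) l"
  then show "continuous_map Q T (\<lambda>p. reduce_word (map (\<lambda>l. l p) ls))"
  proof (induction ls)
    case Nil
    have "reduce_word [] \<in> topspace T"
      by (simp add: top reduce_word_in_free_group)
    then show ?case by simp
  next
    case (Cons l ls)
    have l: "continuous_map Q T (\<lambda>p. [l p])"
      using continuous_map_compose[OF _ letter, of Q l] Cons.prems by (simp add: o_def)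
    have ls: "continuous_map Q T (\<lambda>p. reduce_word (map (\<lambda>l. l p) ls))"
      using Cons by simp
    have "continuous_map Q T (\<lambda>p. [l p] \<otimes>\<^bsub>?F\<^esub> reduce_word (map (\<lambda>l. l p) ls))"
      using continuous_map_compose[OF continuous_map_pairedI[OF l ls] mult] by (simp add: o_def)
    then show ?case
      by (simp add: free_group_def)
  qed
qed

section \<open>The three topologies on the free group of components\<close>

lemma topspace_pi0_top: "topspace (pi0_top X) = path_component_of_set X ` topspace X"
  by (simp add: pi0_top_def)

definition component_word :: "'x topology \<Rightarrow> 'x word \<Rightarrow> 'x set word" where
  "component_word X w = reduce_word (map (apsnd (path_component_of_set X)) w)"

lemma component_word_in_free_group:
  assumes "w \<in> topspace (monoid_topology X)"
  shows "component_word X w \<in> carrier (free_group (topspace (pi0_top X)))"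
  unfolding component_word_def
  using assms by (intro reduce_word_in_free_group) (auto simp: topspace_monoid_topology topspace_pi0_top)

text \<open>A quotient of a quotient is a quotient by the composite map. This removes the path
  components of the monoid and the choice inside \<open>psi\<close>, and leaves a quotient of words
  over \<open>X\<close> itself, which can be compared with loops.\<close>

lemma FRP_topology_eq: "FRP_topology X = quotient_topology (monoid_topology X) (component_word X)"
proof -
  have "FRP_topology X = quotient_topology (monoid_topology X)
      ((reduce_word \<circ> psi X) \<circ> path_component_of_set (monoid_topology X))"
    by (simp add: FRP_topology_def pi0_top_def quotient_topology_compose)
  also have "\<dots> = quotient_topology (monoid_topology X) (component_word X)"
    by (rule quotient_topology_cong) (simp add: psi_path_component component_word_def)
  finally show ?thesis .
qed

lemma topspace_FR_topology: "topspace (FR_topology Y) = carrier (free_group (topspace Y))"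
proof -
  have "w \<in> reduce_word ` topspace (monoid_topology Y)" if "w \<in> carrier (free_group (topspace Y))" for w
    using that by (intro image_eqI[of _ _ w])
      (auto simp: free_group_def reduce_word_reduced topspace_monoid_topology)
  then show ?thesis
    by (auto simp: FR_topology_def topspace_monoid_topology intro!: reduce_word_in_free_group)
qed

text \<open>A reduced word over components is lifted letter by letter to points of \<open>X\<close>;
  its image is reduced already, so reduction returns it unchanged.\<close>

lemma component_word_surj:
  "component_word X ` topspace (monoid_topology X) = carrier (free_group (topspace (pi0_top X)))"
proof -
  have "w \<in> component_word X ` topspace (monoid_topology X)"
    if "w \<in> carrier (free_group (topspace (pi0_top X)))" for w
  proof -
    have "reduced_word w" and "snd ` set w \<subseteq> path_component_of_set X ` topspace X"
      using that by (auto simp: free_group_def topspace_pi0_top)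
    have "\<exists>b. snd b \<in> topspace X \<and> apsnd (path_component_of_set X) b = a" if "a \<in> set w" for a
    proof -
      have "snd a \<in> path_component_of_set X ` topspace X"
        using imageI[OF that, of snd] \<open>snd ` set w \<subseteq> path_component_of_set X ` topspace X\<close>
        by (rule rev_subsetD)
      then obtain x where x: "x \<in> topspace X" "snd a = path_component_of_set X x"
        by (rule imageE)
      then have "apsnd (path_component_of_set X) (fst a, x) = a"
        by (metis apsnd_conv prod.collapse)
      with x show ?thesis
        by (intro exI[of _ "(fst a, x)"]) simp
    qed
    then obtain b where "\<And>a. a \<in> set w \<Longrightarrow> snd (b a) \<in> topspace X"
        and b: "\<And>a. a \<in> set w \<Longrightarrow> apsnd (path_component_of_set X) (b a) = a"
      by metis
    then have "map b w \<in> topspace (monoid_topology X)"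
      by (auto simp: topspace_monoid_topology)
    moreover have "component_word X (map b w) = w"
      using b \<open>reduced_word w\<close> by (simp add: component_word_def o_def reduce_word_reduced cong: map_cong)
    ultimately show ?thesis
      by (metis imageI)
  qed
  then show ?thesis
    by (auto intro: component_word_in_free_group)
qed

lemma topspace_FRP_topology:
  "topspace (FRP_topology X) = carrier (free_group (topspace (pi0_top X)))"
  by (simp add: FRP_topology_eq component_word_surj)

text \<open>A continuous map of spaces induces a continuous map of words. The opposite direction is
  not formal, since finite powers of the quotient map onto the components need not be quotient
  maps.\<close>

lemma continuous_map_FRP_FR: "continuous_map (FRP_topology X) (FR_topology (pi0_top X)) (\<lambda>w. w)"
  unfolding FRP_topology_eq
proof (rule continuous_map_from_quotient)
  have "continuous_map X (pi0_top X) (path_component_of_set X)"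
    unfolding pi0_top_def by (rule continuous_map_to_quotient)
  from continuous_map_compose[OF continuous_map_monoid_map[OF this] continuous_map_to_quotient]
  show "continuous_map (monoid_topology X) (FR_topology (pi0_top X)) ((\<lambda>w. w) \<circ> component_word X)"
    by (simp add: FR_topology_def component_word_def[abs_def] o_def)
qed

lemma continuous_map_FR_FM: "continuous_map (FR_topology Y) (FM_topology Y) (\<lambda>w. w)"
  unfolding FR_topology_def
proof (rule continuous_map_from_quotient)
  \<comment> \<open>The type \<open>unit\<close> is an arbitrary choice: being a group topology with
    continuous generators does not refer to it.\<close>
  have "is_free_topological_group TYPE(unit) Y (FM_topology Y)"
    by (rule is_free_topological_group_FM_topology)
  then have "continuous_map (monoid_topology Y) (FM_topology Y) reduce_word"
    unfolding is_free_topological_group_def by (intro continuous_map_reduce_word) blast+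
  then show "continuous_map (monoid_topology Y) (FM_topology Y) ((\<lambda>w. w) \<circ> reduce_word)"
    by (simp add: o_def)
qed

lemma topspace_FM_topology: "topspace (FM_topology Y) = carrier (free_group (topspace Y))"
  using is_free_topological_group_FM_topology[of Y, where 'g = unit]
  by (simp add: is_free_topological_group_def topological_group_def)

text \<open>A homeomorphism that is the identity on points identifies the open sets, so the
  conditions on \<Phi> and \<Psi> become equalities of topologies.\<close>

lemma topological_isomorphism_ident_iff:
  "topological_isomorphism G S G T (\<lambda>w. w) \<longleftrightarrow> S = T"
proof -
  have "(\<lambda>w. w) \<in> iso G G"
    by (simp add: iso_def hom_def bij_betw_def)
  then show ?thesis
    using homeomorphic_map_id[of S T] by (auto simp: topological_isomorphism_def id_def)
qed

lemma topology_eq_if_continuous_ident: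
  assumes "topspace S = topspace T" "continuous_map S T (\<lambda>x. x)" "continuous_map T S (\<lambda>x. x)"
  shows "S = T"
proof -
  have "homeomorphic_maps S T (\<lambda>x. x) (\<lambda>x. x)"
    using assms by (simp add: homeomorphic_maps_def)
  then have "homeomorphic_map S T id"
    using homeomorphic_maps_imp_map by (fastforce simp: id_def)
  then show ?thesis
    by (simp only: homeomorphic_map_id)
qed

text \<open>Transport of structure: with \<open>k\<close> the inverse of \<open>h\<close>, the
  operations of \<open>G\<close> are those of \<open>H\<close> conjugated by \<open>h\<close> and
  \<open>k\<close>.\<close>

lemma topological_group_iso:
  assumes h: "topological_isomorphism G T H S h" and G: "group G" "topspace T = carrier G"
    and H: "topological_group H S"
  shows "topological_group G T"
proof -
  have iso: "h \<in> iso G H" and homeo: "homeomorphic_map T S h"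
    using h by (auto simp: topological_isomorphism_def)
  have grp: "group H" and S: "topspace S = carrier H"
    and mult: "continuous_map (prod_topology S S) S (\<lambda>(x, y). x \<otimes>\<^bsub>H\<^esub> y)"
    and inv: "continuous_map S S (\<lambda>x. inv\<^bsub>H\<^esub> x)"
    using H by (auto simp: topological_group_def)
  interpret G: group G by (rule G(1))
  interpret h: group_hom G H h
    using G grp iso by (simp add: group_hom_def group_hom_axioms_def iso_def)
  obtain k where k: "homeomorphic_maps T S h k"
    using homeo homeomorphic_map_maps by blast
  then have hc: "continuous_map T S h" and kc: "continuous_map S T k"
    and kh: "\<And>x. x \<in> carrier G \<Longrightarrow> k (h x) = x"
    by (auto simp: homeomorphic_maps_def G)
  have "continuous_map (prod_topology T T) T (\<lambda>p. k (h (fst p) \<otimes>\<^bsub>H\<^esub> h (snd p)))"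
    using continuous_map_compose[OF continuous_map_compose[OF continuous_map_pairedI[OF
        continuous_map_compose[OF continuous_map_fst hc] continuous_map_compose[OF continuous_map_snd hc]] mult] kc]
    by (simp add: o_def)
  then have 1: "continuous_map (prod_topology T T) T (\<lambda>(x, y). x \<otimes>\<^bsub>G\<^esub> y)"
    by (rule continuous_map_eq) (auto simp: G kh simp flip: h.hom_mult)
  have "continuous_map T T (\<lambda>x. k (inv\<^bsub>H\<^esub> h x))"
    using continuous_map_compose[OF continuous_map_compose[OF hc inv] kc] by (simp add: o_def)
  then have 2: "continuous_map T T (\<lambda>x. inv\<^bsub>G\<^esub> x)"
    by (rule continuous_map_eq) (auto simp: G kh simp flip: h.hom_inv)
  show ?thesis
    using G 1 2 by (simp add: topological_group_def)
qed

section \<open>The suspension\<close>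

definition susp_proj :: "'a topology \<Rightarrow> 'a option \<times> real \<Rightarrow> ('a option \<times> real) set" where
  "susp_proj X p = (if p \<in> suspension_base X then suspension_base X else {p})"

lemma suspension_plus_eq:
  "suspension_plus X =
     quotient_topology (prod_topology (plus_topology X) unit_interval) (susp_proj X)"
  by (simp add: suspension_plus_def collapse_topology_def susp_proj_def[abs_def])

text \<open>The complement of the basepoint is \<open>X \<times> (0, 1)\<close>; \<open>xcoord\<close> and \<open>height\<close> are meaningful only there.\<close>

definition inner_part :: "'a topology \<Rightarrow> ('a option \<times> real) set set" where
  "inner_part X = {{(Some x, s)} | x s. x \<in> topspace X \<and> 0 < s \<and> s < 1}"

definition xcoord :: "('a option \<times> real) set \<Rightarrow> 'a" where
  "xcoord p = the (fst (the_elem p))"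

definition height :: "('a option \<times> real) set \<Rightarrow> real" where
  "height p = snd (the_elem p)"

text \<open>The thresholds leave a closed middle third uncovered. This separates the part of the
  overlap with \<open>inner_part\<close> near height 0 from the one near height 1, and it fits the
  map \<open>3 * s - 1\<close>, which stretches the middle third onto the unit interval.\<close>

definition outer_part :: "'a topology \<Rightarrow> ('a option \<times> real) set set" where
  "outer_part X =
     insert (suspension_base X) {p \<in> inner_part X. height p < 1/3 \<or> 2/3 < height p}"

lemma coords_singleton [simp]: "xcoord {(Some x, s)} = x" "height {(Some x, s)} = s"
  by (simp_all add: xcoord_def height_def)

lemma suspension_base_not_singleton: "suspension_base X \<noteq> {(Some x, s)}"
proof -
  have "(None, 0) \<in> suspension_base X"
    by (simp add: suspension_base_def)
  then show ?thesis by auto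
qed

lemma base_notin_inner [simp]: "suspension_base X \<notin> inner_part X"
  by (simp add: inner_part_def suspension_base_not_singleton)

lemma base_in_outer [simp]: "suspension_base X \<in> outer_part X"
  by (simp add: outer_part_def)

lemma susp_proj_None: "s \<in> {0..1} \<Longrightarrow> susp_proj X (None, s) = suspension_base X"
  by (simp add: susp_proj_def suspension_base_def)

lemma susp_proj_Some:
  "x \<in> topspace X \<Longrightarrow>
     susp_proj X (Some x, s) = (if s = 0 \<or> s = 1 then suspension_base X else {(Some x, s)})"
  by (auto simp: susp_proj_def suspension_base_def)

lemma susp_proj_Some_ends [simp]:
  "x \<in> topspace X \<Longrightarrow> susp_proj X (Some x, 0) = suspension_base X"
  "x \<in> topspace X \<Longrightarrow> susp_proj X (Some x, 1) = suspension_base X"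
  by (simp_all add: susp_proj_Some)

lemma susp_proj_inner_iff:
  assumes "x \<in> topspace X" "s \<in> {0..1}"
  shows "susp_proj X (Some x, s) \<in> inner_part X \<longleftrightarrow> 0 < s \<and> s < 1"
  using assms by (auto simp: susp_proj_Some) (auto simp: inner_part_def)

lemma coords_susp_proj:
  assumes "x \<in> topspace X" "0 < s" "s < 1"
  shows "xcoord (susp_proj X (Some x, s)) = x" "height (susp_proj X (Some x, s)) = s"
  using assms by (simp_all add: susp_proj_Some)

lemma inner_cases:
  assumes "p \<in> inner_part X"
  obtains x s where "x \<in> topspace X" "0 < s" "s < 1" "p = susp_proj X (Some x, s)"
    "xcoord p = x" "height p = s"
proof -
  obtain x s where "x \<in> topspace X" "0 < s" "s < 1" "p = {(Some x, s)}"
    using assms by (auto simp: inner_part_def)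
  then show ?thesis
    using that[of x s] by (simp add: susp_proj_Some)
qed

lemma topspace_suspension_plus:
  "topspace (suspension_plus X) = insert (suspension_base X) (inner_part X)"
proof (intro equalityI subsetI)
  fix p assume "p \<in> topspace (suspension_plus X)"
  then obtain u s where p: "p = susp_proj X (u, s)" "u \<in> insert None (Some ` topspace X)" "s \<in> {0..1}"
    by (auto simp: suspension_plus_eq)
  show "p \<in> insert (suspension_base X) (inner_part X)"
  proof (cases "u = None \<or> s = 0 \<or> s = 1")
    case True
    then have "p = suspension_base X"
      using p by (auto simp only: susp_proj_None susp_proj_Some_ends insert_iff image_iff)
    then show ?thesis by simp
  next
    case False
    then show ?thesis
      using p by (auto simp: susp_proj_inner_iff)
  qed
next
  fix p assume p: "p \<in> insert (suspension_base X) (inner_part X)"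
  show "p \<in> topspace (suspension_plus X)"
  proof (cases "p = suspension_base X")
    case True
    then have "p = susp_proj X (None, 0)"
      by (simp add: susp_proj_None)
    then show ?thesis
      unfolding suspension_plus_eq topspace_quotient_topology by (rule image_eqI) simp
  next
    case False
    then have "p \<in> inner_part X"
      using p by simp
    then obtain x s where "x \<in> topspace X" "0 < s" "s < 1" "p = susp_proj X (Some x, s)"
      by (rule inner_cases)
    then show ?thesis
      unfolding suspension_plus_eq topspace_quotient_topology by (intro image_eqI[of _ _ "(Some x, s)"]) auto
  qed
qed

lemma outer_subset_topspace: "outer_part X \<subseteq> topspace (suspension_plus X)"
  by (auto simp: outer_part_def topspace_suspension_plus)

lemma topspace_subset_parts: "topspace (suspension_plus X) \<subseteq> inner_part X \<union> outer_part X"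
  by (auto simp: outer_part_def topspace_suspension_plus)

lemma base_in_topspace [simp]: "suspension_base X \<in> topspace (suspension_plus X)"
  by (simp add: topspace_suspension_plus)

lemma inner_outer_iff:
  "p \<in> inner_part X \<Longrightarrow> p \<in> outer_part X \<longleftrightarrow> height p < 1/3 \<or> 2/3 < height p"
  using base_notin_inner by (auto simp: outer_part_def)

text \<open>The preimage under the collapsing map is a box over \<open>A\<close> that avoids both
  ends. So over \<open>inner_part\<close> the suspension contains all open sets of the product of
  \<open>X\<close> with an open interval, which makes both coordinates continuous.\<close>

lemma openin_inner_box:
  assumes A: "openin X A" and B: "open B"
  shows "openin (suspension_plus X) {p \<in> inner_part X. xcoord p \<in> A \<and> height p \<in> B}"
proof -
  have "A \<subseteq> topspace X"
    by (rule openin_subset[OF A])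
  let ?W = "{p \<in> inner_part X. xcoord p \<in> A \<and> height p \<in> B}"
  have "{p \<in> topspace (prod_topology (plus_topology X) unit_interval). susp_proj X p \<in> ?W} =
      Some ` A \<times> ({0..1} \<inter> ({0<..<1} \<inter> B))" (is "?L = ?R")
  proof (intro equalityI subsetI)
    fix p assume p: "p \<in> ?L"
    obtain u s where us: "p = (u, s)" by (cases p)
    show "p \<in> ?R"
    proof (cases u)
      case None
      with p us show ?thesis by (auto simp: susp_proj_None)
    next
      case (Some x)
      then have "x \<in> topspace X" "0 < s" "s < 1"
        using p us by (auto simp: susp_proj_inner_iff)
      then show ?thesis
        using p us Some by (auto simp: coords_susp_proj)
    qed
  next
    fix p assume "p \<in> ?R"
    then show "p \<in> ?L"
      using \<open>A \<subseteq> topspace X\<close> by (auto simp: susp_proj_inner_iff coords_susp_proj)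
  qed
  moreover have "openin (plus_topology X) (Some ` A)"
  proof -
    have "{x. Some x \<in> Some ` A} = A" by auto
    with A \<open>A \<subseteq> topspace X\<close> show ?thesis
      by (auto simp: openin_plus_topology)
  qed
  moreover have "openin unit_interval ({0..1} \<inter> ({0<..<1} \<inter> B))"
    using B by (intro openin_open_Int) auto
  moreover have "?W \<subseteq> topspace (suspension_plus X)"
    by (auto simp: topspace_suspension_plus)
  ultimately show ?thesis
    by (auto simp: suspension_plus_eq openin_quotient_topology openin_prod_Times_iff)
qed

lemma openin_inner: "openin (suspension_plus X) (inner_part X)"
proof -
  have "{p \<in> inner_part X. xcoord p \<in> topspace X \<and> height p \<in> UNIV} = inner_part X"
    by (auto elim: inner_cases)
  then show ?thesis
    using openin_inner_box[OF openin_topspace open_UNIV, of X] by simp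
qed

text \<open>The preimage consists of the whole segment over \<open>None\<close> and of collars at
  both ends over \<open>X\<close>; the segment is open because \<open>None\<close> is
  isolated.\<close>

lemma openin_outer: "openin (suspension_plus X) (outer_part X)"
proof -
  have "{p \<in> topspace (prod_topology (plus_topology X) unit_interval). susp_proj X p \<in> outer_part X} =
      {None} \<times> {0..1} \<union> Some ` topspace X \<times> ({0..1} \<inter> ({..<1/3} \<union> {2/3<..}))" (is "?L = ?R")
  proof (intro equalityI subsetI)
    fix p assume p: "p \<in> ?L"
    obtain u s where us: "p = (u, s)" by (cases p)
    show "p \<in> ?R"
    proof (cases "u = None \<or> s = 0 \<or> s = 1")
      case True
      with p us show ?thesis by auto
    next
      case False
      then obtain x where x: "u = Some x" "x \<in> topspace X" "0 < s" "s < 1"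
        using p us by auto
      then have "height (susp_proj X p) = s" "susp_proj X p \<in> inner_part X"
        using us by (auto simp: coords_susp_proj susp_proj_inner_iff)
      then show ?thesis
        using p us x by (auto simp: inner_outer_iff)
    qed
  next
    fix p assume p: "p \<in> ?R"
    obtain u s where us: "p = (u, s)" by (cases p)
    show "p \<in> ?L"
    proof (cases "u = None \<or> s = 0 \<or> s = 1")
      case True
      with p us show ?thesis by (auto simp: susp_proj_None)
    next
      case False
      then obtain x where x: "u = Some x" "x \<in> topspace X" "0 < s" "s < 1"
        using p us by auto
      then have "height (susp_proj X p) = s" "susp_proj X p \<in> inner_part X"
        using us by (auto simp: coords_susp_proj susp_proj_inner_iff)
      then show ?thesis
        using p us x by (auto simp: inner_outer_iff)
    qed
  qed
  moreover have "openin (plus_topology X) {None}" "openin (plus_topology X) (Some ` topspace X)"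
    by (auto simp: openin_plus_topology image_iff)
  moreover have "openin unit_interval ({0..1} \<inter> ({..<1/3} \<union> {2/3<..}))"
    by (intro openin_open_Int) auto
  moreover have "openin unit_interval {0..1}"
    by simp
  ultimately have "openin (prod_topology (plus_topology X) unit_interval)
      {p \<in> topspace (prod_topology (plus_topology X) unit_interval). susp_proj X p \<in> outer_part X}"
    by (simp add: openin_Un openin_prod_Times_iff)
  then show ?thesis
    using outer_subset_topspace[of X] by (simp add: suspension_plus_eq openin_quotient_topology)
qed

lemma continuous_map_xcoord: "continuous_map (subtopology (suspension_plus X) (inner_part X)) X xcoord"
  unfolding continuous_map_def
proof (intro conjI allI impI)
  show "xcoord \<in> topspace (subtopology (suspension_plus X) (inner_part X)) \<rightarrow> topspace X"
    by (auto elim: inner_cases)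
  fix A assume "openin X A"
  then have "openin (suspension_plus X) {p \<in> inner_part X. xcoord p \<in> A}"
    using openin_inner_box[of X A UNIV] by simp
  moreover have "{p \<in> topspace (subtopology (suspension_plus X) (inner_part X)). xcoord p \<in> A} =
      {p \<in> inner_part X. xcoord p \<in> A}"
    by (auto simp: topspace_suspension_plus)
  ultimately show "openin (subtopology (suspension_plus X) (inner_part X))
      {p \<in> topspace (subtopology (suspension_plus X) (inner_part X)). xcoord p \<in> A}"
    by (auto simp: openin_open_subtopology[OF openin_inner])
qed

lemma continuous_map_height:
  "continuous_map (subtopology (suspension_plus X) (inner_part X)) euclideanreal height"
  unfolding continuous_map_def
proof (intro conjI allI impI)
  fix B assume "openin euclideanreal B"
  then have "openin (suspension_plus X) {p \<in> inner_part X. xcoord p \<in> topspace X \<and> height p \<in> B}"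
    by (intro openin_inner_box) auto
  moreover have "{p \<in> topspace (subtopology (suspension_plus X) (inner_part X)). height p \<in> B} =
      {p \<in> inner_part X. xcoord p \<in> topspace X \<and> height p \<in> B}"
    by (auto simp: topspace_suspension_plus elim: inner_cases)
  ultimately show "openin (subtopology (suspension_plus X) (inner_part X))
      {p \<in> topspace (subtopology (suspension_plus X) (inner_part X)). height p \<in> B}"
    by (auto simp: openin_open_subtopology[OF openin_inner])
qed simp

lemma continuous_map_Some: "continuous_map X (plus_topology X) Some"
proof -
  have "{x \<in> topspace X. Some x \<in> U} = {x. Some x \<in> U}" if "openin X {x. Some x \<in> U}" for U
    using openin_subset[OF that] by auto
  then show ?thesis
    by (auto simp: continuous_map_def openin_plus_topology)
qed

lemma continuous_map_susp_proj:
  "continuous_map (prod_topology (plus_topology X) unit_interval) (suspension_plus X) (susp_proj X)"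
  unfolding suspension_plus_eq by (rule continuous_map_to_quotient)

lemma continuous_map_susp_proj_Some:
  assumes "continuous_map Q X f" "continuous_map Q euclideanreal g" "\<And>q. q \<in> topspace Q \<Longrightarrow> g q \<in> {0..1}"
  shows "continuous_map Q (suspension_plus X) (\<lambda>q. susp_proj X (Some (f q), g q))"
proof -
  have "continuous_map Q (plus_topology X) (\<lambda>q. Some (f q))"
    using continuous_map_compose[OF assms(1) continuous_map_Some] by (simp add: o_def)
  moreover have "continuous_map Q unit_interval g"
    using assms(2,3) by (intro continuous_map_into_subtopology) auto
  ultimately show ?thesis
    using continuous_map_compose[OF continuous_map_pairedI continuous_map_susp_proj, of Q X]
    by (simp add: o_def)
qed

subsection \<open>Deforming the outer part into the basepoint\<close>

text \<open>An interpolation from the identity at \<open>r = 0\<close> to the clamp of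
  \<open>3 * s - 1\<close> at \<open>r = 1\<close>, which sends the lower third to 0 and the upper
  third to 1.\<close>

definition spread_height :: "real \<Rightarrow> real \<Rightarrow> real" where
  "spread_height r s = (1 - r) * s + r * max 0 (min 1 (3 * s - 1))"

definition spread :: "'a topology \<Rightarrow> real \<Rightarrow> ('a option \<times> real) set \<Rightarrow> ('a option \<times> real) set" where
  "spread X r p =
     (if p \<in> inner_part X then susp_proj X (Some (xcoord p), spread_height r (height p))
      else suspension_base X)"

lemma spread_height_in_interval:
  assumes "r \<in> {0..1}" "s \<in> {0..1}"
  shows "spread_height r s \<in> {0..1}"
  using assms convexD[of "{0..1::real}" s "max 0 (min 1 (3 * s - 1))" "1 - r" r]
  by (auto simp: spread_height_def)

lemma spread_height_simps [simp]: "spread_height r 0 = 0" "spread_height r 1 = 1" "spread_height 0 s = s"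
  by (simp_all add: spread_height_def)

lemma spread_0: "p \<in> topspace (suspension_plus X) \<Longrightarrow> spread X 0 p = p"
  by (auto simp: spread_def topspace_suspension_plus elim: inner_cases)

lemma spread_base [simp]: "spread X r (suspension_base X) = suspension_base X"
  by (simp add: spread_def)

lemma spread_height_outer: "s < 1/3 \<or> 2/3 < s \<Longrightarrow> spread_height 1 s = (if s < 1/3 then 0 else 1)"
  by (auto simp: spread_height_def)

lemma spread_outer: "p \<in> outer_part X \<Longrightarrow> spread X 1 p = suspension_base X"
  by (auto simp: outer_part_def spread_def spread_height_outer elim: inner_cases)

text \<open>The map is defined on a product with a quotient, and continuity is clear only before
  collapsing. The product of the collapsing map with the identity of the interval is again a
  quotient map because the interval is locally compact and Hausdorff.\<close>

lemma continuous_map_spread: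
  "continuous_map (prod_topology unit_interval (suspension_plus X)) (suspension_plus X) (\<lambda>(r, p). spread X r p)"
proof -
  let ?PI = "prod_topology (plus_topology X) unit_interval"
  have lc: "locally_compact_space unit_interval"
    by (intro compact_imp_locally_compact_space compact_space_subtopology) simp
  have q: "quotient_map (prod_topology unit_interval ?PI) (prod_topology unit_interval (suspension_plus X))
      (\<lambda>(r, p). (r, susp_proj X p))"
    unfolding suspension_plus_eq
    by (intro quotient_map_prod_right lc quotient_map_quotient_topology disjI1) (simp add: Hausdorff_space_subtopology)
  let ?Q = "prod_topology unit_interval ?PI"
  have r: "continuous_map ?Q euclideanreal fst"
    using continuous_map_fst continuous_map_in_subtopology by blast
  have s: "continuous_map ?Q euclideanreal (\<lambda>z. snd (snd z))"
    using continuous_map_compose[OF continuous_map_snd continuous_map_snd, of unit_interval "plus_topology X" unit_interval]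
    by (simp add: o_def continuous_map_in_subtopology)
  have u: "continuous_map ?Q (plus_topology X) (\<lambda>z. fst (snd z))"
    using continuous_map_compose[OF continuous_map_snd continuous_map_fst, of unit_interval "plus_topology X" unit_interval]
    by (simp add: o_def)
  have "continuous_map ?Q euclideanreal (\<lambda>z. spread_height (fst z) (snd (snd z)))"
    unfolding spread_height_def by (intro continuous_intros r s) auto
  then have "continuous_map ?Q unit_interval (\<lambda>z. spread_height (fst z) (snd (snd z)))"
    by (intro continuous_map_into_subtopology) (auto intro!: spread_height_in_interval simp del: atLeastAtMost_iff)
  from continuous_map_compose[OF continuous_map_pairedI[OF u this] continuous_map_susp_proj]
  have "continuous_map ?Q (suspension_plus X) (\<lambda>z. susp_proj X (fst (snd z), spread_height (fst z) (snd (snd z))))"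
    by (simp add: o_def)
  then have "continuous_map ?Q (suspension_plus X) ((\<lambda>(r, p). spread X r p) \<circ> (\<lambda>(r, p). (r, susp_proj X p)))"
  proof (rule continuous_map_eq)
    fix z assume z: "z \<in> topspace ?Q"
    then obtain r u s where z_eq: "z = (r, (u, s))" and r: "r \<in> {0..1}" and s: "s \<in> {0..1}"
        and u: "u \<in> insert None (Some ` topspace X)"
      by (cases z) auto
    have "susp_proj X (u, spread_height r s) = spread X r (susp_proj X (u, s))"
    proof (cases "u = None \<or> s = 0 \<or> s = 1")
      case True
      have "susp_proj X (None, s) = suspension_base X"
        "susp_proj X (None, spread_height r s) = suspension_base X"
        by (rule susp_proj_None[OF s]) (rule susp_proj_None[OF spread_height_in_interval[OF r s]])
      with True u show ?thesis
        by (elim insertE imageE) (simp_all, elim disjE, simp_all)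
    next
      case False
      then obtain x where "u = Some x" "x \<in> topspace X" "0 < s" "s < 1"
        using u s by auto
      then show ?thesis
        by (simp add: spread_def susp_proj_inner_iff coords_susp_proj)
    qed
    then show "susp_proj X (fst (snd z), spread_height (fst z) (snd (snd z))) =
        ((\<lambda>(r, p). spread X r p) \<circ> (\<lambda>(r, p). (r, susp_proj X p))) z"
      by (simp add: z_eq)
  qed
  then show ?thesis
    by (rule continuous_compose_quotient_map[OF q])
qed

subsection \<open>Meridians generate the fundamental group\<close>

abbreviation susp_loops :: "'a topology \<Rightarrow> (real \<Rightarrow> ('a option \<times> real) set) topology" where
  "susp_loops X \<equiv> loop_space (suspension_plus X) (suspension_base X)"

abbreviation susp_group :: "'a topology \<Rightarrow> (real \<Rightarrow> ('a option \<times> real) set) set monoid" where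
  "susp_group X \<equiv> fundamental_group (suspension_plus X) (suspension_base X)"

abbreviation susp_class ::
  "'a topology \<Rightarrow> (real \<Rightarrow> ('a option \<times> real) set) \<Rightarrow> (real \<Rightarrow> ('a option \<times> real) set) set" where
  "susp_class X \<equiv> loop_class (suspension_plus X) (suspension_base X)"

abbreviation component_group :: "'a topology \<Rightarrow> 'a set word monoid" where
  "component_group X \<equiv> free_group (topspace (pi0_top X))"

definition meridian :: "'a topology \<Rightarrow> 'a \<Rightarrow> real \<Rightarrow> ('a option \<times> real) set" where
  "meridian X x = (\<lambda>t\<in>{0..1}. susp_proj X (Some x, t))"

lemma group_susp_group: "group (susp_group X)"
  by (intro group_fundamental_group base_in_topspace)

lemma meridian_loop:
  assumes "x \<in> topspace X"
  shows "meridian X x \<in> topspace (susp_loops X)"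
  unfolding meridian_def using assms
  by (intro restrict_loop continuous_map_susp_proj_Some) (auto simp: continuous_map_in_subtopology)

text \<open>The homotopy slides the \<open>X\<close>-coordinate back along \<xi> to its start while
  it straightens the height. The ends stay at the basepoint, since their heights remain 0 or 1 and
  the \<open>X\<close>-coordinate is irrelevant there.\<close>

lemma susp_path_homotopic:
  assumes \<xi>: "continuous_map unit_interval X \<xi>"
    and \<tau>: "continuous_on {0..1} \<tau>" "\<And>t. t \<in> {0..1} \<Longrightarrow> \<tau> t \<in> {0..1}"
      "\<tau> 0 \<in> {0, 1}" "\<tau> 1 \<in> {0, 1}"
  shows "loop_homotopic (suspension_plus X) (suspension_base X)
           (\<lambda>t. susp_proj X (Some (\<xi> t), \<tau> t))
           (\<lambda>t. susp_proj X (Some (\<xi> 0), (1 - t) * \<tau> 0 + t * \<tau> 1))"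
proof (rule loop_homotopicI)
  let ?l = "\<lambda>t. (1 - t) * \<tau> 0 + t * \<tau> 1"
  have l: "?l t \<in> {0..1}" if "t \<in> {0..1}" for t
    using that \<tau>(3,4) by auto
  have \<xi>t: "\<xi> t \<in> topspace X" if "t \<in> {0..1}" for t
    using \<xi> that by (auto simp: continuous_map_def Pi_iff)
  have "continuous_on ({0..1} \<times> {0..1}) (\<lambda>p::real \<times> real. (1 - fst p) * snd p)"
    by (intro continuous_intros)
  moreover have "(1 - fst p) * snd p \<in> {0..1}" if "p \<in> {0..1} \<times> {0..1}" for p :: "real \<times> real"
    using that mult_le_one[of "1 - fst p" "snd p"] by auto
  ultimately have "continuous_map (prod_topology unit_interval unit_interval) unit_interval
      (\<lambda>p. (1 - fst p) * snd p)"
    by (auto simp: prod_topology_subtopology_eu)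
  from continuous_map_compose[OF this \<xi>]
  have 1: "continuous_map (prod_topology unit_interval unit_interval) X (\<lambda>p. \<xi> ((1 - fst p) * snd p))"
    by (simp add: o_def)
  have 2: "continuous_map (prod_topology unit_interval unit_interval) euclideanreal
      (\<lambda>p. (1 - fst p) * \<tau> (snd p) + fst p * ?l (snd p))"
    unfolding prod_topology_subtopology_eu continuous_map_iff_continuous
    by (intro continuous_intros continuous_on_compose2[OF \<tau>(1)]) auto
  have "(1 - fst p) * \<tau> (snd p) + fst p * ?l (snd p) \<in> {0..1}"
    if "p \<in> topspace (prod_topology unit_interval unit_interval)" for p
    using that \<tau>(2)[of "snd p"] l[of "snd p"]
      convexD[of "{0..1::real}" "\<tau> (snd p)" "?l (snd p)" "1 - fst p" "fst p"] by auto
  from continuous_map_susp_proj_Some[OF 1 2 this]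
  show "continuous_map (prod_topology unit_interval unit_interval) (suspension_plus X)
     (\<lambda>(r, t). susp_proj X (Some (\<xi> ((1 - r) * t)), (1 - r) * \<tau> t + r * ?l t))"
    by (simp add: case_prod_unfold)
  fix r :: real assume r: "r \<in> {0..1}"
  have "(1 - r) * a + r * a = a" for a
    by (simp add: algebra_simps)
  then show "susp_proj X (Some (\<xi> ((1 - r) * 0)), (1 - r) * \<tau> 0 + r * ?l 0) = suspension_base X"
    "susp_proj X (Some (\<xi> ((1 - r) * 1)), (1 - r) * \<tau> 1 + r * ?l 1) = suspension_base X"
    using \<tau>(3,4) \<xi>t[of 0] \<xi>t[of "1 - r"] r by auto
qed simp_all

definition meridian_class :: "'a topology \<Rightarrow> 'a set \<Rightarrow> (real \<Rightarrow> ('a option \<times> real) set) set" where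
  "meridian_class X C = susp_class X (meridian X (SOME x. x \<in> C))"

text \<open>The choice of a representative in \<open>meridian_class\<close> is harmless: a path
  \<xi> in \<open>X\<close> gives the homotopy \<open>(r, t)\<close> to \<open>(\<xi> r, t)\<close>
  between the meridians at its ends.\<close>

lemma meridian_class_path_component:
  assumes x: "x \<in> topspace X"
  shows "meridian_class X (path_component_of_set X x) = susp_class X (meridian X x)"
proof -
  define y where "y = (SOME y. y \<in> path_component_of_set X x)"
  have "x \<in> path_component_of_set X x"
    using x by (simp add: path_component_of_refl)
  then have "y \<in> path_component_of_set X x"
    unfolding y_def by (rule someI)
  then have "path_component_of X x y"
    by simp
  then obtain \<xi> where \<xi>: "continuous_map unit_interval X \<xi>" "\<xi> 0 = x" "\<xi> 1 = y"
    by (auto simp: path_component_of_def pathin_def)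
  have y: "y \<in> topspace X"
    using \<open>path_component_of X x y\<close> by (rule path_component_in_topspace[THEN conjunct2])
  have top: "\<xi> t \<in> topspace X" if "t \<in> {0..1}" for t
    using \<xi>(1) that by (auto simp: continuous_map_def Pi_iff)
  have "continuous_map (prod_topology unit_interval unit_interval) euclideanreal snd"
    using continuous_map_snd continuous_map_in_subtopology by blast
  from continuous_map_susp_proj_Some[OF continuous_map_compose[OF continuous_map_fst \<xi>(1)] this]
  have cont: "continuous_map (prod_topology unit_interval unit_interval) (suspension_plus X)
      (\<lambda>(r, t). susp_proj X (Some (\<xi> r), t))"
    by (auto simp: case_prod_unfold)
  have "loop_homotopic (suspension_plus X) (suspension_base X) (meridian X y) (meridian X x)"
    unfolding homotopic_with_sym[of _ _ _ "meridian X y"]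
    by (rule loop_homotopicI[OF cont]) (use \<xi> top in \<open>auto simp: meridian_def\<close>)
  then have "susp_class X (meridian X y) = susp_class X (meridian X x)"
    using x y by (simp add: loop_class_eq_iff meridian_loop)
  then show ?thesis
    by (simp only: meridian_class_def y_def)
qed

lemma meridian_class_closed: "meridian_class X \<in> topspace (pi0_top X) \<rightarrow> carrier (susp_group X)"
  by (auto simp: topspace_pi0_top meridian_class_path_component
      intro!: loop_class_in_fundamental_group meridian_loop)

definition word_class :: "'a topology \<Rightarrow> 'a set word \<Rightarrow> (real \<Rightarrow> ('a option \<times> real) set) set" where
  "word_class X = word_eval (susp_group X) (meridian_class X)"

lemma word_class_hom: "word_class X \<in> hom (component_group X) (susp_group X)"
  unfolding word_class_def by (rule word_eval_hom[OF group_susp_group meridian_class_closed])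

lemma word_class_generator:
  "x \<in> topspace X \<Longrightarrow>
     word_class X (generator (path_component_of_set X x)) = susp_class X (meridian X x)"
  unfolding word_class_def
  by (subst word_eval_generator[OF group_susp_group meridian_class_closed])
    (auto simp: topspace_pi0_top meridian_class_path_component)

lemma subgroup_word_class: "subgroup (word_class X ` carrier (component_group X)) (susp_group X)"
proof -
  interpret group_hom "component_group X" "susp_group X" "word_class X"
    by (simp add: group_hom_def group_hom_axioms_def group_free_group group_susp_group word_class_hom)
  show ?thesis by (rule img_is_subgroup)
qed

lemma meridian_in_range:
  assumes "x \<in> topspace X"
  shows "susp_class X (meridian X x) \<in> word_class X ` carrier (component_group X)"
proof (rule image_eqI)
  show "susp_class X (meridian X x) = word_class X (generator (path_component_of_set X x))"
    using assms by (simp add: word_class_generator)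
  show "generator (path_component_of_set X x) \<in> carrier (component_group X)"
    using assms by (intro generator_closed) (simp add: topspace_pi0_top)
qed

lemma one_in_range:
  "susp_class X (\<lambda>t\<in>{0..1}. suspension_base X) \<in> word_class X ` carrier (component_group X)"
  using subgroup.one_closed[OF subgroup_word_class] by (simp add: one_fundamental_group)

text \<open>A bisection argument replaces the choice of a Lebesgue number: the implication from
  \<open>Q a\<close> to \<open>Q b\<close> composes over adjacent intervals, so it suffices to have
  it on short intervals around each point.\<close>

lemma interval_induct:
  fixes c :: real
  assumes local: "\<And>x. x \<in> {0..1} \<Longrightarrow> \<exists>W. openin unit_interval W \<and> x \<in> W \<and>
                     (\<forall>a b. 0 \<le> a \<longrightarrow> a \<le> b \<longrightarrow> b \<le> 1 \<longrightarrow> {a..b} \<subseteq> W \<longrightarrow> Q a \<longrightarrow> Q b)"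
    and Q0: "Q 0" and c: "c \<in> {0..1}"
  shows "Q c"
proof -
  \<comment> \<open>\<open>Bolzano\<close> also tests intervals that protrude from the unit
    interval; the two bounds make the predicate trivially true there.\<close>
  let ?P = "\<lambda>a b. 0 \<le> a \<longrightarrow> b \<le> 1 \<longrightarrow> Q a \<longrightarrow> Q b"
  have "?P 0 c"
  proof (rule Bolzano[of 0 c ?P])
    show "0 \<le> c" using c by simp
    fix x :: real assume "0 \<le> x" "x \<le> c"
    then have "x \<in> {0..1}" using c by simp
    then obtain W where W: "openin unit_interval W" "x \<in> W"
        and step: "\<And>a b. 0 \<le> a \<Longrightarrow> a \<le> b \<Longrightarrow> b \<le> 1 \<Longrightarrow> {a..b} \<subseteq> W \<Longrightarrow> Q a \<Longrightarrow> Q b"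
      using local by meson
    then obtain T where T: "open T" "W = {0..1} \<inter> T"
      by (auto simp: openin_open)
    then obtain d where d: "0 < d" "ball x d \<subseteq> T"
      using W by (auto simp: open_contains_ball)
    have "{a..b} \<subseteq> W" if "0 \<le> a" "a \<le> x" "x \<le> b" "b - a < d" "b \<le> 1" for a b
      using that d T by (auto simp: subset_iff dist_real_def)
    then have "?P a b" if "a \<le> x" "x \<le> b" "b - a < d" for a b
      using that step[of a b] by auto
    with d show "\<exists>d>0. \<forall>a b. a \<le> x \<and> x \<le> b \<and> b - a < d \<longrightarrow> ?P a b"
      by blast
  qed auto
  then show ?thesis
    using Q0 c by simp
qed

text \<open>Applied to the cover by \<open>inner_part\<close> and \<open>outer_part\<close>, this
  carries the surjectivity argument, the uniqueness of lifts and the local description of their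
  endpoints.\<close>

lemma path_induct_cover:
  assumes f: "continuous_map unit_interval Z f" and U: "openin Z U" and V: "openin Z V"
    and cover: "topspace Z \<subseteq> U \<union> V"
    and step: "\<And>a b. \<lbrakk>0 \<le> a; a \<le> b; b \<le> 1; f ` {a..b} \<subseteq> U \<or> f ` {a..b} \<subseteq> V; Q a\<rbrakk> \<Longrightarrow> Q b"
    and Q0: "Q 0" and c: "c \<in> {0..1}"
  shows "Q c"
proof (rule interval_induct[where Q = Q and c = c, OF _ Q0 c])
  fix x :: real assume x: "x \<in> {0..1}"
  then have "f x \<in> U \<union> V"
    using f cover by (auto simp: continuous_map_def Pi_iff)
  then obtain O1 where O1: "O1 = U \<or> O1 = V" "f x \<in> O1"
    by auto
  let ?W = "{t \<in> topspace unit_interval. f t \<in> O1}"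
  have "openin Z O1"
    using O1(1) U V by auto
  then have "openin unit_interval ?W"
    by (rule openin_continuous_map_preimage[OF f])
  moreover have "Q b" if "0 \<le> a" "a \<le> b" "b \<le> 1" "{a..b} \<subseteq> ?W" "Q a" for a b
  proof (rule step)
    show "f ` {a..b} \<subseteq> U \<or> f ` {a..b} \<subseteq> V"
      using that(4) O1(1) by blast
  qed (use that in auto)
  ultimately show "\<exists>W. openin unit_interval W \<and> x \<in> W \<and>
      (\<forall>a b. 0 \<le> a \<longrightarrow> a \<le> b \<longrightarrow> b \<le> 1 \<longrightarrow> {a..b} \<subseteq> W \<longrightarrow> Q a \<longrightarrow> Q b)"
    using x O1(2) by (intro exI[of _ ?W]) auto
qed

lemmas susp_path_induct = path_induct_cover[OF _ openin_inner openin_outer topspace_subset_parts]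

lemma continuous_map_inner_piece:
  assumes \<alpha>: "continuous_map unit_interval (suspension_plus X) \<alpha>"
    and ab: "0 \<le> a" "b \<le> 1" and inner: "\<alpha> ` {a..b} \<subseteq> inner_part X"
  shows "continuous_map (top_of_set {a..b}) X (\<lambda>t. xcoord (\<alpha> t))"
    "continuous_map (top_of_set {a..b}) euclideanreal (\<lambda>t. height (\<alpha> t))"
proof -
  have "continuous_map (top_of_set {a..b}) (suspension_plus X) \<alpha>"
    using ab by (intro continuous_map_from_subtopology_mono[OF \<alpha>]) auto
  then have *: "continuous_map (top_of_set {a..b}) (subtopology (suspension_plus X) (inner_part X)) \<alpha>"
    using inner by (intro continuous_map_into_subtopology) auto
  show "continuous_map (top_of_set {a..b}) X (\<lambda>t. xcoord (\<alpha> t))"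
    "continuous_map (top_of_set {a..b}) euclideanreal (\<lambda>t. height (\<alpha> t))"
    using continuous_map_compose[OF * continuous_map_xcoord] continuous_map_compose[OF * continuous_map_height]
    by (simp_all add: o_def)
qed

text \<open>After spreading, such a piece begins and ends at the basepoint, with heights 0 or 1. By
  \<open>susp_path_homotopic\<close> it straightens over one point of \<open>X\<close> to a constant
  loop, a meridian or an inverse meridian, according to the two end heights.\<close>

lemma inner_piece_in_range:
  assumes \<alpha>: "continuous_map unit_interval (suspension_plus X) \<alpha>"
    and ab: "0 \<le> a" "a \<le> b" "b \<le> 1" and inner: "\<alpha> ` {a..b} \<subseteq> inner_part X"
    and outer: "\<alpha> a \<in> outer_part X" "\<alpha> b \<in> outer_part X"
  shows "susp_class X (loop_piece (\<lambda>t. spread X 1 (\<alpha> t)) a b)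
           \<in> word_class X ` carrier (component_group X)" (is "_ \<in> ?H")
proof -
  define \<phi> where "\<phi> t = a + (b - a) * t" for t
  define \<xi> where "\<xi> t = xcoord (\<alpha> (\<phi> t))" for t
  define \<tau> where "\<tau> t = spread_height 1 (height (\<alpha> (\<phi> t)))" for t
  have \<phi>: "continuous_map unit_interval (top_of_set {a..b}) \<phi>"
    unfolding \<phi>_def by (rule continuous_map_affine[OF ab(2)])
  have \<phi>_inner: "\<alpha> (\<phi> t) \<in> inner_part X" if "t \<in> {0..1}" for t
    using affine_in_interval[OF ab(2) that] inner by (auto simp: \<phi>_def)
  have \<xi>: "continuous_map unit_interval X \<xi>"
    using continuous_map_compose[OF \<phi> continuous_map_inner_piece(1)[OF \<alpha> ab(1,3) inner]]
    by (simp add: \<xi>_def[abs_def] o_def)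
  have "continuous_map unit_interval euclideanreal (\<lambda>t. height (\<alpha> (\<phi> t)))"
    using continuous_map_compose[OF \<phi> continuous_map_inner_piece(2)[OF \<alpha> ab(1,3) inner]]
    by (simp add: o_def)
  then have \<tau>: "continuous_on {0..1} \<tau>"
    unfolding \<tau>_def spread_height_def by (auto intro!: continuous_intros)
  have \<tau>_in: "\<tau> t \<in> {0..1}" if "t \<in> {0..1}" for t
    unfolding \<tau>_def using \<phi>_inner[OF that] by (intro spread_height_in_interval) (auto elim: inner_cases)
  have "height (\<alpha> (\<phi> t)) < 1/3 \<or> 2/3 < height (\<alpha> (\<phi> t))" if "t = 0 \<or> t = 1" for t
  proof -
    have "\<alpha> (\<phi> t) \<in> outer_part X"
      using that outer by (auto simp: \<phi>_def)
    with that show ?thesis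
      using inner_outer_iff[OF \<phi>_inner[of t]] by auto
  qed
  then have ends: "\<tau> 0 \<in> {0, 1}" "\<tau> 1 \<in> {0, 1}"
    unfolding \<tau>_def using spread_height_outer by (metis insert_iff)+
  have x: "\<xi> 0 \<in> topspace X"
    using \<xi> by (auto simp: continuous_map_def Pi_iff)
  let ?\<beta> = "\<lambda>t\<in>{0..1}. susp_proj X (Some (\<xi> 0), (1 - t) * \<tau> 0 + t * \<tau> 1)"
  have piece: "loop_piece (\<lambda>t. spread X 1 (\<alpha> t)) a b = (\<lambda>t\<in>{0..1}. susp_proj X (Some (\<xi> t), \<tau> t))"
    unfolding loop_piece_def
    by (rule restrict_ext) (use \<phi>_inner in \<open>simp add: spread_def \<xi>_def \<tau>_def \<phi>_def\<close>)
  have hom: "loop_homotopic (suspension_plus X) (suspension_base X)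
      (\<lambda>t\<in>{0..1}. susp_proj X (Some (\<xi> t), \<tau> t)) ?\<beta>"
    by (rule homotopic_with_eq[OF susp_path_homotopic[OF \<xi> \<tau> \<tau>_in ends]]) auto
  then have cont: "continuous_map unit_interval (suspension_plus X) (\<lambda>t\<in>{0..1}. susp_proj X (Some (\<xi> t), \<tau> t))"
      "continuous_map unit_interval (suspension_plus X) ?\<beta>"
    using homotopic_with_imp_continuous_maps by blast+
  have ev: "(\<lambda>t\<in>{0..1}. susp_proj X (Some (\<xi> t), \<tau> t)) 0 = suspension_base X"
    "(\<lambda>t\<in>{0..1}. susp_proj X (Some (\<xi> t), \<tau> t)) 1 = suspension_base X"
    "?\<beta> 0 = suspension_base X" "?\<beta> 1 = suspension_base X"
    using homotopic_with_imp_property[OF hom] by blast+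
  then have eq: "susp_class X (loop_piece (\<lambda>t. spread X 1 (\<alpha> t)) a b) = susp_class X ?\<beta>"
    using hom cont unfolding piece by (subst loop_class_eq_iff) (auto simp: loop_iff)
  interpret H: subgroup ?H "susp_group X"
    by (rule subgroup_word_class)
  consider "\<tau> 0 = \<tau> 1" | "\<tau> 0 = 0" "\<tau> 1 = 1" | "\<tau> 0 = 1" "\<tau> 1 = 0"
    using ends by auto
  then have "susp_class X ?\<beta> \<in> ?H"
  proof cases
    case 1
    then have l: "(1 - t) * \<tau> 0 + t * \<tau> 1 = \<tau> 0" for t
      by (simp add: algebra_simps)
    have "susp_proj X (Some (\<xi> 0), \<tau> 0) = suspension_base X"
      using ends(1) x by (elim insertE) auto
    then have "?\<beta> = (\<lambda>t\<in>{0..1}. suspension_base X)"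
      by (simp only: l)
    then show ?thesis
      using one_in_range by simp
  next
    case 2
    then have "?\<beta> = meridian X (\<xi> 0)"
      by (simp add: meridian_def)
    then show ?thesis
      using meridian_in_range[OF x] by simp
  next
    case 3
    then have "?\<beta> = reverse_loop (meridian X (\<xi> 0))"
      unfolding reverse_loop_def by (intro restrict_ext) (simp add: meridian_def)
    then have "susp_class X ?\<beta> = inv\<^bsub>susp_group X\<^esub> susp_class X (meridian X (\<xi> 0))"
      using meridian_loop[OF x] by (simp add: inv_fundamental_group)
    then show ?thesis
      using meridian_in_range[OF x] by (simp add: H.m_inv_closed)
  qed
  with eq show ?thesis
    by simp
qed

lemma loop_class_in_range:
  assumes \<alpha>: "\<alpha> \<in> topspace (susp_loops X)"
  shows "susp_class X \<alpha> \<in> word_class X ` carrier (component_group X)" (is "_ \<in> ?H")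
proof -
  have cont: "continuous_map unit_interval (suspension_plus X) \<alpha>"
    and ends: "\<alpha> 0 = suspension_base X" "\<alpha> 1 = suspension_base X"
    using \<alpha> by (auto simp: loop_iff)
  define \<beta> where "\<beta> t = spread X 1 (\<alpha> t)" for t
  have hc: "continuous_map (prod_topology unit_interval unit_interval) (suspension_plus X)
      (\<lambda>(r, t). spread X r (\<alpha> t))"
    using continuous_map_compose[OF continuous_map_pairedI[OF continuous_map_fst
          continuous_map_compose[OF continuous_map_snd cont]] continuous_map_spread]
    by (simp add: o_def case_prod_unfold)
  have \<alpha>_top: "\<alpha> t \<in> topspace (suspension_plus X)" if "t \<in> {0..1}" for t
    using cont that by (auto simp: continuous_map_def Pi_iff)
  have "loop_homotopic (suspension_plus X) (suspension_base X) \<alpha> (loop_piece \<beta> 0 1)"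
    by (rule loop_homotopicI[OF hc])
      (auto simp: spread_0 \<alpha>_top ends loop_piece_def \<beta>_def)
  have \<beta>: "continuous_map unit_interval (suspension_plus X) \<beta>"
    using continuous_map_o_Pair[OF hc, of 1] by (simp add: \<beta>_def[abs_def] o_def)
  have \<beta>_outer: "\<beta> t = suspension_base X" if "\<alpha> t \<in> outer_part X" for t
    using that by (simp add: \<beta>_def spread_outer)
  interpret H: subgroup ?H "susp_group X"
    by (rule subgroup_word_class)
  \<comment> \<open>The time \<open>s\<close> is a cut whose initial piece is already known to lie
    in the range. Since then the loop has stayed in the inner part, so at most one unfinished
    excursion is pending at time \<open>c\<close>.\<close>
  define Q where "Q c \<longleftrightarrow> (\<exists>s. 0 \<le> s \<and> s \<le> c \<and> \<alpha> s \<in> outer_part X \<and>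
      susp_class X (loop_piece \<beta> 0 s) \<in> ?H \<and> (s = c \<or> \<alpha> ` {s..c} \<subseteq> inner_part X))" for c
  have const: "loop_piece \<beta> a b = (\<lambda>t\<in>{0..1}. suspension_base X)"
    if "a \<le> b" "\<alpha> ` {a..b} \<subseteq> outer_part X" for a b
    unfolding loop_piece_def
  proof (rule restrict_ext)
    fix t :: real assume "t \<in> {0..1}"
    then have "\<alpha> (a + (b - a) * t) \<in> outer_part X"
      using affine_in_interval[OF that(1)] that(2) by blast
    then show "\<beta> (a + (b - a) * t) = suspension_base X"
      by (rule \<beta>_outer)
  qed
  have mult: "susp_class X (loop_piece \<beta> 0 b) \<in> ?H"
    if "0 \<le> a" "a \<le> b" "b \<le> 1" "\<alpha> a \<in> outer_part X" "\<alpha> b \<in> outer_part X"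
      "susp_class X (loop_piece \<beta> 0 a) \<in> ?H" "susp_class X (loop_piece \<beta> a b) \<in> ?H" for a b
    using H.m_closed[OF that(6,7)] loop_class_piece_mult[OF \<beta> that(1-3)] that(4,5)
    by (simp add: \<beta>_outer ends)
  have "Q 1"
  proof (rule susp_path_induct[OF cont])
    show "Q 0"
      unfolding Q_def using const[of 0 0] ends one_in_range by (intro exI[of _ 0]) auto
    fix a b assume ab: "0 \<le> a" "a \<le> b" "b \<le> (1::real)"
      and cover: "\<alpha> ` {a..b} \<subseteq> inner_part X \<or> \<alpha> ` {a..b} \<subseteq> outer_part X" and "Q a"
    then obtain s where s: "0 \<le> s" "s \<le> a" "\<alpha> s \<in> outer_part X"
        "susp_class X (loop_piece \<beta> 0 s) \<in> ?H" "s = a \<or> \<alpha> ` {s..a} \<subseteq> inner_part X"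
      unfolding Q_def by blast
    show "Q b"
    proof (cases "\<alpha> ` {a..b} \<subseteq> inner_part X")
      case True
      have "{s..b} = {s..a} \<union> {a..b}"
        using s ab by auto
      then have "\<alpha> ` {s..b} \<subseteq> inner_part X"
        using s(5) True by (auto simp: image_Un)
      then show ?thesis
        unfolding Q_def using s ab by (intro exI[of _ s]) auto
    next
      case False
      with cover have outer: "\<alpha> ` {a..b} \<subseteq> outer_part X"
        by simp
      then have "\<alpha> a \<in> outer_part X" "\<alpha> b \<in> outer_part X"
        using ab by auto
      \<comment> \<open>Reaching the outer part at \<open>a\<close> completes the pending excursion
        from \<open>s\<close>, which contributes one more factor in the range.\<close>
      have "susp_class X (loop_piece \<beta> 0 a) \<in> ?H"
        using s(5)
      proof
        assume "s = a"
        then show ?thesis using s(4) by simp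
      next
        assume "\<alpha> ` {s..a} \<subseteq> inner_part X"
        then have "susp_class X (loop_piece \<beta> s a) \<in> ?H"
          unfolding \<beta>_def using s ab \<open>\<alpha> a \<in> outer_part X\<close> by (intro inner_piece_in_range[OF cont]) auto
        then show ?thesis
          using s ab \<open>\<alpha> a \<in> outer_part X\<close> by (intro mult[of s a]) auto
      qed
      then have "susp_class X (loop_piece \<beta> 0 b) \<in> ?H"
        using ab \<open>\<alpha> a \<in> outer_part X\<close> \<open>\<alpha> b \<in> outer_part X\<close> const[OF ab(2) outer] one_in_range
        by (intro mult[of a b]) auto
      then show ?thesis
        unfolding Q_def using ab \<open>\<alpha> b \<in> outer_part X\<close> by (intro exI[of _ b]) auto
    qed
  qed simp
  \<comment> \<open>No excursion can be pending at time 1, where the loop is at the basepoint, so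
    the cut is \<open>s = 1\<close>.\<close>
  then obtain s where "s \<le> 1" "susp_class X (loop_piece \<beta> 0 s) \<in> ?H" "s = 1 \<or> \<alpha> ` {s..1} \<subseteq> inner_part X"
    unfolding Q_def by blast
  moreover have "\<not> \<alpha> ` {s..1} \<subseteq> inner_part X" if "s \<le> 1" for s
    using that ends base_notin_inner[of X] by (metis atLeastAtMost_iff image_subset_iff order_refl)
  ultimately have "susp_class X (loop_piece \<beta> 0 1) \<in> ?H"
    by blast
  moreover have "susp_class X \<alpha> = susp_class X (loop_piece \<beta> 0 1)"
    using \<alpha> \<open>loop_homotopic _ _ \<alpha> (loop_piece \<beta> 0 1)\<close> loop_piece_loop[OF \<beta>, of 0 1 "suspension_base X"]
    by (subst loop_class_eq_iff) (auto simp: \<beta>_outer ends)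
  ultimately show ?thesis
    by simp
qed

subsection \<open>Lifting loops to the free group\<close>

lemma inner_path_component:
  assumes \<alpha>: "continuous_map unit_interval (suspension_plus X) \<alpha>"
    and ab: "0 \<le> a" "a \<le> b" "b \<le> 1" and inner: "\<alpha> ` {a..b} \<subseteq> inner_part X"
  shows "path_component_of_set X (xcoord (\<alpha> a)) = path_component_of_set X (xcoord (\<alpha> b))"
proof -
  have "continuous_map unit_interval X (\<lambda>t. xcoord (\<alpha> (a + (b - a) * t)))"
    using continuous_map_compose[OF continuous_map_affine[OF ab(2)]
        continuous_map_inner_piece(1)[OF \<alpha> ab(1,3) inner]] by (simp add: o_def)
  then have "path_component_of X (xcoord (\<alpha> a)) (xcoord (\<alpha> b))"
    unfolding path_component_of_def pathin_def
    by (intro exI[of _ "\<lambda>t. xcoord (\<alpha> (a + (b - a) * t))"]) simp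
  then show ?thesis
    by (simp add: path_component_of_equiv)
qed

text \<open>A potential for the lift over the cylinder: crossing height 1/2 upwards multiplies by
  the generator of the component, crossing it downwards by its inverse. The jump lies in the middle
  third, away from the overlap with \<open>outer_part\<close>.\<close>

definition height_word :: "'a topology \<Rightarrow> ('a option \<times> real) set \<Rightarrow> 'a set word" where
  "height_word X p = (if height p < 1/2 then [] else generator (path_component_of_set X (xcoord p)))"

lemma one_component_group: "\<one>\<^bsub>component_group X\<^esub> = []"
  by (simp add: free_group_def)

lemma height_word_closed:
  assumes "p \<in> inner_part X"
  shows "height_word X p \<in> carrier (component_group X)"
proof -
  have "xcoord p \<in> topspace X"
    using assms by (auto elim: inner_cases)
  then have "generator (path_component_of_set X (xcoord p)) \<in> carrier (component_group X)"
    by (intro generator_closed) (simp add: topspace_pi0_top)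
  moreover have "[] \<in> carrier (component_group X)"
    by (simp add: free_group_def)
  ultimately show ?thesis
    by (simp add: height_word_def)
qed

text \<open>In the overlap the height is continuous and avoids the middle third, so by connectedness
  it stays on one side of 1/2; the \<open>X\<close>-coordinate moves along a path and keeps its
  component.\<close>

lemma height_word_eq:
  assumes \<alpha>: "continuous_map unit_interval (suspension_plus X) \<alpha>"
    and ab: "0 \<le> a" "a \<le> b" "b \<le> 1"
    and inner: "\<alpha> ` {a..b} \<subseteq> inner_part X" and outer: "\<alpha> ` {a..b} \<subseteq> outer_part X"
  shows "height_word X (\<alpha> a) = height_word X (\<alpha> b)"
proof -
  have "continuous_on {a..b} (\<lambda>t. height (\<alpha> t))"
    using continuous_map_inner_piece(2)[OF \<alpha> ab(1,3) inner] by simp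
  then have conn: "connected ((\<lambda>t. height (\<alpha> t)) ` {a..b})"
    by (intro connected_continuous_image) auto
  have ends: "height (\<alpha> a) \<in> (\<lambda>t. height (\<alpha> t)) ` {a..b}" "height (\<alpha> b) \<in> (\<lambda>t. height (\<alpha> t)) ` {a..b}"
    using ab by auto
  have "height (\<alpha> t) < 1/3 \<or> 2/3 < height (\<alpha> t)" if "t \<in> {a..b}" for t
  proof -
    have "\<alpha> t \<in> inner_part X" "\<alpha> t \<in> outer_part X"
      using that inner outer by blast+
    then show ?thesis
      by (simp only: inner_outer_iff)
  qed
  then have "1/2 \<notin> (\<lambda>t. height (\<alpha> t)) ` {a..b}"
    by fastforce
  then have "height (\<alpha> a) < 1/2 \<longleftrightarrow> height (\<alpha> b) < 1/2"
    using connectedD_interval[OF conn ends, of "1/2"] connectedD_interval[OF conn ends(2,1), of "1/2"]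
    by force
  then show ?thesis
    using inner_path_component[OF \<alpha> ab inner] by (simp add: height_word_def)
qed

text \<open>Instead of lifting a loop to a covering space, we lift it to a map \<open>g\<close> into the free group that is
  constant where the loop stays in the outer part and that follows \<open>height_word\<close>, up to a left
  factor, where the loop stays in the inner part. On overlaps the two prescriptions agree, by
  \<open>height_word_eq\<close>.\<close>

definition lift_on ::
  "'a topology \<Rightarrow> (real \<Rightarrow> ('a option \<times> real) set) \<Rightarrow> real \<Rightarrow> real \<Rightarrow> (real \<Rightarrow> 'a set word) \<Rightarrow> bool" where
  "lift_on X \<alpha> a c g \<longleftrightarrow>
     g \<in> {a..c} \<rightarrow> carrier (component_group X) \<and>
     (\<forall>s t. a \<le> s \<longrightarrow> s \<le> t \<longrightarrow> t \<le> c \<longrightarrow> \<alpha> ` {s..t} \<subseteq> outer_part X \<longrightarrow> g t = g s) \<and>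
     (\<forall>s t. a \<le> s \<longrightarrow> s \<le> t \<longrightarrow> t \<le> c \<longrightarrow> \<alpha> ` {s..t} \<subseteq> inner_part X \<longrightarrow>
        g t = g s \<otimes>\<^bsub>component_group X\<^esub>
          (inv\<^bsub>component_group X\<^esub> height_word X (\<alpha> s) \<otimes>\<^bsub>component_group X\<^esub> height_word X (\<alpha> t)))"

lemma lift_onI:
  assumes "\<And>t. a \<le> t \<Longrightarrow> t \<le> c \<Longrightarrow> g t \<in> carrier (component_group X)"
    and "\<And>s t. \<lbrakk>a \<le> s; s \<le> t; t \<le> c; \<alpha> ` {s..t} \<subseteq> outer_part X\<rbrakk> \<Longrightarrow> g t = g s"
    and "\<And>s t. \<lbrakk>a \<le> s; s \<le> t; t \<le> c; \<alpha> ` {s..t} \<subseteq> inner_part X\<rbrakk> \<Longrightarrow>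
        g t = g s \<otimes>\<^bsub>component_group X\<^esub>
          (inv\<^bsub>component_group X\<^esub> height_word X (\<alpha> s) \<otimes>\<^bsub>component_group X\<^esub> height_word X (\<alpha> t))"
  shows "lift_on X \<alpha> a c g"
  using assms unfolding lift_on_def by auto

lemma lift_onD:
  assumes "lift_on X \<alpha> a c g"
  shows "\<And>t. a \<le> t \<Longrightarrow> t \<le> c \<Longrightarrow> g t \<in> carrier (component_group X)"
    and "\<And>s t. \<lbrakk>a \<le> s; s \<le> t; t \<le> c; \<alpha> ` {s..t} \<subseteq> outer_part X\<rbrakk> \<Longrightarrow> g t = g s"
    and "\<And>s t. \<lbrakk>a \<le> s; s \<le> t; t \<le> c; \<alpha> ` {s..t} \<subseteq> inner_part X\<rbrakk> \<Longrightarrow>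
        g t = g s \<otimes>\<^bsub>component_group X\<^esub>
          (inv\<^bsub>component_group X\<^esub> height_word X (\<alpha> s) \<otimes>\<^bsub>component_group X\<^esub> height_word X (\<alpha> t))"
proof -
  show "g t \<in> carrier (component_group X)" if "a \<le> t" "t \<le> c" for t
    using assms[unfolded lift_on_def, THEN conjunct1] that by (simp add: Pi_iff)
  show "g t = g s" if "a \<le> s" "s \<le> t" "t \<le> c" "\<alpha> ` {s..t} \<subseteq> outer_part X" for s t
    using assms[unfolded lift_on_def, THEN conjunct2, THEN conjunct1] that by iprover
  show "g t = g s \<otimes>\<^bsub>component_group X\<^esub>
      (inv\<^bsub>component_group X\<^esub> height_word X (\<alpha> s) \<otimes>\<^bsub>component_group X\<^esub> height_word X (\<alpha> t))"
    if "a \<le> s" "s \<le> t" "t \<le> c" "\<alpha> ` {s..t} \<subseteq> inner_part X" for s t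
    using assms[unfolded lift_on_def, THEN conjunct2, THEN conjunct2] that by iprover
qed

lemma lift_on_cong:
  assumes "lift_on X \<alpha> a c g" "\<And>t. a \<le> t \<Longrightarrow> t \<le> c \<Longrightarrow> g' t = g t"
  shows "lift_on X \<alpha> a c g'"
proof (rule lift_onI)
  fix s t assume st: "a \<le> s" "s \<le> t" "t \<le> c"
  then have eq: "g' s = g s" "g' t = g t"
    using assms(2) by auto
  show "g' t = g' s" if "\<alpha> ` {s..t} \<subseteq> outer_part X"
    unfolding eq using lift_onD(2)[OF assms(1) st that] .
  show "g' t = g' s \<otimes>\<^bsub>component_group X\<^esub>
      (inv\<^bsub>component_group X\<^esub> height_word X (\<alpha> s) \<otimes>\<^bsub>component_group X\<^esub> height_word X (\<alpha> t))"
    if "\<alpha> ` {s..t} \<subseteq> inner_part X"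
    unfolding eq using lift_onD(3)[OF assms(1) st that] .
next
  show "g' t \<in> carrier (component_group X)" if "a \<le> t" "t \<le> c" for t
    using lift_onD(1)[OF assms(1) that] assms(2)[OF that] by simp
qed

lemma (in group) cancel_middle:
  assumes "a \<in> carrier G" "u \<in> carrier G" "v \<in> carrier G" "w \<in> carrier G"
  shows "a \<otimes> (inv u \<otimes> v) \<otimes> (inv v \<otimes> w) = a \<otimes> (inv u \<otimes> w)"
    and "a \<otimes> v \<otimes> (inv v \<otimes> w) = a \<otimes> w" and "a \<otimes> (inv v \<otimes> v) = a"
proof -
  have "v \<otimes> (inv v \<otimes> w) = w"
    using assms m_assoc[of v "inv v" w] by simp
  then show "a \<otimes> (inv u \<otimes> v) \<otimes> (inv v \<otimes> w) = a \<otimes> (inv u \<otimes> w)"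
    and "a \<otimes> v \<otimes> (inv v \<otimes> w) = a \<otimes> w"
    using assms by (simp_all add: m_assoc)
  show "a \<otimes> (inv v \<otimes> v) = a"
    using assms by simp
qed

text \<open>An interval that straddles \<open>b\<close> is split there. The outer rule then holds by
  transitivity, and in the inner rule the two factors \<open>height_word X (\<alpha> b)\<close>
  cancel.\<close>

lemma lift_on_paste:
  assumes l: "lift_on X \<alpha> a b g" and r: "lift_on X \<alpha> b c g" and ab: "a \<le> b" "b \<le> c"
  shows "lift_on X \<alpha> a c g"
proof (rule lift_onI)
  interpret F: group "component_group X" by (rule group_free_group)
  show "g t \<in> carrier (component_group X)" if "a \<le> t" "t \<le> c" for t
    using that lift_onD(1)[OF l, of t] lift_onD(1)[OF r, of t] by linarith
  fix s t assume st: "a \<le> s" "s \<le> t" "t \<le> c"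
  consider "t \<le> b" | "b \<le> s" | "s \<le> b" "b \<le> t" by linarith
  then show "g t = g s" if o: "\<alpha> ` {s..t} \<subseteq> outer_part X"
  proof cases
    case 3
    have "{s..b} \<subseteq> {s..t}" "{b..t} \<subseteq> {s..t}" using 3 by auto
    then have "\<alpha> ` {s..b} \<subseteq> outer_part X" "\<alpha> ` {b..t} \<subseteq> outer_part X" using o by blast+
    then show ?thesis
      using 3 st lift_onD(2)[OF l, of s b] lift_onD(2)[OF r, of b t] by simp
  qed (use st o lift_onD(2)[OF l] lift_onD(2)[OF r] in auto)
  consider "t \<le> b" | "b \<le> s" | "s \<le> b" "b \<le> t" by linarith
  then show "g t = g s \<otimes>\<^bsub>component_group X\<^esub>
      (inv\<^bsub>component_group X\<^esub> height_word X (\<alpha> s) \<otimes>\<^bsub>component_group X\<^esub> height_word X (\<alpha> t))"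
    if i: "\<alpha> ` {s..t} \<subseteq> inner_part X"
  proof cases
    case 3
    have "{s..b} \<subseteq> {s..t}" "{b..t} \<subseteq> {s..t}" using 3 by auto
    then have sub: "\<alpha> ` {s..b} \<subseteq> inner_part X" "\<alpha> ` {b..t} \<subseteq> inner_part X" using i by blast+
    have "\<alpha> s \<in> inner_part X" "\<alpha> b \<in> inner_part X" "\<alpha> t \<in> inner_part X"
      using i 3 st by auto
    then have "height_word X (\<alpha> s) \<in> carrier (component_group X)"
      "height_word X (\<alpha> b) \<in> carrier (component_group X)" "height_word X (\<alpha> t) \<in> carrier (component_group X)"
      by (simp_all add: height_word_closed)
    then show ?thesis
      using 3 st lift_onD(3)[OF l, of s b] lift_onD(3)[OF r, of b t] lift_onD(1)[OF l, of s] sub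
      by (simp add: F.cancel_middle)
  next
    case 1
    then show ?thesis using st i lift_onD(3)[OF l, of s t] by simp
  next
    case 2
    then show ?thesis using st i lift_onD(3)[OF r, of s t] by simp
  qed
qed

lemma lift_on_extend:
  assumes g: "lift_on X \<alpha> 0 a g" and k: "lift_on X \<alpha> a b k" and "k a = g a" "0 \<le> a" "a \<le> b"
  obtains g' where "lift_on X \<alpha> 0 b g'" "g' 0 = g 0" "g' b = k b"
proof
  let ?g = "\<lambda>t. if t \<le> a then g t else k t"
  show "lift_on X \<alpha> 0 b ?g"
  proof (rule lift_on_paste[of _ _ 0 a])
    show "lift_on X \<alpha> 0 a ?g"
      by (rule lift_on_cong[OF g]) simp
    show "lift_on X \<alpha> a b ?g"
      by (rule lift_on_cong[OF k]) (use assms(3) in auto)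
  qed fact+
qed (use assms in auto)

text \<open>The extension is constant. The inner rule has to be verified on subintervals inside the
  overlap, where \<open>height_word_eq\<close> makes its right factor trivial.\<close>

lemma lift_on_extend_outer:
  assumes \<alpha>: "continuous_map unit_interval (suspension_plus X) \<alpha>"
    and g: "lift_on X \<alpha> 0 a g" and ab: "0 \<le> a" "a \<le> b" "b \<le> 1"
    and outer: "\<alpha> ` {a..b} \<subseteq> outer_part X"
  obtains g' where "lift_on X \<alpha> 0 b g'" "g' 0 = g 0" "g' b = g a"
proof -
  interpret F: group "component_group X" by (rule group_free_group)
  have ga: "g a \<in> carrier (component_group X)"
    using lift_onD(1)[OF g] ab by simp
  have "lift_on X \<alpha> a b (\<lambda>t. g a)"
  proof (rule lift_onI)
    fix s t assume st: "a \<le> s" "s \<le> t" "t \<le> b" and i: "\<alpha> ` {s..t} \<subseteq> inner_part X"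
    then have "{s..t} \<subseteq> {a..b}" by auto
    then have "\<alpha> ` {s..t} \<subseteq> outer_part X" using outer by blast
    then have "height_word X (\<alpha> s) = height_word X (\<alpha> t)"
      using st ab i by (intro height_word_eq[OF \<alpha>]) auto
    moreover have "\<alpha> t \<in> inner_part X"
      using i st by auto
    ultimately show "g a = g a \<otimes>\<^bsub>component_group X\<^esub>
        (inv\<^bsub>component_group X\<^esub> height_word X (\<alpha> s) \<otimes>\<^bsub>component_group X\<^esub> height_word X (\<alpha> t))"
      using ga by (simp add: F.cancel_middle height_word_closed)
  qed (use ga in auto)
  from lift_on_extend[OF g this refl ab(1,2)] that show thesis
    by metis
qed

text \<open>The extension follows \<open>height_word\<close>. Dually to the outer case,
  \<open>height_word_eq\<close> makes it constant on subintervals inside the overlap.\<close>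

lemma lift_on_extend_inner:
  assumes \<alpha>: "continuous_map unit_interval (suspension_plus X) \<alpha>"
    and g: "lift_on X \<alpha> 0 a g" and ab: "0 \<le> a" "a \<le> b" "b \<le> 1"
    and inner: "\<alpha> ` {a..b} \<subseteq> inner_part X"
  obtains g' where "lift_on X \<alpha> 0 b g'" "g' 0 = g 0"
    "g' b = g a \<otimes>\<^bsub>component_group X\<^esub>
       (inv\<^bsub>component_group X\<^esub> height_word X (\<alpha> a) \<otimes>\<^bsub>component_group X\<^esub> height_word X (\<alpha> b))"
proof -
  interpret F: group "component_group X" by (rule group_free_group)
  have ga: "g a \<in> carrier (component_group X)"
    using lift_onD(1)[OF g] ab by simp
  have h: "height_word X (\<alpha> t) \<in> carrier (component_group X)" if "a \<le> t" "t \<le> b" for t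
    using that inner by (intro height_word_closed) auto
  have "lift_on X \<alpha> a b (\<lambda>t. g a \<otimes>\<^bsub>component_group X\<^esub>
       (inv\<^bsub>component_group X\<^esub> height_word X (\<alpha> a) \<otimes>\<^bsub>component_group X\<^esub> height_word X (\<alpha> t)))"
  proof (rule lift_onI)
    fix s t assume st: "a \<le> s" "s \<le> t" "t \<le> b" and o: "\<alpha> ` {s..t} \<subseteq> outer_part X"
    then have "{s..t} \<subseteq> {a..b}" by auto
    then have "\<alpha> ` {s..t} \<subseteq> inner_part X" using inner by blast
    then have "height_word X (\<alpha> s) = height_word X (\<alpha> t)"
      using st ab o by (intro height_word_eq[OF \<alpha>]) auto
    then show "g a \<otimes>\<^bsub>component_group X\<^esub>
        (inv\<^bsub>component_group X\<^esub> height_word X (\<alpha> a) \<otimes>\<^bsub>component_group X\<^esub> height_word X (\<alpha> t)) =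
      g a \<otimes>\<^bsub>component_group X\<^esub>
        (inv\<^bsub>component_group X\<^esub> height_word X (\<alpha> a) \<otimes>\<^bsub>component_group X\<^esub> height_word X (\<alpha> s))"
      by simp
  qed (use ga h ab in \<open>simp_all add: F.cancel_middle\<close>)
  moreover have "g a \<otimes>\<^bsub>component_group X\<^esub>
      (inv\<^bsub>component_group X\<^esub> height_word X (\<alpha> a) \<otimes>\<^bsub>component_group X\<^esub> height_word X (\<alpha> a)) = g a"
    using ga h[of a] ab by (simp add: F.cancel_middle)
  ultimately show thesis
    using lift_on_extend[OF g _ _ ab(1,2)] that by metis
qed

text \<open>On each piece of the cover one of the two rules computes the final value from the
  initial one, so agreement propagates along the path.\<close>

lemma lift_on_unique:
  assumes \<alpha>: "continuous_map unit_interval (suspension_plus X) \<alpha>"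
    and "lift_on X \<alpha> 0 1 g" "lift_on X \<alpha> 0 1 k" "g 0 = k 0" and c: "c \<in> {0..1}"
  shows "g c = k c"
proof (rule susp_path_induct[where Q = "\<lambda>c. g c = k c", OF \<alpha> _ assms(4) c])
  fix a b assume "0 \<le> a" "a \<le> b" "b \<le> (1::real)" "g a = k a"
    and "\<alpha> ` {a..b} \<subseteq> inner_part X \<or> \<alpha> ` {a..b} \<subseteq> outer_part X"
  then show "g b = k b"
    using lift_onD(2,3)[OF assms(2), of a b] lift_onD(2,3)[OF assms(3), of a b] by auto
qed

text \<open>The endpoint of the lift that starts at the empty word. A relation is used so that
  uniqueness can be shown before an endpoint has been found for every loop.\<close>

definition tracks :: "'a topology \<Rightarrow> (real \<Rightarrow> ('a option \<times> real) set) \<Rightarrow> 'a set word \<Rightarrow> bool" where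
  "tracks X \<alpha> w \<longleftrightarrow> (\<exists>g. lift_on X \<alpha> 0 1 g \<and> g 0 = [] \<and> g 1 = w)"

lemma tracks_unique:
  assumes "\<alpha> \<in> topspace (susp_loops X)" "tracks X \<alpha> v" "tracks X \<alpha> w"
  shows "v = w"
  using assms lift_on_unique[of X \<alpha> _ _ 1] unfolding tracks_def loop_iff by fastforce

lemma tracks_const: "tracks X (\<lambda>t\<in>{0..1}. suspension_base X) []"
  unfolding tracks_def
proof (intro exI conjI lift_onI)
  fix s t :: real assume "0 \<le> s" "s \<le> t" "t \<le> 1" and i: "(\<lambda>t\<in>{0..1}. suspension_base X) ` {s..t} \<subseteq> inner_part X"
  then have "suspension_base X \<in> inner_part X"
    by (auto simp: image_subset_iff split: if_splits)
  then show "[] = [] \<otimes>\<^bsub>component_group X\<^esub>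
      (inv\<^bsub>component_group X\<^esub> height_word X ((\<lambda>t\<in>{0..1}. suspension_base X) s)
        \<otimes>\<^bsub>component_group X\<^esub> height_word X ((\<lambda>t\<in>{0..1}. suspension_base X) t))"
    by simp
qed (auto simp: free_group_def)

text \<open>Both rules for lifts are invariant under left multiplication by a fixed
  \<open>v\<close>. The shifts \<open>q = 0\<close> and \<open>q = 1\<close> give the two halves of
  a concatenation.\<close>

lemma lift_on_rescale:
  assumes g: "lift_on X \<alpha> 0 1 g" and v: "v \<in> carrier (component_group X)"
    and ac: "q \<le> 2 * a" "2 * c \<le> q + 1"
    and \<gamma>: "\<And>t. a \<le> t \<Longrightarrow> t \<le> c \<Longrightarrow> \<gamma> t = \<alpha> (2 * t - q)"
  shows "lift_on X \<gamma> a c (\<lambda>t. v \<otimes>\<^bsub>component_group X\<^esub> g (2 * t - q))"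
proof (rule lift_onI)
  interpret F: group "component_group X" by (rule group_free_group)
  show "v \<otimes>\<^bsub>component_group X\<^esub> g (2 * t - q) \<in> carrier (component_group X)" if "a \<le> t" "t \<le> c" for t
    using that ac v lift_onD(1)[OF g, of "2 * t - q"] by simp
  fix s t assume st: "a \<le> s" "s \<le> t" "t \<le> c"
  have sub: "\<alpha> ` {2 * s - q..2 * t - q} \<subseteq> \<gamma> ` {s..t}"
  proof (rule image_subsetI)
    fix x assume "x \<in> {2 * s - q..2 * t - q}"
    then have "(x + q) / 2 \<in> {s..t}" by auto
    moreover have "2 * ((x + q) / 2) - q = x"
      by argo
    then have "\<gamma> ((x + q) / 2) = \<alpha> x"
      using \<gamma>[of "(x + q) / 2"] st \<open>(x + q) / 2 \<in> {s..t}\<close> by (simp del: times_divide_eq_right)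
    ultimately show "\<alpha> x \<in> \<gamma> ` {s..t}"
      by (metis imageI)
  qed
  show "v \<otimes>\<^bsub>component_group X\<^esub> g (2 * t - q) = v \<otimes>\<^bsub>component_group X\<^esub> g (2 * s - q)"
    if "\<gamma> ` {s..t} \<subseteq> outer_part X"
    using lift_onD(2)[OF g, of "2 * s - q" "2 * t - q"] sub that st ac by simp
  assume i: "\<gamma> ` {s..t} \<subseteq> inner_part X"
  then have "\<gamma> s \<in> inner_part X" "\<gamma> t \<in> inner_part X"
    using st by auto
  then have "height_word X (\<gamma> s) \<in> carrier (component_group X)" "height_word X (\<gamma> t) \<in> carrier (component_group X)"
    by (simp_all add: height_word_closed)
  moreover have "g (2 * s - q) \<in> carrier (component_group X)"
    using lift_onD(1)[OF g, of "2 * s - q"] st ac by simp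
  moreover have "g (2 * t - q) = g (2 * s - q) \<otimes>\<^bsub>component_group X\<^esub>
      (inv\<^bsub>component_group X\<^esub> height_word X (\<gamma> s) \<otimes>\<^bsub>component_group X\<^esub> height_word X (\<gamma> t))"
    using lift_onD(3)[OF g, of "2 * s - q" "2 * t - q"] sub i st ac \<gamma>[of s] \<gamma>[of t] by simp
  ultimately show "v \<otimes>\<^bsub>component_group X\<^esub> g (2 * t - q) =
      v \<otimes>\<^bsub>component_group X\<^esub> g (2 * s - q) \<otimes>\<^bsub>component_group X\<^esub>
        (inv\<^bsub>component_group X\<^esub> height_word X (\<gamma> s) \<otimes>\<^bsub>component_group X\<^esub> height_word X (\<gamma> t))"
    using v by (simp add: F.m_assoc)
qed

lemma tracks_concat:
  assumes \<alpha>: "\<alpha> \<in> topspace (susp_loops X)" "tracks X \<alpha> v"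
    and \<beta>: "\<beta> \<in> topspace (susp_loops X)" "tracks X \<beta> w"
  shows "tracks X (loop_concat \<alpha> \<beta>) (v \<otimes>\<^bsub>component_group X\<^esub> w)"
proof -
  interpret F: group "component_group X" by (rule group_free_group)
  obtain g where g: "lift_on X \<alpha> 0 1 g" "g 0 = []" "g 1 = v"
    using \<alpha> by (auto simp: tracks_def)
  obtain k where k: "lift_on X \<beta> 0 1 k" "k 0 = []" "k 1 = w"
    using \<beta> by (auto simp: tracks_def)
  have v: "v \<in> carrier (component_group X)"
    using lift_onD(1)[OF g(1), of 1] g by simp
  have one: "[] \<in> carrier (component_group X)"
    by (simp add: free_group_def)
  have l: "lift_on X (loop_concat \<alpha> \<beta>) 0 (1/2) (\<lambda>t. [] \<otimes>\<^bsub>component_group X\<^esub> g (2 * t - 0))"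
    by (rule lift_on_rescale[OF g(1) one]) (auto simp: loop_concat_def)
  have r: "lift_on X (loop_concat \<alpha> \<beta>) (1/2) 1 (\<lambda>t. v \<otimes>\<^bsub>component_group X\<^esub> k (2 * t - 1))"
  proof (rule lift_on_rescale[OF k(1) v])
    fix t :: real assume "1/2 \<le> t" "t \<le> 1"
    then show "loop_concat \<alpha> \<beta> t = \<beta> (2 * t - 1)"
    \<comment> \<open>At the midpoint \<open>loop_concat\<close> evaluates the first loop, so the
      claim there rests on both loops being at the basepoint.\<close>
    proof (cases "t = 1/2")
      case True
      then have "2 * t = 1" by simp
      with True show ?thesis
        using \<alpha>(1) \<beta>(1) by (simp add: loop_concat_def loop_iff)
    qed (simp add: loop_concat_def)
  qed auto
  have unit: "[] \<otimes>\<^bsub>component_group X\<^esub> u = u" "u \<otimes>\<^bsub>component_group X\<^esub> [] = u"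
    if "u \<in> carrier (component_group X)" for u
    using F.l_one[OF that] F.r_one[OF that] by (simp_all only: one_component_group)
  have "v \<otimes>\<^bsub>component_group X\<^esub> k (2 * (1/2) - 1) = [] \<otimes>\<^bsub>component_group X\<^esub> g (2 * (1/2) - 0)"
    using v by (simp add: unit g k)
  then obtain h where "lift_on X (loop_concat \<alpha> \<beta>) 0 1 h"
      "h 0 = [] \<otimes>\<^bsub>component_group X\<^esub> g (2 * 0 - 0)" "h 1 = v \<otimes>\<^bsub>component_group X\<^esub> k (2 * 1 - 1)"
    by (rule lift_on_extend[OF l r]) auto
  then have "lift_on X (loop_concat \<alpha> \<beta>) 0 1 h" "h 0 = []" "h 1 = v \<otimes>\<^bsub>component_group X\<^esub> w"
    by (simp_all add: unit g k one)
  then show ?thesis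
    unfolding tracks_def by blast
qed

section \<open>Loops that spell a given word\<close>

definition letter_loop :: "'a topology \<Rightarrow> 'a letter \<Rightarrow> real \<Rightarrow> ('a option \<times> real) set" where
  "letter_loop X a = (\<lambda>t\<in>{0..1}. susp_proj X (Some (snd a), if fst a then t else 1 - t))"

lemma letter_loop_eq:
  "letter_loop X (True, x) = meridian X x" "letter_loop X (False, x) = reverse_loop (meridian X x)"
proof -
  show "letter_loop X (True, x) = meridian X x"
    by (simp add: letter_loop_def meridian_def)
  show "letter_loop X (False, x) = reverse_loop (meridian X x)"
    unfolding letter_loop_def reverse_loop_def by (intro restrict_ext) (simp add: meridian_def)
qed

lemma letter_loop_loop: "snd a \<in> topspace X \<Longrightarrow> letter_loop X a \<in> topspace (susp_loops X)"
  by (cases a; cases "fst a") (auto simp: letter_loop_eq meridian_loop reverse_loop_loop)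

text \<open>The height word along the loop is the step function \<open>h\<close>, which jumps at
  time 1/2, and the factor \<open>inv h 0\<close> makes the lift start at the identity. A reversed
  meridian starts at the top, where \<open>h 0\<close> is the generator, so its lift ends at the
  inverse.\<close>

lemma tracks_letter:
  assumes x: "snd a \<in> topspace X"
  shows "tracks X (letter_loop X a) [apsnd (path_component_of_set X) a]"
proof -
  interpret F: group "component_group X" by (rule group_free_group)
  define \<sigma> where "\<sigma> t = (if fst a then t else 1 - t)" for t :: real
  define c where "c = path_component_of_set X (snd a)"
  define h where "h t = (if \<sigma> t < 1/2 then [] else generator c)" for t
  have c: "c \<in> topspace (pi0_top X)"
    using x by (simp add: c_def topspace_pi0_top)
  then have h: "h t \<in> carrier (component_group X)" for t
    by (auto simp: h_def generator_closed) (simp add: free_group_def)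
  have loop: "letter_loop X a t = susp_proj X (Some (snd a), \<sigma> t)" if "t \<in> {0..1}" for t
    using that by (simp add: letter_loop_def \<sigma>_def)
  have "lift_on X (letter_loop X a) 0 1
      (\<lambda>t. inv\<^bsub>component_group X\<^esub> h 0 \<otimes>\<^bsub>component_group X\<^esub> h t)"
  proof (rule lift_onI)
    fix s t :: real assume st: "0 \<le> s" "s \<le> t" "t \<le> 1"
    show "inv\<^bsub>component_group X\<^esub> h 0 \<otimes>\<^bsub>component_group X\<^esub> h t =
        inv\<^bsub>component_group X\<^esub> h 0 \<otimes>\<^bsub>component_group X\<^esub> h s"
      if o: "letter_loop X a ` {s..t} \<subseteq> outer_part X"
    proof -
      \<comment> \<open>For either orientation the loop has height 1/2 at time 1/2 and is then
        outside \<open>outer_part\<close>, so \<open>h\<close> cannot jump within the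
        interval.\<close>
      have "\<not> (s \<le> 1/2 \<and> 1/2 \<le> t)"
      proof
        assume "s \<le> 1/2 \<and> 1/2 \<le> t"
        then have "letter_loop X a (1/2) \<in> outer_part X"
          using o by auto
        then have "susp_proj X (Some (snd a), 1/2) \<in> outer_part X"
          using loop[of "1/2"] by (simp add: \<sigma>_def split: if_splits)
        then show False
          using x inner_outer_iff[of "susp_proj X (Some (snd a), 1/2)" X]
          by (simp add: susp_proj_inner_iff coords_susp_proj)
      qed
      then show ?thesis
        using st by (auto simp: h_def \<sigma>_def)
    qed
    assume i: "letter_loop X a ` {s..t} \<subseteq> inner_part X"
    have hw: "height_word X (letter_loop X a u) = h u" if "u \<in> {s..t}" for u
    proof -
      have u: "u \<in> {0..1}" using that st by auto
      moreover have "susp_proj X (Some (snd a), \<sigma> u) \<in> inner_part X"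
        using i that loop[OF u] by (metis image_subset_iff)
      ultimately have "0 < \<sigma> u" "\<sigma> u < 1"
        using x by (auto simp: susp_proj_inner_iff \<sigma>_def split: if_splits)
      then show ?thesis
        using loop[OF u] x by (simp add: height_word_def coords_susp_proj h_def c_def)
    qed
    show "inv\<^bsub>component_group X\<^esub> h 0 \<otimes>\<^bsub>component_group X\<^esub> h t =
        inv\<^bsub>component_group X\<^esub> h 0 \<otimes>\<^bsub>component_group X\<^esub> h s \<otimes>\<^bsub>component_group X\<^esub>
          (inv\<^bsub>component_group X\<^esub> height_word X (letter_loop X a s) \<otimes>\<^bsub>component_group X\<^esub>
            height_word X (letter_loop X a t))"
      using st h F.cancel_middle(2)[of "inv\<^bsub>component_group X\<^esub> h 0" "h s" "h s" "h t"] by (simp add: hw)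
  qed (use h in auto)
  moreover have "inv\<^bsub>component_group X\<^esub> h 0 \<otimes>\<^bsub>component_group X\<^esub> h 0 = []"
    using h[of 0] F.l_inv[OF h[of 0]] by (simp only: one_component_group)
  moreover have "inv\<^bsub>component_group X\<^esub> h 0 \<otimes>\<^bsub>component_group X\<^esub> h 1 = [apsnd (path_component_of_set X) a]"
  proof (cases "fst a")
    case True
    then have "h 0 = \<one>\<^bsub>component_group X\<^esub>" "h 1 = [apsnd (path_component_of_set X) a]"
      by (simp_all add: h_def \<sigma>_def one_component_group generator_def c_def apsnd_def map_prod_def split_beta)
    then show ?thesis
      using h[of 1] by simp
  next
    case False
    then have "h 0 = generator c" "h 1 = \<one>\<^bsub>component_group X\<^esub>"
      by (simp_all add: h_def \<sigma>_def one_component_group)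
    then have "inv\<^bsub>component_group X\<^esub> h 0 \<otimes>\<^bsub>component_group X\<^esub> h 1 = inv\<^bsub>component_group X\<^esub> generator c"
      using h[of 0] by simp
    also have "\<dots> = [(False, c)]"
      by (rule inv_generator[OF c])
    finally have "inv\<^bsub>component_group X\<^esub> h 0 \<otimes>\<^bsub>component_group X\<^esub> h 1 = [(False, c)]" .
    then show ?thesis
      using False by (simp add: c_def apsnd_def map_prod_def split_beta)
  qed
  ultimately show ?thesis
    unfolding tracks_def by blast
qed

definition word_loop :: "'a topology \<Rightarrow> 'a word \<Rightarrow> real \<Rightarrow> ('a option \<times> real) set" where
  "word_loop X w = foldr (\<lambda>a. loop_concat (letter_loop X a)) w (\<lambda>t\<in>{0..1}. suspension_base X)"

lemma word_loop_Nil: "word_loop X [] = (\<lambda>t\<in>{0..1}. suspension_base X)"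
  by (simp add: word_loop_def)

lemma word_loop_Cons [simp]: "word_loop X (a # w) = loop_concat (letter_loop X a) (word_loop X w)"
  by (simp add: word_loop_def)

lemma word_loop_loop:
  "snd ` set w \<subseteq> topspace X \<Longrightarrow> word_loop X w \<in> topspace (susp_loops X)"
  by (induction w) (auto simp: word_loop_Nil intro!: const_loop loop_concat_loop letter_loop_loop)

lemma component_word_append:
  "component_word X (v @ w) = component_word X v \<otimes>\<^bsub>component_group X\<^esub> component_word X w"
  by (simp add: component_word_def free_group_def)

lemma component_word_Nil: "component_word X [] = []"
  by (simp add: component_word_def reduce_word_def)

lemma component_word_singleton: "component_word X [a] = [apsnd (path_component_of_set X) a]"
  by (simp add: component_word_def reduce_word_def)

lemma tracks_word_loop:
  "snd ` set w \<subseteq> topspace X \<Longrightarrow> tracks X (word_loop X w) (component_word X w)"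
proof (induction w)
  case Nil
  show ?case
    unfolding word_loop_Nil component_word_Nil by (rule tracks_const)
next
  case (Cons a w)
  then have "tracks X (word_loop X (a # w))
      ([apsnd (path_component_of_set X) a] \<otimes>\<^bsub>component_group X\<^esub> component_word X w)"
    by (auto intro!: tracks_concat letter_loop_loop word_loop_loop tracks_letter)
  then show ?case
    using component_word_append[of X "[a]" w] by (simp add: component_word_singleton)
qed

text \<open>The homotopy counterpart of \<open>tracks_word_loop\<close>: the loop spelled by a word
  represents the image of that word, and its lift recovers the word.\<close>

lemma susp_class_word_loop:
  "snd ` set w \<subseteq> topspace X \<Longrightarrow> susp_class X (word_loop X w) = word_class X (component_word X w)"
proof (induction w)
  case Nil
  show ?case
    using hom_one[OF word_class_hom[of X] group_free_group group_susp_group]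
    by (simp only: word_loop_Nil component_word_Nil one_fundamental_group one_component_group)
next
  case (Cons a w)
  have x: "snd a \<in> topspace X" and w: "snd ` set w \<subseteq> topspace X"
    using Cons.prems by auto
  then have "path_component_of_set X (snd a) \<in> topspace (pi0_top X)"
    by (simp add: topspace_pi0_top)
  then have mem: "[apsnd (path_component_of_set X) a] \<in> carrier (component_group X)"
    by (intro singleton_in_free_group) simp
  have "susp_class X (letter_loop X a) = word_class X [apsnd (path_component_of_set X) a]"
  proof -
    obtain e y where a: "a = (e, y)" "y \<in> topspace X"
      using x by (cases a) auto
    interpret group "susp_group X" by (rule group_susp_group)
    show ?thesis
    proof (cases e)
      case True
      then show ?thesis
        using a word_class_generator[of y X] by (simp add: letter_loop_eq generator_def)
    next
      case False
      then have "susp_class X (letter_loop X a) = inv\<^bsub>susp_group X\<^esub> susp_class X (meridian X y)"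
        using a by (simp add: letter_loop_eq inv_fundamental_group meridian_loop)
      also have "\<dots> = word_class X [(False, path_component_of_set X y)]"
        using a loop_class_in_fundamental_group[OF meridian_loop[OF a(2)]]
        by (simp add: word_class_def word_eval_def letter_eval_def meridian_class_path_component)
      finally show ?thesis
        using False a by simp
    qed
  qed
  moreover have "component_word X w \<in> carrier (component_group X)"
    using w by (intro component_word_in_free_group) (simp add: topspace_monoid_topology)
  ultimately have "susp_class X (word_loop X (a # w)) =
      word_class X ([apsnd (path_component_of_set X) a] \<otimes>\<^bsub>component_group X\<^esub> component_word X w)"
    using Cons.IH[OF w] mem x w
    by (simp add: hom_mult[OF word_class_hom] letter_loop_loop word_loop_loop flip: fundamental_group_mult)
  then show ?case
    using component_word_append[of X "[a]" w] by (simp add: component_word_singleton)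
qed

subsection \<open>The lift depends continuously on the loop\<close>

text \<open>Near a given loop, the endpoint of the lift is a word in the \<open>X\<close>-coordinates of the loop at
  finitely many fixed times. This gives both homotopy invariance and continuity into
  \<open>FRP_topology\<close>.\<close>

definition sampled_word ::
  "(real \<Rightarrow> ('a option \<times> real) set) \<Rightarrow> (bool \<times> real) list \<Rightarrow> 'a word" where
  "sampled_word \<alpha> L = map (\<lambda>(e, t). (e, xcoord (\<alpha> t))) L"

definition samples_inside ::
  "'a topology \<Rightarrow> (real \<Rightarrow> ('a option \<times> real) set) \<Rightarrow> (bool \<times> real) list \<Rightarrow> bool" where
  "samples_inside X \<alpha> L \<longleftrightarrow> (\<forall>(e, t)\<in>set L. t \<in> {0..1} \<and> \<alpha> t \<in> inner_part X)"

lemma sampled_word_in_monoid: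
  "samples_inside X \<alpha> L \<Longrightarrow> sampled_word \<alpha> L \<in> topspace (monoid_topology X)"
  by (fastforce simp: samples_inside_def sampled_word_def topspace_monoid_topology elim: inner_cases)

lemma component_word_sampled_append:
  "component_word X (sampled_word \<alpha> (L @ [(e, t)])) =
     component_word X (sampled_word \<alpha> L) \<otimes>\<^bsub>component_group X\<^esub>
       [(e, path_component_of_set X (xcoord (\<alpha> t)))]"
  by (simp add: sampled_word_def component_word_append component_word_singleton)

lemma openin_loops_at:
  assumes "openin (suspension_plus X) U" "t \<in> {0..1}"
  shows "openin (susp_loops X) {\<alpha> \<in> topspace (susp_loops X). \<alpha> t \<in> U}"
  using openin_continuous_map_preimage[OF continuous_map_loop_eval[OF assms(2)] assms(1)] .

text \<open>In the overlap the height differs from 1/2, and the strict inequality persists for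
  nearby loops. Only the form of the height word is locally constant; the component of
  \<open>xcoord (\<alpha> a)\<close> may still vary with \<alpha>, because components need not be
  open.\<close>

lemma height_word_locally:
  assumes \<beta>: "\<beta> \<in> topspace (susp_loops X)" and a: "a \<in> {0..1}"
    and "\<beta> a \<in> inner_part X" "\<beta> a \<in> outer_part X"
  obtains N where "openin (susp_loops X) N" "\<beta> \<in> N" "\<And>\<alpha>. \<alpha> \<in> N \<Longrightarrow> \<alpha> a \<in> inner_part X"
    "(\<forall>\<alpha>\<in>N. height_word X (\<alpha> a) = []) \<or>
     (\<forall>\<alpha>\<in>N. height_word X (\<alpha> a) = generator (path_component_of_set X (xcoord (\<alpha> a))))"
proof -
  define B :: "real set" where "B = (if height (\<beta> a) < 1/2 then {..<1/2} else {1/2<..})"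
  have op: "openin (suspension_plus X) {p \<in> inner_part X. xcoord p \<in> topspace X \<and> height p \<in> B}"
    by (intro openin_inner_box) (auto simp: B_def)
  let ?N = "{\<alpha> \<in> topspace (susp_loops X).
    \<alpha> a \<in> {p \<in> inner_part X. xcoord p \<in> topspace X \<and> height p \<in> B}}"
  have "height (\<beta> a) \<in> B"
    using assms(4) inner_outer_iff[OF assms(3)] by (auto simp: B_def)
  moreover have "xcoord (\<beta> a) \<in> topspace X"
    using assms(3) by (auto elim: inner_cases)
  ultimately have "\<beta> \<in> ?N"
    using \<beta> assms(3) by simp
  moreover have "(\<forall>\<alpha>\<in>?N. height_word X (\<alpha> a) = []) \<or>
     (\<forall>\<alpha>\<in>?N. height_word X (\<alpha> a) = generator (path_component_of_set X (xcoord (\<alpha> a))))"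
    by (cases "height (\<beta> a) < 1/2") (auto simp: B_def height_word_def)
  ultimately show thesis
    using openin_loops_at[OF op a] by (intro that[of ?N]) auto
qed

text \<open>The analogue of \<open>tracks\<close> for the initial segment up to time
  \<open>c\<close>, which makes induction on \<open>c\<close> possible.\<close>

definition lift_value :: "'a topology \<Rightarrow> (real \<Rightarrow> ('a option \<times> real) set) \<Rightarrow> real \<Rightarrow> 'a set word \<Rightarrow> bool" where
  "lift_value X \<alpha> c w \<longleftrightarrow> (\<exists>g. lift_on X \<alpha> 0 c g \<and> g 0 = [] \<and> g c = w)"

lemma tracks_iff: "tracks X \<alpha> w \<longleftrightarrow> lift_value X \<alpha> 1 w"
  by (simp add: tracks_def lift_value_def)

lemma lift_value_outer:
  assumes "\<alpha> \<in> topspace (susp_loops X)" "lift_value X \<alpha> a w" "0 \<le> a" "a \<le> b" "b \<le> 1"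
    and "\<alpha> ` {a..b} \<subseteq> outer_part X"
  shows "lift_value X \<alpha> b w"
proof -
  obtain g where g: "lift_on X \<alpha> 0 a g" "g 0 = []" "g a = w"
    using assms(2) by (auto simp: lift_value_def)
  have "continuous_map unit_interval (suspension_plus X) \<alpha>"
    using assms(1) by (simp add: loop_iff)
  from lift_on_extend_outer[OF this g(1) assms(3-6)]
  obtain g' where "lift_on X \<alpha> 0 b g'" "g' 0 = g 0" "g' b = g a"
    by metis
  with g show ?thesis
    unfolding lift_value_def by (intro exI[of _ g']) simp
qed

lemma lift_value_inner:
  assumes "\<alpha> \<in> topspace (susp_loops X)" "lift_value X \<alpha> a w" "0 \<le> a" "a \<le> b" "b \<le> 1"
    and "\<alpha> ` {a..b} \<subseteq> inner_part X"
  shows "lift_value X \<alpha> b (w \<otimes>\<^bsub>component_group X\<^esub>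
       (inv\<^bsub>component_group X\<^esub> height_word X (\<alpha> a) \<otimes>\<^bsub>component_group X\<^esub> height_word X (\<alpha> b)))"
proof -
  obtain g where g: "lift_on X \<alpha> 0 a g" "g 0 = []" "g a = w"
    using assms(2) by (auto simp: lift_value_def)
  have "continuous_map unit_interval (suspension_plus X) \<alpha>"
    using assms(1) by (simp add: loop_iff)
  from lift_on_extend_inner[OF this g(1) assms(3-6)]
  obtain g' where "lift_on X \<alpha> 0 b g'" "g' 0 = g 0"
    "g' b = g a \<otimes>\<^bsub>component_group X\<^esub>
       (inv\<^bsub>component_group X\<^esub> height_word X (\<alpha> a) \<otimes>\<^bsub>component_group X\<^esub> height_word X (\<alpha> b))"
    by metis
  with g show ?thesis
    unfolding lift_value_def by (intro exI[of _ g']) simp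
qed

lemma openin_loops_piece:
  assumes "openin (suspension_plus X) U" "0 \<le> a" "b \<le> 1"
  shows "openin (susp_loops X) {\<alpha> \<in> topspace (susp_loops X). \<alpha> ` {a..b} \<subseteq> U}"
  using assms by (intro openin_loop_space_image_subset) (auto simp: compactin_subtopology)

text \<open>By induction along \<beta>, a neighbourhood and a list of signed sample times are built
  together. A sample is added only at a change between inner and outer mode, and at the change the
  loop is in the overlap, where \<open>height_word_locally\<close> fixes whether a letter is
  needed.\<close>

lemma tracks_sampled_word:
  assumes \<beta>: "\<beta> \<in> topspace (susp_loops X)"
  obtains N L where "openin (susp_loops X) N" "\<beta> \<in> N"
    "\<And>\<alpha>. \<alpha> \<in> N \<Longrightarrow> samples_inside X \<alpha> L"
    "\<And>\<alpha>. \<alpha> \<in> N \<Longrightarrow> tracks X \<alpha> (component_word X (sampled_word \<alpha> L))"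
proof -
  interpret F: group "component_group X" by (rule group_free_group)
  have cont: "continuous_map unit_interval (suspension_plus X) \<beta>"
    using \<beta> by (simp add: loop_iff)
  let ?good = "\<lambda>N L. openin (susp_loops X) N \<and> \<beta> \<in> N \<and> (\<forall>\<alpha>\<in>N. samples_inside X \<alpha> L)"
  \<comment> \<open>In outer mode the sampled word is the value of the lift. In inner mode the
    moving factor \<open>height_word X (\<alpha> c)\<close> is kept apart, so no sample has to move
    with \<open>c\<close>.\<close>
  let ?out = "\<lambda>N L c. \<forall>\<alpha>\<in>N. \<alpha> c \<in> outer_part X \<and>
    lift_value X \<alpha> c (component_word X (sampled_word \<alpha> L))"
  let ?inn = "\<lambda>N L c. \<forall>\<alpha>\<in>N. \<alpha> c \<in> inner_part X \<and>
    lift_value X \<alpha> c (component_word X (sampled_word \<alpha> L) \<otimes>\<^bsub>component_group X\<^esub> height_word X (\<alpha> c))"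
  let ?Q = "\<lambda>c. \<exists>N L. ?good N L \<and> (?out N L c \<or> ?inn N L c)"
  have cw: "component_word X (sampled_word \<alpha> L) \<in> carrier (component_group X)"
    if "samples_inside X \<alpha> L" for \<alpha> L
    using that by (intro component_word_in_free_group sampled_word_in_monoid)
  have unit: "u \<otimes>\<^bsub>component_group X\<^esub> [] = u" "[] \<otimes>\<^bsub>component_group X\<^esub> u = u"
    if "u \<in> carrier (component_group X)" for u
    using F.r_one[OF that] F.l_one[OF that] by (simp_all only: one_component_group)
  have inv_unit: "inv\<^bsub>component_group X\<^esub> [] = []"
    using F.inv_one by (simp only: one_component_group)
  have comp: "path_component_of_set X (xcoord p) \<in> topspace (pi0_top X)" if "p \<in> inner_part X" for p
    using that by (auto simp: topspace_pi0_top elim: inner_cases)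
  have "?Q 1"
  proof (rule susp_path_induct[where Q = ?Q, OF cont])
    have "lift_value X \<alpha> 0 []" if "\<alpha> \<in> topspace (susp_loops X)" for \<alpha>
      unfolding lift_value_def
    proof (intro exI conjI lift_onI)
      fix s t :: real assume "0 \<le> s" "s \<le> t" "t \<le> 0" "\<alpha> ` {s..t} \<subseteq> inner_part X"
      then have "\<alpha> 0 \<in> inner_part X" by auto
      then show "[] = [] \<otimes>\<^bsub>component_group X\<^esub>
          (inv\<^bsub>component_group X\<^esub> height_word X (\<alpha> s) \<otimes>\<^bsub>component_group X\<^esub> height_word X (\<alpha> t))"
        using that by (simp add: loop_iff)
    qed (auto simp: free_group_def)
    then have "?good (topspace (susp_loops X)) [] \<and> ?out (topspace (susp_loops X)) [] 0"
      using \<beta> by (auto simp: samples_inside_def sampled_word_def component_word_Nil loop_iff)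
    then show "?Q 0" by blast
  next
    fix a b :: real assume ab: "0 \<le> a" "a \<le> b" "b \<le> 1"
      and cover: "\<beta> ` {a..b} \<subseteq> inner_part X \<or> \<beta> ` {a..b} \<subseteq> outer_part X" and "?Q a"
    then obtain N L where good: "?good N L" and NL: "?out N L a \<or> ?inn N L a"
      by blast
    then have Nsub: "N \<subseteq> topspace (susp_loops X)"
      using openin_subset by blast
    have a01: "a \<in> {0..1}" using ab by simp
    show "?Q b"
    proof (cases "\<beta> ` {a..b} \<subseteq> outer_part X")
      case True
      define N1 where "N1 = N \<inter> {\<alpha> \<in> topspace (susp_loops X). \<alpha> ` {a..b} \<subseteq> outer_part X}"
      have N1: "openin (susp_loops X) N1" "\<beta> \<in> N1"
        using good True \<beta> openin_loops_piece[OF openin_outer ab(1,3), of X] unfolding N1_def by blast+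
      have piece: "\<alpha> ` {a..b} \<subseteq> outer_part X" "\<alpha> a \<in> outer_part X" "\<alpha> b \<in> outer_part X"
          "\<alpha> \<in> topspace (susp_loops X)" "\<alpha> \<in> N"
        if "\<alpha> \<in> N1" for \<alpha>
        using that ab by (auto simp: N1_def)
      show ?thesis
        using NL
      proof
        assume out: "?out N L a"
        have "?out N1 L b"
        proof (intro ballI conjI)
          fix \<alpha> assume \<alpha>: "\<alpha> \<in> N1"
          then show "\<alpha> b \<in> outer_part X" by (rule piece)
          show "lift_value X \<alpha> b (component_word X (sampled_word \<alpha> L))"
            using lift_value_outer[OF piece(4)[OF \<alpha>] conjunct2[OF bspec[OF out piece(5)[OF \<alpha>]]]
                ab piece(1)[OF \<alpha>]] .
        qed
        moreover have "?good N1 L"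
          using good N1 piece(5) by blast
        ultimately show ?thesis by blast
      next
        assume inn: "?inn N L a"
        then have "\<beta> a \<in> inner_part X" "\<beta> a \<in> outer_part X"
          using good piece(2)[OF N1(2)] by blast+
        from height_word_locally[OF \<beta> a01 this]
        obtain N2 where N2: "openin (susp_loops X) N2" "\<beta> \<in> N2" "\<And>\<alpha>. \<alpha> \<in> N2 \<Longrightarrow> \<alpha> a \<in> inner_part X"
          and hw: "(\<forall>\<alpha>\<in>N2. height_word X (\<alpha> a) = []) \<or>
            (\<forall>\<alpha>\<in>N2. height_word X (\<alpha> a) = generator (path_component_of_set X (xcoord (\<alpha> a))))"
          by metis
        \<comment> \<open>Leaving inner mode freezes the moving factor at time \<open>a\<close>: it
          becomes a positive sample if nearby loops are high there, and nothing if they are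
          low.\<close>
        have "\<exists>L'. \<forall>\<alpha>\<in>N1 \<inter> N2. samples_inside X \<alpha> L' \<and> component_word X (sampled_word \<alpha> L') =
            component_word X (sampled_word \<alpha> L) \<otimes>\<^bsub>component_group X\<^esub> height_word X (\<alpha> a)"
          using hw
        proof
          assume "\<forall>\<alpha>\<in>N2. height_word X (\<alpha> a) = []"
          then show ?thesis
            using good piece(5) by (intro exI[of _ L]) (simp add: unit cw)
        next
          assume "\<forall>\<alpha>\<in>N2. height_word X (\<alpha> a) = generator (path_component_of_set X (xcoord (\<alpha> a)))"
          moreover have "samples_inside X \<alpha> (L @ [(True, a)])" if "\<alpha> \<in> N1 \<inter> N2" for \<alpha>
            using that good piece(5) N2(3) a01 by (auto simp: samples_inside_def)
          ultimately show ?thesis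
            by (intro exI[of _ "L @ [(True, a)]"]) (simp add: component_word_sampled_append generator_def)
        qed
        then obtain L' where L': "\<And>\<alpha>. \<alpha> \<in> N1 \<inter> N2 \<Longrightarrow> samples_inside X \<alpha> L'"
          "\<And>\<alpha>. \<alpha> \<in> N1 \<inter> N2 \<Longrightarrow> component_word X (sampled_word \<alpha> L') =
            component_word X (sampled_word \<alpha> L) \<otimes>\<^bsub>component_group X\<^esub> height_word X (\<alpha> a)"
          by metis
        have "?out (N1 \<inter> N2) L' b"
        proof (intro ballI conjI)
          fix \<alpha> assume \<alpha>: "\<alpha> \<in> N1 \<inter> N2"
          then have \<alpha>1: "\<alpha> \<in> N1" by blast
          show "\<alpha> b \<in> outer_part X" using piece(3)[OF \<alpha>1] .
          have "lift_value X \<alpha> a (component_word X (sampled_word \<alpha> L'))"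
            unfolding L'(2)[OF \<alpha>] using bspec[OF inn piece(5)[OF \<alpha>1]] by (rule conjunct2)
          then show "lift_value X \<alpha> b (component_word X (sampled_word \<alpha> L'))"
            by (rule lift_value_outer[OF piece(4)[OF \<alpha>1] _ ab piece(1)[OF \<alpha>1]])
        qed
        moreover have "?good (N1 \<inter> N2) L'"
          using N1 N2 L'(1) by (intro conjI openin_Int) blast+
        ultimately show ?thesis by blast
      qed
    next
      case False
      then have inner: "\<beta> ` {a..b} \<subseteq> inner_part X"
        using cover by blast
      define N1 where "N1 = N \<inter> {\<alpha> \<in> topspace (susp_loops X). \<alpha> ` {a..b} \<subseteq> inner_part X}"
      have N1: "openin (susp_loops X) N1" "\<beta> \<in> N1"
        using good inner \<beta> openin_loops_piece[OF openin_inner ab(1,3), of X] unfolding N1_def by blast+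
      have piece: "\<alpha> ` {a..b} \<subseteq> inner_part X" "\<alpha> a \<in> inner_part X" "\<alpha> b \<in> inner_part X"
          "\<alpha> \<in> topspace (susp_loops X)" "\<alpha> \<in> N"
        if "\<alpha> \<in> N1" for \<alpha>
        using that ab by (auto simp: N1_def)
      show ?thesis
        using NL
      proof
        assume inn: "?inn N L a"
        have "?inn N1 L b"
        proof (intro ballI conjI)
          fix \<alpha> assume \<alpha>: "\<alpha> \<in> N1"
          then show "\<alpha> b \<in> inner_part X" by (rule piece)
          have "component_word X (sampled_word \<alpha> L) \<in> carrier (component_group X)"
            "height_word X (\<alpha> a) \<in> carrier (component_group X)" "height_word X (\<alpha> b) \<in> carrier (component_group X)"
            using good piece[OF \<alpha>] by (auto intro: cw height_word_closed)
          note eq = F.cancel_middle(2)[OF this(1) this(2) this(2,3)]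
          have "lift_value X \<alpha> a (component_word X (sampled_word \<alpha> L) \<otimes>\<^bsub>component_group X\<^esub> height_word X (\<alpha> a))"
            using bspec[OF inn piece(5)[OF \<alpha>]] by (rule conjunct2)
          from lift_value_inner[OF piece(4)[OF \<alpha>] this ab piece(1)[OF \<alpha>]]
          show "lift_value X \<alpha> b (component_word X (sampled_word \<alpha> L) \<otimes>\<^bsub>component_group X\<^esub> height_word X (\<alpha> b))"
            unfolding eq .
        qed
        moreover have "?good N1 L"
          using good N1 piece(5) by blast
        ultimately show ?thesis by blast
      next
        assume out: "?out N L a"
        then have "\<beta> a \<in> inner_part X" "\<beta> a \<in> outer_part X"
          using good piece(2)[OF N1(2)] by blast+
        from height_word_locally[OF \<beta> a01 this]
        obtain N2 where N2: "openin (susp_loops X) N2" "\<beta> \<in> N2" "\<And>\<alpha>. \<alpha> \<in> N2 \<Longrightarrow> \<alpha> a \<in> inner_part X"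
          and hw: "(\<forall>\<alpha>\<in>N2. height_word X (\<alpha> a) = []) \<or>
            (\<forall>\<alpha>\<in>N2. height_word X (\<alpha> a) = generator (path_component_of_set X (xcoord (\<alpha> a))))"
          by metis
        \<comment> \<open>Entering inner mode starts the height word at its value at
          \<open>a\<close>. Its inverse is recorded, as a negative sample at \<open>a\<close> if the
          loops are high there, so that the moving factor can be appended unnormalised.\<close>
        have "\<exists>L'. \<forall>\<alpha>\<in>N1 \<inter> N2. samples_inside X \<alpha> L' \<and> component_word X (sampled_word \<alpha> L') =
            component_word X (sampled_word \<alpha> L) \<otimes>\<^bsub>component_group X\<^esub>
              inv\<^bsub>component_group X\<^esub> height_word X (\<alpha> a)"
          using hw
        proof
          assume "\<forall>\<alpha>\<in>N2. height_word X (\<alpha> a) = []"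
          then show ?thesis
            using good piece(5) by (intro exI[of _ L]) (simp add: unit inv_unit cw)
        next
          assume "\<forall>\<alpha>\<in>N2. height_word X (\<alpha> a) = generator (path_component_of_set X (xcoord (\<alpha> a)))"
          moreover have "samples_inside X \<alpha> (L @ [(False, a)])" if "\<alpha> \<in> N1 \<inter> N2" for \<alpha>
            using that good piece(5) N2(3) a01 by (auto simp: samples_inside_def)
          ultimately show ?thesis
            using N2(3)
            by (intro exI[of _ "L @ [(False, a)]"]) (simp add: component_word_sampled_append inv_generator comp)
        qed
        then obtain L' where L': "\<And>\<alpha>. \<alpha> \<in> N1 \<inter> N2 \<Longrightarrow> samples_inside X \<alpha> L'"
          "\<And>\<alpha>. \<alpha> \<in> N1 \<inter> N2 \<Longrightarrow> component_word X (sampled_word \<alpha> L') =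
            component_word X (sampled_word \<alpha> L) \<otimes>\<^bsub>component_group X\<^esub>
              inv\<^bsub>component_group X\<^esub> height_word X (\<alpha> a)"
          by metis
        have "?inn (N1 \<inter> N2) L' b"
        proof (intro ballI conjI)
          fix \<alpha> assume \<alpha>: "\<alpha> \<in> N1 \<inter> N2"
          then have \<alpha>1: "\<alpha> \<in> N1" by blast
          show "\<alpha> b \<in> inner_part X" using piece(3)[OF \<alpha>1] .
          have "component_word X (sampled_word \<alpha> L) \<in> carrier (component_group X)"
            "height_word X (\<alpha> a) \<in> carrier (component_group X)" "height_word X (\<alpha> b) \<in> carrier (component_group X)"
            using good piece[OF \<alpha>1] by (auto intro: cw height_word_closed)
          then have eq: "component_word X (sampled_word \<alpha> L) \<otimes>\<^bsub>component_group X\<^esub>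
              (inv\<^bsub>component_group X\<^esub> height_word X (\<alpha> a) \<otimes>\<^bsub>component_group X\<^esub> height_word X (\<alpha> b)) =
              component_word X (sampled_word \<alpha> L') \<otimes>\<^bsub>component_group X\<^esub> height_word X (\<alpha> b)"
            by (simp add: L'(2)[OF \<alpha>] F.m_assoc)
          have "lift_value X \<alpha> a (component_word X (sampled_word \<alpha> L))"
            using bspec[OF out piece(5)[OF \<alpha>1]] by (rule conjunct2)
          from lift_value_inner[OF piece(4)[OF \<alpha>1] this ab piece(1)[OF \<alpha>1]]
          show "lift_value X \<alpha> b (component_word X (sampled_word \<alpha> L') \<otimes>\<^bsub>component_group X\<^esub> height_word X (\<alpha> b))"
            unfolding eq .
        qed
        moreover have "?good (N1 \<inter> N2) L'"
          using N1 N2 L'(1) by (intro conjI openin_Int) blast+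
        ultimately show ?thesis by blast
      qed
    qed
  qed simp
  then obtain N L where good: "?good N L" and NL: "?out N L 1 \<or> ?inn N L 1"
    by blast
  have "\<beta> 1 = suspension_base X"
    using \<beta> by (simp add: loop_iff)
  \<comment> \<open>At time 1 the loop is at the basepoint, so no moving factor remains.\<close>
  then have "\<not> ?inn N L 1"
    using good base_notin_inner[of X] by metis
  with NL have "?out N L 1"
    by blast
  with good show thesis
    by (intro that[of N L]) (auto simp: tracks_iff)
qed

text \<open>A homotopy is a path in the loop space. Near each of its points the endpoint is a
  sampled word at fixed times, so it suffices that the letters of this word keep their
  components.\<close>

lemma tracks_homotopic:
  assumes \<alpha>: "\<alpha> \<in> topspace (susp_loops X)" and \<beta>: "\<beta> \<in> topspace (susp_loops X)"
    and hom: "loop_homotopic (suspension_plus X) (suspension_base X) \<alpha> \<beta>" and w: "tracks X \<alpha> w"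
  shows "tracks X \<beta> w"
proof -
  obtain h where h: "continuous_map (prod_topology unit_interval unit_interval) (suspension_plus X) h"
      "\<And>t. t\<in>{0..1} \<Longrightarrow> h (0, t) = \<alpha> t" "\<And>t. t\<in>{0..1} \<Longrightarrow> h (1, t) = \<beta> t"
      "\<And>r. r\<in>{0..1} \<Longrightarrow> h (r, 0) = suspension_base X" "\<And>r. r\<in>{0..1} \<Longrightarrow> h (r, 1) = suspension_base X"
    using hom unfolding loop_homotopic_iff by blast
  define \<gamma> where "\<gamma> r = (\<lambda>t\<in>{0..1}. h (r, t))" for r
  have \<gamma>: "continuous_map unit_interval (susp_loops X) \<gamma>"
    unfolding \<gamma>_def using h by (intro continuous_map_loop_family) auto
  have \<gamma>_loop: "\<gamma> r \<in> topspace (susp_loops X)" if "r \<in> {0..1}" for r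
    using \<gamma> that by (auto simp: continuous_map_def Pi_iff)
  \<comment> \<open>Loops are extensional, so the restricted slices equal \<alpha> and \<beta> as
    functions.\<close>
  have ends: "\<gamma> 0 = \<alpha>" "\<gamma> 1 = \<beta>"
    unfolding \<gamma>_def using \<alpha> \<beta> h by (auto simp: loop_iff intro!: extensionalityI[of _ "{0..1}"])
  have "tracks X (\<gamma> 1) w"
  proof (rule interval_induct[where Q = "\<lambda>r. tracks X (\<gamma> r) w"])
    show "tracks X (\<gamma> 0) w" using w ends by simp
    fix x :: real assume x: "x \<in> {0..1}"
    obtain N L where N: "openin (susp_loops X) N" "\<gamma> x \<in> N"
      "\<And>\<alpha>. \<alpha> \<in> N \<Longrightarrow> samples_inside X \<alpha> L"
      "\<And>\<alpha>. \<alpha> \<in> N \<Longrightarrow> tracks X \<alpha> (component_word X (sampled_word \<alpha> L))"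
      using tracks_sampled_word[OF \<gamma>_loop[OF x]] by metis
    let ?W = "{r \<in> topspace unit_interval. \<gamma> r \<in> N}"
    have "openin unit_interval ?W"
      by (rule openin_continuous_map_preimage[OF \<gamma> N(1)])
    moreover have "tracks X (\<gamma> b) w" if ab: "0 \<le> a" "a \<le> b" "b \<le> 1" "{a..b} \<subseteq> ?W" "tracks X (\<gamma> a) w" for a b
    proof -
      have inN: "\<gamma> r \<in> N" if "r \<in> {a..b}" for r
        using ab(4) that by blast
      \<comment> \<open>For a fixed sample time \<open>t\<close>, varying \<open>r\<close> moves the
        sample along a path in the cylinder, whose projection is a path in \<open>X\<close>.\<close>
      have "path_component_of_set X (xcoord (\<gamma> a t)) = path_component_of_set X (xcoord (\<gamma> b t))"
        if "(e, t) \<in> set L" for e t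
      proof (rule inner_path_component[OF _ ab(1-3)])
        have t: "t \<in> {0..1}" and "\<gamma> r t \<in> inner_part X" if "r \<in> {a..b}" for r
          using N(3)[OF inN[OF that]] \<open>(e, t) \<in> set L\<close> by (auto simp: samples_inside_def)
        then show "(\<lambda>r. \<gamma> r t) ` {a..b} \<subseteq> inner_part X"
          by blast
        have "t \<in> {0..1}"
          using t[of a] ab(2) by simp
        from continuous_map_compose[OF \<gamma> continuous_map_loop_eval[OF this]]
        show "continuous_map unit_interval (suspension_plus X) (\<lambda>r. \<gamma> r t)"
          by (simp add: o_def)
      qed
      then have "map (apsnd (path_component_of_set X)) (sampled_word (\<gamma> a) L) =
          map (apsnd (path_component_of_set X)) (sampled_word (\<gamma> b) L)"
        by (auto simp: sampled_word_def)
      then have "component_word X (sampled_word (\<gamma> a) L) = component_word X (sampled_word (\<gamma> b) L)"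
        by (simp only: component_word_def)
      moreover have "w = component_word X (sampled_word (\<gamma> a) L)"
        using ab(1-3) N(4)[OF inN] by (intro tracks_unique[OF \<gamma>_loop ab(5)]) auto
      ultimately show ?thesis
        using N(4)[OF inN, of b] ab(2) by simp
    qed
    ultimately show "\<exists>W. openin unit_interval W \<and> x \<in> W \<and>
        (\<forall>a b. 0 \<le> a \<longrightarrow> a \<le> b \<longrightarrow> b \<le> 1 \<longrightarrow> {a..b} \<subseteq> W \<longrightarrow> tracks X (\<gamma> a) w \<longrightarrow> tracks X (\<gamma> b) w)"
      using x N(2) by (intro exI[of _ ?W] conjI) (auto simp del: atLeastAtMost_iff)
  qed simp
  then show ?thesis
    using ends by simp
qed

subsection \<open>The fundamental group of the suspension\<close>

text \<open>A loop that spells \<open>w\<close> is homotopic to \<alpha> and its lift ends at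
  \<open>w\<close>. So the endpoint of the lift inverts \<open>word_class\<close>, which is the
  source of both injectivity and continuity of the inverse.\<close>

lemma tracks_if_class:
  assumes \<alpha>: "\<alpha> \<in> topspace (susp_loops X)" and w: "w \<in> carrier (component_group X)"
    and eq: "susp_class X \<alpha> = word_class X w"
  shows "tracks X \<alpha> w"
proof -
  obtain u where u: "u \<in> topspace (monoid_topology X)" "w = component_word X u"
    using w component_word_surj[of X] by (metis imageE)
  then have uX: "snd ` set u \<subseteq> topspace X"
    by (simp add: topspace_monoid_topology)
  have "susp_class X (word_loop X u) = susp_class X \<alpha>"
    using u by (simp add: eq susp_class_word_loop[OF uX])
  then have "loop_homotopic (suspension_plus X) (suspension_base X) (word_loop X u) \<alpha>"
    by (simp only: loop_class_eq_iff[OF word_loop_loop[OF uX] \<alpha>])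
  then show ?thesis
    unfolding u(2) by (rule tracks_homotopic[OF word_loop_loop[OF uX] \<alpha> _ tracks_word_loop[OF uX]])
qed

text \<open>Two words with the same image are both tracked by any loop in that class, so they agree
  by \<open>tracks_unique\<close>; \<open>loop_class_in_range\<close> supplies surjectivity.\<close>

lemma word_class_iso: "word_class X \<in> iso (component_group X) (susp_group X)"
proof -
  have "inj_on (word_class X) (carrier (component_group X))"
  proof (rule inj_onI)
    fix v w assume vw: "v \<in> carrier (component_group X)" "w \<in> carrier (component_group X)"
      and eq: "word_class X v = word_class X w"
    have "word_class X v \<in> carrier (susp_group X)"
      using word_class_hom vw(1) by (rule hom_in_carrier)
    then obtain \<alpha> where "\<alpha> \<in> topspace (susp_loops X)" "word_class X v = susp_class X \<alpha>"
      unfolding carrier_fundamental_group by (rule imageE)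
    then show "v = w"
      using vw eq by (metis tracks_if_class tracks_unique)
  qed
  moreover have "word_class X ` carrier (component_group X) = carrier (susp_group X)"
  proof
    show "word_class X ` carrier (component_group X) \<subseteq> carrier (susp_group X)"
      using hom_in_carrier[OF word_class_hom] by blast
    show "carrier (susp_group X) \<subseteq> word_class X ` carrier (component_group X)"
      unfolding carrier_fundamental_group using loop_class_in_range by blast
  qed
  ultimately show ?thesis
    using word_class_hom by (simp add: iso_def bij_betw_def)
qed

lemma continuous_map_word_loop: "continuous_map (monoid_topology X) (susp_loops X) (word_loop X)"
proof (rule continuous_map_from_monoid)
  fix Q :: "(nat \<Rightarrow> 'a letter) topology" and ls
  assume ls: "\<forall>l\<in>set ls. continuous_map Q (letter_topology X) l"
  let ?QI = "prod_topology Q unit_interval"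
  have inX: "snd (l p) \<in> topspace X" if "l \<in> set ls" "p \<in> topspace Q" for l p
  proof -
    have "l p \<in> topspace (letter_topology X)"
      using ls that by (auto simp: continuous_map_def Pi_iff)
    then show ?thesis
      by (auto simp: letter_topology_def)
  qed
  have words: "snd ` set (map (\<lambda>l. l p) ls) \<subseteq> topspace X" if "p \<in> topspace Q" for p
    unfolding set_map image_image using inX that by (intro image_subsetI) simp
  have letter: "continuous_map ?QI (suspension_plus X) (\<lambda>(p, t). letter_loop X (l p) t)"
    if l: "continuous_map Q (letter_topology X) l" for l
  proof -
    have c: "continuous_map ?QI (letter_topology X) (\<lambda>z. l (fst z))"
      using continuous_map_compose[OF continuous_map_fst l] by (simp add: o_def)
    have "continuous_map (letter_topology X) X snd"
      by (rule continuous_map_from_letter) simp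
    from continuous_map_compose[OF c this]
    have 1: "continuous_map ?QI X (\<lambda>z. snd (l (fst z)))"
      by (simp add: o_def)
    have "continuous_map (letter_topology X) euclideanreal (\<lambda>a. if fst a then 1 else 0)"
      by (rule continuous_map_from_letter) simp
    from continuous_map_compose[OF c this]
    have e: "continuous_map ?QI euclideanreal (\<lambda>z. if fst (l (fst z)) then 1 else 0)"
      by (simp add: o_def)
    have t: "continuous_map ?QI euclideanreal snd"
      using continuous_map_snd continuous_map_in_subtopology by blast
    \<comment> \<open>The case distinction on the orientation becomes a polynomial in its indicator,
      which is continuous because the letters form a disjoint sum.\<close>
    have "continuous_map ?QI euclideanreal
        (\<lambda>z. (if fst (l (fst z)) then 1 else 0) * snd z + (1 - (if fst (l (fst z)) then 1 else 0)) * (1 - snd z))"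
      by (intro continuous_intros e t) auto
    from continuous_map_susp_proj_Some[OF 1 this]
    have "continuous_map ?QI (suspension_plus X) (\<lambda>z. susp_proj X (Some (snd (l (fst z))),
        (if fst (l (fst z)) then 1 else 0) * snd z + (1 - (if fst (l (fst z)) then 1 else 0)) * (1 - snd z)))"
      by auto
    then show ?thesis
      by (rule continuous_map_eq) (auto simp: letter_loop_def)
  qed
  have "continuous_map ?QI (suspension_plus X) (\<lambda>(p, t). word_loop X (map (\<lambda>l. l p) ls) t)"
    using ls inX
  proof (induction ls)
    case Nil
    have "continuous_map ?QI (suspension_plus X) (\<lambda>z. suspension_base X)"
      by simp
    then show ?case
      by (rule continuous_map_eq) (auto simp: word_loop_Nil)
  next
    case (Cons l ls)
    have "letter_loop X (l p) \<in> topspace (susp_loops X)" if "p \<in> topspace Q" for p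
      using Cons.prems(2) that by (intro letter_loop_loop) simp
    moreover have "word_loop X (map (\<lambda>l. l p) ls) \<in> topspace (susp_loops X)" if "p \<in> topspace Q" for p
      unfolding set_map image_image using Cons.prems(2) that
      by (intro word_loop_loop) (simp add: image_subset_iff)
    ultimately have "letter_loop X (l p) 1 = word_loop X (map (\<lambda>l. l p) ls) 0" if "p \<in> topspace Q" for p
      using that by (simp add: loop_iff)
    with Cons show ?case
      by (simp add: continuous_map_loop_concat letter)
  qed
  then have "continuous_map Q (susp_loops X) (\<lambda>p. \<lambda>t\<in>{0..1}. word_loop X (map (\<lambda>l. l p) ls) t)"
    by (rule continuous_map_loop_family) (use word_loop_loop[OF words] in \<open>simp_all add: loop_iff\<close>)
  then show "continuous_map Q (susp_loops X) (\<lambda>p. word_loop X (map (\<lambda>l. l p) ls))"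
  proof (rule continuous_map_eq)
    fix p assume "p \<in> topspace Q"
    then show "restrict (word_loop X (map (\<lambda>l. l p) ls)) {0..1} = word_loop X (map (\<lambda>l. l p) ls)"
      using word_loop_loop[OF words] by (simp add: loop_iff extensional_restrict)
  qed
qed

lemma continuous_map_word_class:
  "continuous_map (FRP_topology X) (pi1_top (suspension_plus X) (suspension_base X)) (word_class X)"
  unfolding FRP_topology_eq
proof (rule continuous_map_from_quotient)
  have "continuous_map (monoid_topology X) (pi1_top (suspension_plus X) (suspension_base X))
      (susp_class X \<circ> word_loop X)"
    by (rule continuous_map_compose[OF continuous_map_word_loop continuous_map_loop_class])
  then show "continuous_map (monoid_topology X) (pi1_top (suspension_plus X) (suspension_base X))
      (word_class X \<circ> component_word X)"
    by (rule continuous_map_eq) (simp add: susp_class_word_loop topspace_monoid_topology)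
qed

text \<open>Locally the inverse is the component word of a word over \<open>X\<close> sampled from
  the loop. That word varies continuously in the monoid over \<open>X\<close>, and
  \<open>FRP_topology\<close> is a quotient of this monoid.\<close>

lemma continuous_map_word_class_inverse:
  "continuous_map (pi1_top (suspension_plus X) (suspension_base X)) (FRP_topology X)
     (inv_into (carrier (component_group X)) (word_class X))" (is "continuous_map _ _ ?k")
  unfolding pi1_top_def
proof (rule continuous_map_from_quotient)
  have k: "?k (susp_class X \<alpha>) \<in> carrier (component_group X)"
      "word_class X (?k (susp_class X \<alpha>)) = susp_class X \<alpha>" if "\<alpha> \<in> topspace (susp_loops X)" for \<alpha>
    using loop_class_in_range[OF that] by (rule inv_into_into, rule f_inv_into_f)
  have tr: "tracks X \<alpha> (?k (susp_class X \<alpha>))" if "\<alpha> \<in> topspace (susp_loops X)" for \<alpha>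
    by (rule tracks_if_class[OF that k(1)[OF that] k(2)[OF that, symmetric]])
  show "continuous_map (susp_loops X) (FRP_topology X) (?k \<circ> susp_class X)"
    unfolding continuous_map_def
  proof (intro conjI allI impI)
    show "?k \<circ> susp_class X \<in> topspace (susp_loops X) \<rightarrow> topspace (FRP_topology X)"
      using k(1) by (simp add: topspace_FRP_topology)
    fix U assume U: "openin (FRP_topology X) U"
    show "openin (susp_loops X) {\<alpha> \<in> topspace (susp_loops X). (?k \<circ> susp_class X) \<alpha> \<in> U}" (is "openin _ ?V")
    proof (rule openin_subopen[THEN iffD2], rule ballI)
      fix \<beta> assume "\<beta> \<in> ?V"
      then have \<beta>: "\<beta> \<in> topspace (susp_loops X)" "?k (susp_class X \<beta>) \<in> U"
        by simp_all
      obtain N L where N: "openin (susp_loops X) N" "\<beta> \<in> N"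
        "\<And>\<alpha>. \<alpha> \<in> N \<Longrightarrow> samples_inside X \<alpha> L"
        "\<And>\<alpha>. \<alpha> \<in> N \<Longrightarrow> tracks X \<alpha> (component_word X (sampled_word \<alpha> L))"
        using tracks_sampled_word[OF \<beta>(1)] by metis
      have Nsub: "N \<subseteq> topspace (susp_loops X)"
        using N(1) by (rule openin_subset)
      \<comment> \<open>Restriction to \<open>N\<close> keeps all samples in the cylinder, where
        \<open>xcoord\<close> is continuous.\<close>
      let ?S = "subtopology (susp_loops X) N"
      have "\<forall>l\<in>set (map (\<lambda>(e, t) \<alpha>. (e, xcoord (\<alpha> t))) L). continuous_map ?S (letter_topology X) l"
      proof clarsimp
        fix e t assume "(e, t) \<in> set L"
        then have t: "t \<in> {0..1}" "\<And>\<alpha>. \<alpha> \<in> N \<Longrightarrow> \<alpha> t \<in> inner_part X"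
          using N(2,3) by (auto simp: samples_inside_def)
        have "continuous_map ?S (subtopology (suspension_plus X) (inner_part X)) (\<lambda>\<alpha>. \<alpha> t)"
          using continuous_map_loop_eval[OF t(1)] t(2)
          by (intro continuous_map_into_subtopology continuous_map_from_subtopology) auto
        from continuous_map_compose[OF this continuous_map_xcoord]
        show "continuous_map ?S (letter_topology X) (\<lambda>\<alpha>. (e, xcoord (\<alpha> t)))"
          by (intro continuous_map_letter) (simp add: o_def)
      qed
      from continuous_map_into_monoid[OF this]
      have "continuous_map ?S (monoid_topology X) (\<lambda>\<alpha>. sampled_word \<alpha> L)"
        by (simp add: sampled_word_def o_def case_prod_unfold)
      from continuous_map_compose[OF this continuous_map_to_quotient]
      have "continuous_map ?S (FRP_topology X) (\<lambda>\<alpha>. component_word X (sampled_word \<alpha> L))"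
        by (simp add: FRP_topology_eq o_def)
      from openin_continuous_map_preimage[OF this U]
      have "openin (susp_loops X) {\<alpha> \<in> topspace ?S. component_word X (sampled_word \<alpha> L) \<in> U}"
        using openin_trans_full N(1) by blast
      moreover have "component_word X (sampled_word \<alpha> L) = ?k (susp_class X \<alpha>)" if "\<alpha> \<in> N" for \<alpha>
        using that Nsub by (intro tracks_unique[OF _ N(4) tr]) blast+
      ultimately show "\<exists>T. openin (susp_loops X) T \<and> \<beta> \<in> T \<and> T \<subseteq> ?V"
        using \<beta> N(2) Nsub
        by (intro exI[of _ "{\<alpha> \<in> topspace ?S. component_word X (sampled_word \<alpha> L) \<in> U}"]) auto
    qed
  qed
qed

section \<open>The homeomorphism and the comparison of the three topologies\<close>

lemma topspace_pi1_top: "topspace (pi1_top Z z) = carrier (fundamental_group Z z)"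
  by (simp add: pi1_top_def carrier_fundamental_group)

lemma homeomorphic_maps_word_class:
  "homeomorphic_maps (FRP_topology X) (pi1_top (suspension_plus X) (suspension_base X))
     (word_class X) (inv_into (carrier (component_group X)) (word_class X))"
proof -
  have bij: "bij_betw (word_class X) (carrier (component_group X)) (carrier (susp_group X))"
    using word_class_iso[of X] by (simp add: iso_def)
  show ?thesis
    unfolding homeomorphic_maps_def
    using continuous_map_word_class[of X] continuous_map_word_class_inverse[of X]
      bij_betw_inv_into_left[OF bij] bij_betw_inv_into_right[OF bij]
    by (simp add: topspace_FRP_topology topspace_pi1_top)
qed

lemma continuous_map_pi0_meridian_class:
  "continuous_map (pi0_top X) (pi1_top (suspension_plus X) (suspension_base X)) (meridian_class X)"
  unfolding pi0_top_def
proof (rule continuous_map_from_quotient)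
  have "continuous_map (prod_topology X unit_interval) euclideanreal snd"
    using continuous_map_snd continuous_map_in_subtopology by blast
  from continuous_map_susp_proj_Some[OF continuous_map_fst this]
  have "continuous_map (prod_topology X unit_interval) (suspension_plus X) (\<lambda>(x, t). susp_proj X (Some x, t))"
    by (auto simp: case_prod_unfold)
  then have "continuous_map X (susp_loops X) (meridian X)"
    unfolding meridian_def by (rule continuous_map_loop_family) auto
  from continuous_map_compose[OF this continuous_map_loop_class]
  show "continuous_map X (pi1_top (suspension_plus X) (suspension_base X))
      (meridian_class X \<circ> path_component_of_set X)"
    by (rule continuous_map_eq) (simp add: meridian_class_path_component)
qed

lemma FM_topology_eq_FRP_topology:
  assumes "topological_group (susp_group X) (pi1_top (suspension_plus X) (suspension_base X))"
  shows "FM_topology (pi0_top X) = FRP_topology X"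
proof (rule topology_eq_if_continuous_ident)
  let ?k = "inv_into (carrier (component_group X)) (word_class X)"
  \<comment> \<open>The universal property is applied to the fundamental group itself, hence the
    instance at the type of classes of loops.\<close>
  have free: "is_free_topological_group TYPE((real \<Rightarrow> ('a option \<times> real) set) set) (pi0_top X) (FM_topology (pi0_top X))"
    by (rule is_free_topological_group_FM_topology)
  note ex = free[unfolded is_free_topological_group_def, THEN conjunct2, THEN conjunct2, rule_format,
      OF conjI[OF assms continuous_map_pi0_meridian_class]]
  obtain h where "h \<in> extensional (carrier (component_group X)) \<and> h \<in> hom (component_group X) (susp_group X) \<and>
      continuous_map (FM_topology (pi0_top X)) (pi1_top (suspension_plus X) (suspension_base X)) h \<and>
      (\<forall>y\<in>topspace (pi0_top X). h (generator y) = meridian_class X y)"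
    using ex1_implies_ex[OF ex] by (rule exE)
  then have h: "h \<in> hom (component_group X) (susp_group X)"
      "continuous_map (FM_topology (pi0_top X)) (pi1_top (suspension_plus X) (suspension_base X)) h"
      "\<And>y. y \<in> topspace (pi0_top X) \<Longrightarrow> h (generator y) = meridian_class X y"
    by simp_all
  have "h w = word_class X w" if "w \<in> carrier (component_group X)" for w
    unfolding word_class_def
    by (rule hom_eq_word_eval[OF group_susp_group meridian_class_closed h(1,3) that])
  then have kh: "?k (h w) = w" if "w \<in> carrier (component_group X)" for w
    using that word_class_iso[of X] by (auto simp: iso_def bij_betw_def inv_into_f_f)
  from continuous_map_compose[OF h(2) continuous_map_word_class_inverse]
  show "continuous_map (FM_topology (pi0_top X)) (FRP_topology X) (\<lambda>w. w)"
    by (rule continuous_map_eq) (simp add: kh topspace_FM_topology)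
  show "continuous_map (FRP_topology X) (FM_topology (pi0_top X)) (\<lambda>w. w)"
    using continuous_map_compose[OF continuous_map_FRP_FR continuous_map_FR_FM] by (simp add: o_def)
qed (simp add: topspace_FM_topology topspace_FRP_topology)

text \<open>The identities from \<open>FRP_topology\<close> through \<open>FR_topology\<close> to
  \<open>FM_topology\<close> are continuous, so equality of the outer two forces the middle one to
  agree.\<close>

lemma quotient_topologies_eq:
  assumes "FM_topology (pi0_top X) = FRP_topology X"
  shows "FR_topology (pi0_top X) = FM_topology (pi0_top X)" "FRP_topology X = FR_topology (pi0_top X)"
proof -
  show "FRP_topology X = FR_topology (pi0_top X)"
    using continuous_map_FRP_FR[of X] continuous_map_FR_FM[of "pi0_top X"] assms
    by (intro topology_eq_if_continuous_ident) (simp_all add: topspace_FRP_topology topspace_FR_topology)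
  then show "FR_topology (pi0_top X) = FM_topology (pi0_top X)"
    using assms by simp
qed

lemma topologically_isomorphic_if_FM_eq_FRP:
  assumes "FM_topology (pi0_top X) = FRP_topology X"
  shows "topologically_isomorphic (susp_group X) (pi1_top (suspension_plus X) (suspension_base X))
           (component_group X) (FM_topology (pi0_top X))"
proof -
  have "inv_into (carrier (component_group X)) (word_class X) \<in> iso (susp_group X) (component_group X)"
    by (rule group.iso_set_sym[OF group_free_group word_class_iso])
  moreover have "homeomorphic_map (pi1_top (suspension_plus X) (suspension_base X)) (FRP_topology X)
      (inv_into (carrier (component_group X)) (word_class X))"
    using homeomorphic_maps_word_class homeomorphic_maps_sym homeomorphic_maps_imp_map by blast
  ultimately show ?thesis
    unfolding topologically_isomorphic_def topological_isomorphism_def assms by blast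
qed

theorem corollary2p29:
  fixes X :: "'a topology"
  shows
    "(topological_group
        (fundamental_group (suspension_plus X) (suspension_base X))
        (pi1_top (suspension_plus X) (suspension_base X)) \<longleftrightarrow>
      topologically_isomorphic
        (fundamental_group (suspension_plus X) (suspension_base X))
        (pi1_top (suspension_plus X) (suspension_base X))
        (free_group (topspace (pi0_top X))) (FM_topology (pi0_top X)))
     \<and>
     (topologically_isomorphic
        (fundamental_group (suspension_plus X) (suspension_base X))
        (pi1_top (suspension_plus X) (suspension_base X))
        (free_group (topspace (pi0_top X))) (FM_topology (pi0_top X)) \<longleftrightarrow>
      topological_isomorphism
        (free_group (topspace (pi0_top X))) (FR_topology (pi0_top X))
        (free_group (topspace (pi0_top X))) (FM_topology (pi0_top X)) (\<lambda>w. w) \<and>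
      topological_isomorphism
        (free_group (topspace (pi0_top X))) (FRP_topology X)
        (free_group (topspace (pi0_top X))) (FR_topology (pi0_top X)) (\<lambda>w. w))"
    (is "(?A \<longleftrightarrow> ?B) \<and> (?B \<longleftrightarrow> ?C \<and> ?D)")
proof -
  have AE: "FM_topology (pi0_top X) = FRP_topology X" if ?A
    using that by (rule FM_topology_eq_FRP_topology)
  have EB: ?B if "FM_topology (pi0_top X) = FRP_topology X"
    using that by (rule topologically_isomorphic_if_FM_eq_FRP)
  \<comment> \<open>\<open>FM_topology\<close> is a group topology by construction, and an
    isomorphism transports this property back.\<close>
  have BA: ?A if B: ?B
  proof -
    obtain h where "topological_isomorphism (susp_group X) (pi1_top (suspension_plus X) (suspension_base X))
        (component_group X) (FM_topology (pi0_top X)) h"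
      using B unfolding topologically_isomorphic_def by (rule exE)
    moreover have "topological_group (component_group X) (FM_topology (pi0_top X))"
      using is_free_topological_group_FM_topology[of "pi0_top X", where 'g = unit]
      unfolding is_free_topological_group_def by (rule conjunct1)
    ultimately show ?thesis
      by (rule topological_group_iso[OF _ group_susp_group topspace_pi1_top])
  qed
  \<comment> \<open>The third condition reads \<open>FR = FM\<close> and \<open>FRP = FR\<close> as
    topologies; by the sandwich this is the single equation through which the three conditions are
    linked.\<close>
  have CD: "?C \<and> ?D \<longleftrightarrow> FM_topology (pi0_top X) = FRP_topology X"
    unfolding topological_isomorphism_ident_iff using quotient_topologies_eq[of X] by auto
  show ?thesis
    using AE EB BA CD by blast
qed

end
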